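(* Assume that $\mathcal{D}(M)\subset_c\mathcal{D}(A)$ and let $0\le\tau\le 1$. If $\sigma\ge\tau$ and the eigenvectors $u_1,u_2,\dots,u_\ell$ of $A$ are all in $\mathcal{D}(M^\sigma)$, then $$\Lambda_j^{(n,\tau)}=\lambda_j+o\big(\mu_{n+1}^{2\tau-2\sigma}\big),\qquad 1\le j\le\ell,$$ and, for all large $n$, there exist eigenvectors $u_{j,n}$ of $A$ in the $\lambda_j$-eigenspace, normalized in $\mathcal{H}_{\tau-1/2}$, such that $$\|u_{j,n}-u_j^{(n,\tau)}\|_\tau=o\big(\mu_{n+1}^{\tau-\sigma}\big),\qquad 1\le j\le\ell,$$ both as $n\to\infty$.
   Context: $\mathcal{H}=\mathcal{H}_0$ is a separable complex Hilbert space with inner product $\langle\cdot,\cdot\rangle$ and norm $\|\cdot\|=\|\cdot\|_0$. $A$ is a selfadjoint operator in $\mathcal{H}$ that is positive definite ($\langle Au,u\rangle\ge\alpha\|u\|^2$ for $u\in\mathcal{D}(A)$, some $\alpha>0$), and the lower part of its spectrum consists of isolated eigenvalues of finite multiplicity $0<\lambda_1\le\lambda_2\le\dots$ (counted with multiplicity) lying below $\lambda_\infty$, the least point of the essential spectrum ($\lambda_\infty=\infty$ if $A^{-1}$ is compact), with corresponding orthonormal eigenvectors $u_1,u_2,\dots$. The eigenpairs with indices $1,\dots,\ell$ are among these. $T=A^{-1}$. For real $\tau$, $\mathcal{H}_\tau=\mathcal{D}(A^\tau)$ with inner product $\langle u,v\rangle_\tau=\langle A^\tau u,A^\tau v\rangle$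 and norm $\|u\|_\tau=\|A^\tau u\|$; for $\tau<0$ it is the completion of $\mathcal{H}$ in that norm. $T$ acts as a bounded selfadjoint operator in each $\mathcal{H}_\tau$. $\mathcal{G}_0$ is a Hilbert space consisting of the same elements as $\mathcal{H}_0$ with an equivalent norm; its inner product and norm are $(\cdot,\cdot)_0$ and $|\cdot|_0$. $M$ is a positive definite selfadjoint operator in $\mathcal{G}_0$ with $M^{-1}$ compact, with eigenvalues $0<\mu_1\le\mu_2\le\dots\to\infty$ (counted with multiplicity) and corresponding eigenvectors $q_1,q_2,\dots$ orthonormal in $\mathcal{G}_0$. For $s\ge0$, $\mathcal{D}(M^s)$ carries the norm $|M^sv|_0$. $\mathcal{V}_1\subset_c\mathcal{V}_0$ means $\mathcal{V}_1\subset\mathcal{V}_0$ with continuous injection. Rayleigh–Ritz method in $\mathcal{H}_\tau$ with trial vectors $q_k$: $\Lambda_1^{(n,\tau)}\le\dots\le\Lambda_n^{(n,\tau)}$ are the eigenvalues of $[\langle q_i,q_j\rangle_\tau]_{i,j=1}^n\mathbf{x}=\Lambda[\langle Tq_i,q_j\rangle_\tau]_{i,j=1}^n\mathbf{x}$, and $u_1^{(n,\tau)},\dots,u_n^{(n,\tau)}\in\mathrm{span}\{q_1,\dots,q_n\}$ are the corresponding eigenvectors normalized so that $\langle u_i^{(n,\tau)},u_j^{(n,\tau)}\rangle_{\tau-1/2}=\delta_{ij}$ and $\langle u_i^{(n,\tau)},u_j^{(n,\tau)}\rangle_\tau=\Lambda_i^{(n,\tau)}\delta_{ij}$. *)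

theory Defs
  imports "HOL-Analysis.Analysis" "HOL-Library.Landau_Symbols"
begin

section \<open>Complex Hilbert spaces\<close>

text \<open>
  Inner products are antilinear in the first and linear in the second argument. The norm, the
  topology and positive definiteness come from the underlying real Hilbert space.
\<close>

class complex_hilbert = real_inner + complete_space +
  fixes scaleC :: "complex \<Rightarrow> 'a \<Rightarrow> 'a"  (infixr "*\<^sub>C" 75)
    and cinner :: "'a \<Rightarrow> 'a \<Rightarrow> complex"
  assumes scaleC_add_right: "a *\<^sub>C (x + y) = a *\<^sub>C x + a *\<^sub>C y"
    and scaleC_add_left: "(a + b) *\<^sub>C x = a *\<^sub>C x + b *\<^sub>C x"
    and scaleC_scaleC: "a *\<^sub>C b *\<^sub>C x = (a * b) *\<^sub>C x"
    and scaleR_scaleC: "scaleR r x = complex_of_real r *\<^sub>C x"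
    and cinner_commute: "cinner x y = cnj (cinner y x)"
    and cinner_add_right: "cinner x (y + z) = cinner x y + cinner x z"
    and cinner_scaleC_right: "cinner x (a *\<^sub>C y) = a * cinner x y"
    and inner_eq_Re_cinner: "inner x y = Re (cinner x y)"

lemma scaleC_one: "1 *\<^sub>C (x :: 'a :: complex_hilbert) = x"
  using scaleR_scaleC[of 1 x] by simp

global_interpretation complex_vector:
  vector_space "scaleC :: complex \<Rightarrow> 'a \<Rightarrow> 'a :: complex_hilbert"
  defines csubspace = complex_vector.subspace
    and cspan = complex_vector.span
  by unfold_locales (simp_all add: scaleC_add_right scaleC_add_left scaleC_scaleC scaleC_one)

definition is_cinner :: "('a::complex_hilbert \<Rightarrow> 'a \<Rightarrow> complex) \<Rightarrow> bool" where
  "is_cinner g \<longleftrightarrow>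
     (\<forall>x y z. g x (y + z) = g x y + g x z) \<and>
     (\<forall>x y a. g x (a *\<^sub>C y) = a * g x y) \<and>
     (\<forall>x y. g x y = cnj (g y x)) \<and>
     (\<forall>x. x \<noteq> 0 \<longrightarrow> 0 < Re (g x x))"

definition cnorm :: "('a \<Rightarrow> 'a \<Rightarrow> complex) \<Rightarrow> 'a \<Rightarrow> real" where
  "cnorm g x = sqrt (Re (g x x))"

text \<open>
  An inner product whose norm is equivalent to the ambient one has the same topology and Cauchy
  sequences, so the space is again a Hilbert space with respect to it.
\<close>

definition equivalent_cinner :: "('a::complex_hilbert \<Rightarrow> 'a \<Rightarrow> complex) \<Rightarrow> bool" where
  "equivalent_cinner g \<longleftrightarrow> is_cinner g \<and>
     (\<exists>c>0. \<exists>C>0. \<forall>x. c * norm x \<le> cnorm g x \<and> cnorm g x \<le> C * norm x)"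

section \<open>Unbounded operators\<close>

text \<open>
  An operator is given by its domain \<open>D\<close> and a function \<open>S\<close>, of which only the values on \<open>D\<close>
  matter; \<open>g\<close> is the inner product with respect to which it is considered.
\<close>

definition clinear_on :: "'a::complex_hilbert set \<Rightarrow> ('a \<Rightarrow> 'a) \<Rightarrow> bool" where
  "clinear_on D S \<longleftrightarrow> csubspace D \<and>
     (\<forall>x\<in>D. \<forall>y\<in>D. S (x + y) = S x + S y) \<and> (\<forall>a. \<forall>x\<in>D. S (a *\<^sub>C x) = a *\<^sub>C S x)"

text \<open>The last conjunct says that the graph of \<open>S\<close> is the graph of its adjoint.\<close>

definition selfadjoint_op ::
  "('a::complex_hilbert \<Rightarrow> 'a \<Rightarrow> complex) \<Rightarrow> 'a set \<Rightarrow> ('a \<Rightarrow> 'a) \<Rightarrow> bool" where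
  "selfadjoint_op g D S \<longleftrightarrow> clinear_on D S \<and> closure D = UNIV \<and>
     (\<forall>x y. (x \<in> D \<and> S x = y) \<longleftrightarrow> (\<forall>z\<in>D. g y z = g x (S z)))"

definition posdef_op ::
  "('a::complex_hilbert \<Rightarrow> 'a \<Rightarrow> complex) \<Rightarrow> 'a set \<Rightarrow> ('a \<Rightarrow> 'a) \<Rightarrow> bool" where
  "posdef_op g D S \<longleftrightarrow> (\<exists>\<alpha>>0. \<forall>x\<in>D. Re (g (S x) x) \<ge> \<alpha> * (cnorm g x)\<^sup>2)"

definition compact_map :: "('a::metric_space \<Rightarrow> 'a) \<Rightarrow> bool" where
  "compact_map K \<longleftrightarrow> (\<forall>B. bounded B \<longrightarrow> compact (closure (K ` B)))"

definition eigenspace ::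
  "'a::complex_hilbert set \<Rightarrow> ('a \<Rightarrow> 'a) \<Rightarrow> complex \<Rightarrow> 'a set" where
  "eigenspace D S z = {x \<in> D. S x = z *\<^sub>C x}"

definition resolvent_set :: "'a::complex_hilbert set \<Rightarrow> ('a \<Rightarrow> 'a) \<Rightarrow> complex set" where
  "resolvent_set D S = {z. bij_betw (\<lambda>x. S x - z *\<^sub>C x) D UNIV \<and>
     (\<exists>K. \<forall>x\<in>D. norm x \<le> K * norm (S x - z *\<^sub>C x))}"

definition spectrum_op :: "'a::complex_hilbert set \<Rightarrow> ('a \<Rightarrow> 'a) \<Rightarrow> complex set" where
  "spectrum_op D S = - resolvent_set D S"

text \<open>
  The essential spectrum of a selfadjoint operator: the spectrum without the isolated eigenvalues of
  finite multiplicity.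
\<close>

definition essential_spectrum :: "'a::complex_hilbert set \<Rightarrow> ('a \<Rightarrow> 'a) \<Rightarrow> complex set" where
  "essential_spectrum D S = spectrum_op D S -
     {z. z isolated_in spectrum_op D S \<and> eigenspace D S z \<noteq> {0} \<and>
         (\<exists>B. finite B \<and> eigenspace D S z \<subseteq> cspan B)}"

definition essential_bottom :: "'a::complex_hilbert set \<Rightarrow> ('a \<Rightarrow> 'a) \<Rightarrow> ereal" where
  "essential_bottom D S = (INF z\<in>essential_spectrum D S. ereal (Re z))"

text \<open>
  \<open>lam\<close> lists, over the index set \<open>I\<close>, the eigenvalues below \<open>b\<close> in nondecreasing order with their
  multiplicities, and \<open>u\<close> is a corresponding orthonormal system of eigenvectors. Completeness of the
  list and the multiplicities are both expressed by the last conjunct: the vectors listed for \<open>t\<close>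
  span the whole \<open>t\<close>-eigenspace.
\<close>

definition eigenpair_listing ::
  "('a::complex_hilbert \<Rightarrow> 'a \<Rightarrow> complex) \<Rightarrow> 'a set \<Rightarrow> ('a \<Rightarrow> 'a) \<Rightarrow> ereal \<Rightarrow> nat set \<Rightarrow>
     (nat \<Rightarrow> real) \<Rightarrow> (nat \<Rightarrow> 'a) \<Rightarrow> bool" where
  "eigenpair_listing g D S b I lam u \<longleftrightarrow>
     (\<forall>i\<in>I. u i \<in> eigenspace D S (complex_of_real (lam i)) \<and> 0 < lam i \<and> ereal (lam i) < b) \<and>
     (\<forall>i\<in>I. \<forall>j\<in>I. g (u i) (u j) = (if i = j then 1 else 0)) \<and>
     mono_on I lam \<and>
     (\<forall>t. ereal t < b \<longrightarrow> eigenspace D S (complex_of_real t) = cspan (u ` {i \<in> I. lam i = t}))"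

section \<open>Spectral families and real powers\<close>

text \<open>Right-continuous resolutions of the identity by \<open>g\<close>-orthogonal projections.\<close>

definition spectral_family ::
  "('a::complex_hilbert \<Rightarrow> 'a \<Rightarrow> complex) \<Rightarrow> (real \<Rightarrow> 'a \<Rightarrow> 'a) \<Rightarrow> bool" where
  "spectral_family g E \<longleftrightarrow>
     (\<forall>t. clinear_on UNIV (E t) \<and> (\<forall>x. E t (E t x) = E t x) \<and>
          (\<forall>x y. g (E t x) y = g x (E t y))) \<and>
     (\<forall>s t x. s \<le> t \<longrightarrow> E s (E t x) = E s x) \<and>
     (\<forall>t x. ((\<lambda>s. E s x) \<longlongrightarrow> E t x) (at_right t)) \<and>
     (\<forall>x. ((\<lambda>s. E s x) \<longlongrightarrow> 0) at_bot) \<and>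
     (\<forall>x. ((\<lambda>s. E s x) \<longlongrightarrow> x) at_top)"

text \<open>The Stieltjes measure of the function mapping \<open>t\<close> to \<open>\<langle>E t x, x\<rangle>\<close>.\<close>

definition spectral_measure ::
  "('a \<Rightarrow> 'a \<Rightarrow> complex) \<Rightarrow> (real \<Rightarrow> 'a \<Rightarrow> 'a) \<Rightarrow> 'a \<Rightarrow> real measure" where
  "spectral_measure g E x = interval_measure (\<lambda>t. Re (g (E t x) x))"

definition spectral_dom ::
  "('a \<Rightarrow> 'a \<Rightarrow> complex) \<Rightarrow> (real \<Rightarrow> 'a \<Rightarrow> 'a) \<Rightarrow> (real \<Rightarrow> real) \<Rightarrow> 'a set" where
  "spectral_dom g E f = {x. integrable (spectral_measure g E x) (\<lambda>t. (f t)\<^sup>2)}"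

text \<open>
  The operator with domain \<open>D\<close> and action \<open>S\<close> is the integral of \<open>f\<close> with respect to \<open>E\<close>. By
  polarization, the linear \<open>S\<close> is determined on \<open>D\<close> by its quadratic form.
\<close>

definition is_spectral_integral ::
  "('a::complex_hilbert \<Rightarrow> 'a \<Rightarrow> complex) \<Rightarrow> (real \<Rightarrow> 'a \<Rightarrow> 'a) \<Rightarrow> (real \<Rightarrow> real) \<Rightarrow>
     'a set \<Rightarrow> ('a \<Rightarrow> 'a) \<Rightarrow> bool" where
  "is_spectral_integral g E f D S \<longleftrightarrow> D = spectral_dom g E f \<and> clinear_on D S \<and>
     (\<forall>x\<in>D. g (S x) x = complex_of_real (\<integral>t. f t \<partial>spectral_measure g E x))"

text \<open>The spectral theorem gives existence and uniqueness for selfadjoint operators.\<close>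

definition spectral_family_of ::
  "('a::complex_hilbert \<Rightarrow> 'a \<Rightarrow> complex) \<Rightarrow> 'a set \<Rightarrow> ('a \<Rightarrow> 'a) \<Rightarrow> real \<Rightarrow> 'a \<Rightarrow> 'a" where
  "spectral_family_of g D S =
     (SOME E. spectral_family g E \<and> is_spectral_integral g E (\<lambda>t. t) D S)"

text \<open>
  Real powers of a positive definite selfadjoint operator by functional calculus. Its spectral
  measures live on a half-line \<open>{\<alpha>..}\<close> with \<open>\<alpha> > 0\<close>, so the values of \<open>powr\<close> at nonpositive
  arguments are irrelevant. For a nonpositive exponent the domain is the whole space.
\<close>

definition power_dom ::
  "('a::complex_hilbert \<Rightarrow> 'a \<Rightarrow> complex) \<Rightarrow> 'a set \<Rightarrow> ('a \<Rightarrow> 'a) \<Rightarrow> real \<Rightarrow> 'a set" where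
  "power_dom g D S r = spectral_dom g (spectral_family_of g D S) (\<lambda>t. t powr r)"

definition power_op ::
  "('a::complex_hilbert \<Rightarrow> 'a \<Rightarrow> complex) \<Rightarrow> 'a set \<Rightarrow> ('a \<Rightarrow> 'a) \<Rightarrow> real \<Rightarrow> 'a \<Rightarrow> 'a" where
  "power_op g D S r =
     (SOME R. is_spectral_integral g (spectral_family_of g D S) (\<lambda>t. t powr r) (power_dom g D S r) R)"

text \<open>
  Inner product and norm of the scale of spaces \<open>\<H>\<^sub>r\<close> generated by \<open>A\<close> with domain \<open>DA\<close>, on the
  elements of the original space that lie in the domain of the power. For \<open>r < 0\<close> these are all
  elements of the original space, which is dense in \<open>\<H>\<^sub>r\<close>.
\<close>

definition scale_inner ::
  "'a::complex_hilbert set \<Rightarrow> ('a \<Rightarrow> 'a) \<Rightarrow> real \<Rightarrow> 'a \<Rightarrow> 'a \<Rightarrow> complex" where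
  "scale_inner DA A r x y = cinner (power_op cinner DA A r x) (power_op cinner DA A r y)"

definition scale_norm :: "'a::complex_hilbert set \<Rightarrow> ('a \<Rightarrow> 'a) \<Rightarrow> real \<Rightarrow> 'a \<Rightarrow> real" where
  "scale_norm DA A r x = norm (power_op cinner DA A r x)"

definition continuously_embedded ::
  "'a set \<Rightarrow> ('a \<Rightarrow> real) \<Rightarrow> 'a set \<Rightarrow> ('a \<Rightarrow> real) \<Rightarrow> bool" where
  "continuously_embedded V1 n1 V0 n0 \<longleftrightarrow> V1 \<subseteq> V0 \<and> (\<exists>C. \<forall>x\<in>V1. n0 x \<le> C * n1 x)"

section \<open>The Rayleigh--Ritz method\<close>

text \<open>
  \<open>L 1 \<le> \<dots> \<le> L n\<close> are the eigenvalues of the matrix pencil formed by the Gram matrices of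
  \<open>q 1, \<dots>, q n\<close>, with coefficient vectors \<open>c\<close> and associated vectors \<open>v i\<close> in the span of the
  \<open>q k\<close>. Since the \<open>v i\<close> are orthonormal in \<open>\<H>\<close> with index \<open>r - 1/2\<close>, hence linearly independent,
  the \<open>n\<close> values \<open>L i\<close> exhaust the eigenvalues of the pencil with their multiplicities.
\<close>

definition rayleigh_ritz ::
  "'a::complex_hilbert set \<Rightarrow> ('a \<Rightarrow> 'a) \<Rightarrow> real \<Rightarrow> (nat \<Rightarrow> 'a) \<Rightarrow> nat \<Rightarrow>
     (nat \<Rightarrow> real) \<Rightarrow> (nat \<Rightarrow> 'a) \<Rightarrow> bool" where
  "rayleigh_ritz DA A r q n L v \<longleftrightarrow>
     mono_on {1..n} L \<and>
     (\<forall>i\<in>{1..n}. \<exists>c :: nat \<Rightarrow> complex.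
        (\<forall>k\<in>{1..n}. (\<Sum>m=1..n. scale_inner DA A r (q k) (q m) * c m) =
           complex_of_real (L i) *
             (\<Sum>m=1..n. scale_inner DA A r (inv_into DA A (q k)) (q m) * c m)) \<and>
        v i = (\<Sum>m=1..n. c m *\<^sub>C q m)) \<and>
     (\<forall>i\<in>{1..n}. \<forall>j\<in>{1..n}.
        scale_inner DA A (r - 1/2) (v i) (v j) = (if i = j then 1 else 0) \<and>
        scale_inner DA A r (v i) (v j) = (if i = j then complex_of_real (L i) else 0))"

end

theory Submission
  imports Defs
begin

text \<open>
  The powers of \<open>A\<close> and \<open>M\<close> only enter through the measures \<open>\<nu>\<^sub>x\<close> with
  \<open>\<nu>\<^sub>x {a<..b} = \<langle>(E b - E a) x, x\<rangle>\<close>, whose existence is the spectral theorem; it is obtained from the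
  projections \<open>E t\<close> onto the nonpositive part of the bounded operator \<open>1 - t A\<^sup>-\<^sup>1\<close>.

  Put \<open>s = \<mu>\<^bsub>n+1\<^esub> / 2\<close>. Since \<open>M\<^sup>-\<^sup>1\<close> is compact, the spectral projection of \<open>M\<close> for \<open>{..s}\<close> maps into the
  span of \<open>q 1, \<dots>, q n\<close>, and on its complement \<open>|M\<^sup>\<tau> x|\<close> is at most \<open>s\<^bsup>\<tau>-\<sigma>\<^esup>\<close> times the tail of
  \<open>|M\<^sup>\<sigma> x|\<close>. The Heinz inequality \<open>\<parallel>A\<^sup>\<tau> x\<parallel> \<le> C |M\<^sup>\<tau> x|\<close> thus bounds the distance of
  \<open>u 1, \<dots>, u l\<close> from the trial space in \<open>\<H>\<^sub>\<tau>\<close> by \<open>o(\<mu>\<^bsub>n+1\<^esub>\<^bsup>\<tau>-\<sigma>\<^esup>)\<close>, and so it bounds the errors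
  \<open>e i\<close> of the \<open>\<H>\<^sub>\<tau>\<close>-orthogonal projection of \<open>u i\<close>.

  The minimax principle gives \<open>0 \<le> \<Lambda>\<^sub>j - \<lambda>\<^sub>j \<le> C (\<parallel>e 1\<parallel>\<^sup>2 + \<dots> + \<parallel>e l\<parallel>\<^sup>2)\<close>. For \<open>\<lambda>\<^sub>k < \<lambda>\<^sub>j\<close> the identity
  \<open>(\<Lambda>\<^sub>j - \<lambda>\<^sub>k) \<langle>u k, v j\<rangle> = \<Lambda>\<^sub>j \<langle>e k, v j\<rangle>\<close> in \<open>\<H>\<^bsub>\<tau>-1/2\<^esub>\<close> makes the lower components of the
  Ritz vector \<open>v j\<close> small, and its component above \<open>\<lambda>\<^sub>j\<close> is small because its Rayleigh quotient is
  close to \<open>\<lambda>\<^sub>j\<close>. Hence \<open>v j\<close> is close to the eigenspace, even if only a part of the eigenvectors of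
  \<open>\<lambda>\<^sub>j\<close> is regular.
\<close>

section \<open>Bounded symmetric operators\<close>


text \<open>The powers are defined by a choice of a spectral family and of an operator known through
  its quadratic form. Existence must come before any statement about \<open>power_op\<close>;
  afterwards only the defining properties of the chosen objects are available, and polarization
  recovers an operator from its form. The matrix pencil is that of the two forms \<open>a\<close>
  and \<open>b\<close> with indices tau and tau - 1/2, because applying \<open>T\<close> in the
  first argument lowers the index of the inner product by 1/2. Eigenvectors satisfy
  \<open>a (u i) x = lam i * b (u i) x\<close>, and in the eigenvalue bound the errors occur only in
  products \<open>a (e i) (e k)\<close>; this doubles the rate. The little o comes from the tail of
  a convergent integral. For the eigenvectors the obstacle is that the eigenspace of
  \<open>lam j\<close> may exceed the span of the vectors with index up to \<open>l\<close>. The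
  comparison vector is therefore the image of the Ritz vector, stripped of its lower components,
  under the spectral projection for \<open>lam j\<close>. What remains lives above the next spectral
  gap, which exists because \<open>lam j\<close> is below the essential spectrum.\<close>

lemma quadratic_nonneg_discriminant:
  fixes a b c :: real
  assumes "a \<ge> 0" "c \<ge> 0" and quad: "\<And>r. 0 \<le> a - 2 * r * b + r\<^sup>2 * c"
  shows "b\<^sup>2 \<le> a * c"
proof (cases "c = 0")
  case True
  have "b = 0"
  proof (rule ccontr)
    assume "b \<noteq> 0"
    \<comment> \<open>Without the quadratic term the expression is affine in \<open>r\<close>; at
      this point it takes the value -1.\<close>
    with quad[of "(a + 1) / (2 * b)"] True show False by simp
  qed
  thus ?thesis using True by simp
next
  case False
  have "0 \<le> a - 2 * (b / c) * b + (b / c)\<^sup>2 * c" by (rule quad)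
  also have "\<dots> = (a * c - b\<^sup>2) / c" using False by (simp add: field_simps power2_eq_square)
  finally show ?thesis using False assms(2) by (simp add: zero_le_divide_iff)
qed

text \<open>The two Hilbert spaces share their elements and topology but not the inner product, so
  the inner product is a parameter. The theory is instantiated with \<open>cinner\<close> for
  \<open>A\<close> and with \<open>ipG\<close> for \<open>M\<close>.\<close>

locale equiv_inner =
  fixes g :: "'a::complex_hilbert \<Rightarrow> 'a \<Rightarrow> complex"
  assumes equivalent: "equivalent_cinner g"
begin

text \<open>The real part suffices for norms, order and convergence. Imaginary parts return as
  \<open>Im (g x y) = - ip x (\<i> *\<^sub>C y)\<close>, so a complex statement reduces to real ones
  for two vectors.\<close>

definition ip :: "'a \<Rightarrow> 'a \<Rightarrow> real" where "ip x y = Re (g x y)"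

lemma is_cinner: "is_cinner g"
  using equivalent unfolding equivalent_cinner_def by simp

lemma g_add_right: "g x (y + z) = g x y + g x z"
  and g_scaleC_right: "g x (a *\<^sub>C y) = a * g x y"
  and g_commute: "g x y = cnj (g y x)"
  using is_cinner unfolding is_cinner_def by blast+

lemma g_add_left: "g (x + y) z = g x z + g y z"
  by (metis complex_cnj_add g_add_right g_commute)

lemma g_scaleC_left: "g (a *\<^sub>C x) y = cnj a * g x y"
  by (metis complex_cnj_mult g_scaleC_right g_commute)

lemma g_zero_right [simp]: "g x 0 = 0"
  using g_add_right[of x 0 0] by simp

lemma g_zero_left [simp]: "g 0 x = 0"
  using g_add_left[of 0 0 x] by simp

lemma g_minus_right: "g x (- y) = - g x y"
  using g_add_right[of x y "- y"] by (simp add: eq_neg_iff_add_eq_0 add.commute)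

lemma g_minus_left: "g (- x) y = - g x y"
  using g_add_left[of x "- x" y] by (simp add: eq_neg_iff_add_eq_0 add.commute)

lemma g_diff_right: "g x (y - z) = g x y - g x z"
  using g_add_right[of x y "- z"] by (simp add: g_minus_right)

lemma g_diff_left: "g (x - y) z = g x z - g y z"
  using g_add_left[of x "- y" z] by (simp add: g_minus_left)

lemma ip_commute: "ip x y = ip y x"
  unfolding ip_def by (subst g_commute) simp

lemma ip_add_right: "ip x (y + z) = ip x y + ip x z"
  and ip_add_left: "ip (x + y) z = ip x z + ip y z"
  and ip_diff_right: "ip x (y - z) = ip x y - ip x z"
  and ip_diff_left: "ip (x - y) z = ip x z - ip y z"
  and ip_minus_right: "ip x (- y) = - ip x y"
  and ip_minus_left: "ip (- x) y = - ip x y"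
  and ip_zero_right [simp]: "ip x 0 = 0"
  and ip_zero_left [simp]: "ip 0 x = 0"
  unfolding ip_def by (simp_all add: g_add_right g_add_left g_diff_left g_diff_right g_minus_left g_minus_right)

lemma ip_scaleR_right: "ip x (r *\<^sub>R y) = r * ip x y"
  and ip_scaleR_left: "ip (r *\<^sub>R x) y = r * ip x y"
  unfolding ip_def by (simp_all add: scaleR_scaleC g_scaleC_left g_scaleC_right)

lemmas ip_simps = ip_add_right ip_add_left ip_diff_right ip_diff_left ip_minus_right ip_minus_left
  ip_scaleR_right ip_scaleR_left

lemma g_sum_left: "g (\<Sum>k\<in>K. F k) y = (\<Sum>k\<in>K. g (F k) y)"
  by (induction K rule: infinite_finite_induct) (simp_all add: g_add_left)

lemma g_sum_right: "g y (\<Sum>k\<in>K. F k) = (\<Sum>k\<in>K. g y (F k))"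
  by (induction K rule: infinite_finite_induct) (simp_all add: g_add_right)

lemma ip_sum_left: "ip (\<Sum>k\<in>K. F k) y = (\<Sum>k\<in>K. ip (F k) y)"
  by (induction K rule: infinite_finite_induct) (simp_all add: ip_simps)

lemma ip_sum_right: "ip y (\<Sum>k\<in>K. F k) = (\<Sum>k\<in>K. ip y (F k))"
  by (induction K rule: infinite_finite_induct) (simp_all add: ip_simps)

lemma ip_pos: "x \<noteq> 0 \<Longrightarrow> 0 < ip x x"
  using is_cinner unfolding is_cinner_def ip_def by blast

lemma ip_nonneg [simp]: "0 \<le> ip x x"
  using ip_pos[of x] by (cases "x = 0") auto

lemma ip_eq_0 [simp]: "ip x x = 0 \<longleftrightarrow> x = 0"
  using ip_pos[of x] by force

lemma g_self: "g x x = complex_of_real (ip x x)"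
proof -
  have "Im (g x x) = 0" using g_commute[of x x] by (metis complex_cnj_cancel_iff complex_In_mult_cnj_zero
      cnj.simps(2) equal_neg_zero)
  thus ?thesis by (simp add: complex_eq_iff ip_def)
qed

lemma cnorm_eq: "cnorm g x = sqrt (ip x x)"
  by (simp add: cnorm_def ip_def)

lemma cnorm_power2: "(cnorm g x)\<^sup>2 = ip x x"
  by (simp add: cnorm_eq)

lemma cnorm_nonneg [simp]: "0 \<le> cnorm g x"
  by (simp add: cnorm_eq)

lemma cnorm_eq_0 [simp]: "cnorm g x = 0 \<longleftrightarrow> x = 0"
  by (simp add: cnorm_eq)

lemma bounds_ex: "\<exists>c>0. \<exists>C>0. \<forall>x. c * norm x \<le> cnorm g x \<and> cnorm g x \<le> C * norm x"
  using equivalent unfolding equivalent_cinner_def by blast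

lemma ip_CS: "(ip x y)\<^sup>2 \<le> ip x x * ip y y"
proof (cases "y = 0")
  case False
  have "0 \<le> ip (ip y y *\<^sub>R x - ip x y *\<^sub>R y) (ip y y *\<^sub>R x - ip x y *\<^sub>R y)" by simp
  also have "\<dots> = ip y y * (ip x x * ip y y - (ip x y)\<^sup>2)"
    by (simp add: ip_simps ip_commute[of y x] power2_eq_square algebra_simps)
  finally show ?thesis using ip_pos[OF False] by (simp add: zero_le_mult_iff)
qed simp

lemma ip_CS_abs: "\<bar>ip x y\<bar> \<le> cnorm g x * cnorm g y"
  unfolding cnorm_eq real_sqrt_mult[symmetric]
  by (rule real_le_rsqrt) (simp add: ip_CS)

lemma cnorm_scaleR: "cnorm g (r *\<^sub>R x) = \<bar>r\<bar> * cnorm g x"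
  by (simp add: cnorm_eq ip_simps real_sqrt_mult)

lemma ip_triangle2: "ip (x + y) (x + y) \<le> 2 * ip x x + 2 * ip y y"
proof -
  have "0 \<le> ip (x - y) (x - y)" by simp
  thus ?thesis by (simp add: ip_simps ip_commute[of y x])
qed

lemma bounded_bilinear_ip: "bounded_bilinear ip"
proof
  obtain C where C: "C > 0" "\<And>x. cnorm g x \<le> C * norm x" using bounds_ex by blast
  have "norm (ip x y) \<le> norm x * norm y * (C * C)" for x y
  proof -
    have "\<bar>ip x y\<bar> \<le> cnorm g x * cnorm g y" by (rule ip_CS_abs)
    also have "\<dots> \<le> (C * norm x) * (C * norm y)" by (intro mult_mono C) (use C in auto)
    finally show ?thesis by (simp add: mult_ac)
  qed
  thus "\<exists>K. \<forall>a b. norm (ip a b) \<le> norm a * norm b * K" by blast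
qed (simp_all add: ip_simps)

lemmas tendsto_ip = bounded_bilinear.tendsto[OF bounded_bilinear_ip]

lemma tendsto_zero_iff_ip: "(f \<longlongrightarrow> 0) F \<longleftrightarrow> ((\<lambda>n. ip (f n) (f n)) \<longlongrightarrow> 0) F"
proof
  assume "(f \<longlongrightarrow> 0) F"
  from tendsto_ip[OF this this] show "((\<lambda>n. ip (f n) (f n)) \<longlongrightarrow> 0) F" by simp
next
  assume "((\<lambda>n. ip (f n) (f n)) \<longlongrightarrow> 0) F"
  hence *: "((\<lambda>n. cnorm g (f n)) \<longlongrightarrow> 0) F" unfolding cnorm_eq using tendsto_real_sqrt by fastforce
  obtain c where c: "c > 0" "\<And>x. c * norm x \<le> cnorm g x" using bounds_ex by blast
  from tendsto_mult_right_zero[OF *, of "inverse c"]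
  have "((\<lambda>n. inverse c * cnorm g (f n)) \<longlongrightarrow> 0) F" by simp
  thus "(f \<longlongrightarrow> 0) F"
    by (rule tendsto_0_le[where K=1])
      (intro always_eventually allI, use c in \<open>simp add: field_simps\<close>)
qed

lemma Cauchy_ipI:
  assumes "\<And>e. e > 0 \<Longrightarrow> \<exists>N. \<forall>m\<ge>N. \<forall>n\<ge>m. ip (f n - f m) (f n - f m) < e"
  shows "convergent f"
proof -
  obtain c where c: "c > 0" "\<And>x. c * norm x \<le> cnorm g x" using bounds_ex by blast
  have "\<exists>M. \<forall>m\<ge>M. \<forall>n>m. norm (f m - f n) < e" if "e > 0" for e
  proof -
    from c that have "(c * e)\<^sup>2 > 0" by simp
    from assms[OF this] obtain N where N: "\<And>m n. m \<ge> N \<Longrightarrow> n \<ge> m \<Longrightarrow> ip (f n - f m) (f n - f m) < (c * e)\<^sup>2" by blast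
    have "norm (f m - f n) < e" if "m \<ge> N" "n > m" for m n
    proof -
      have "(c * norm (f n - f m))\<^sup>2 \<le> (cnorm g (f n - f m))\<^sup>2"
        by (rule power_mono[OF c(2)]) (use c in auto)
      also have "\<dots> < (c * e)\<^sup>2" using N[of m n] that by (simp add: cnorm_power2)
      finally have "c * norm (f n - f m) < c * e" by (rule power_less_imp_less_base) (use c \<open>e > 0\<close> in auto)
      thus ?thesis using c by (simp add: norm_minus_commute)
    qed
    thus ?thesis by blast
  qed
  hence "Cauchy f" by (intro CauchyI') (auto simp: dist_norm)
  thus ?thesis by (rule Cauchy_convergent)
qed

lemma bounded_linear_ipI:
  assumes add: "\<And>x y. B (x + y) = B x + B y" and scale: "\<And>r x. B (r *\<^sub>R x) = r *\<^sub>R B x"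
    and bound: "\<And>x. cnorm g (B x) \<le> K * cnorm g x"
  shows "bounded_linear B"
proof -
  obtain c C where c: "c > 0" "C > 0" "\<And>x. c * norm x \<le> cnorm g x" "\<And>x. cnorm g x \<le> C * norm x"
    using bounds_ex by blast
  { fix x
  have "c * norm (B x) \<le> cnorm g (B x)" by (rule c)
  also have "\<dots> \<le> \<bar>K\<bar> * cnorm g x" using bound[of x] by (smt (verit) cnorm_nonneg mult_right_mono)
  also have "\<dots> \<le> \<bar>K\<bar> * (C * norm x)" by (intro mult_left_mono c) auto
  finally have "norm (B x) \<le> norm x * (\<bar>K\<bar> * C / c)" using c by (simp add: field_simps)
  }
  thus ?thesis by (intro bounded_linear_intro[OF add scale])
qed

definition sym :: "('a \<Rightarrow> 'a) \<Rightarrow> bool" where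
  "sym B \<longleftrightarrow> bounded_linear B \<and> (\<forall>x y. ip (B x) y = ip x (B y))"

definition pos :: "('a \<Rightarrow> 'a) \<Rightarrow> bool" where
  "pos B \<longleftrightarrow> (\<forall>x. 0 \<le> ip (B x) x)"

text \<open>Besides making products symmetric, commutation restores complex linearity, which
  \<open>sym\<close> does not contain: multiplication by a complex scalar commutes with the inverse
  of the operator and hence with every projection built from it.\<close>

definition commuting :: "('a \<Rightarrow> 'a) \<Rightarrow> ('a \<Rightarrow> 'a) \<Rightarrow> bool" where
  "commuting X B \<longleftrightarrow> (\<forall>x. X (B x) = B (X x))"

lemma sym_ip: "sym B \<Longrightarrow> ip (B x) y = ip x (B y)"
  unfolding sym_def by blast

lemma sym_linear: "sym B \<Longrightarrow> bounded_linear B"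
  unfolding sym_def by blast

lemma sym_arith:
  assumes "sym B"
  shows "B (x + y) = B x + B y" "B (x - y) = B x - B y" "B (r *\<^sub>R x) = r *\<^sub>R B x" "B 0 = 0" "B (- x) = - B x"
  using sym_linear[OF assms]
  by (simp_all add: linear_simps)

lemma sym_id [simp]: "sym (\<lambda>x. x)"
  by (simp add: sym_def)

lemma sym_add: "sym B \<Longrightarrow> sym C \<Longrightarrow> sym (\<lambda>x. B x + C x)"
  and sym_diff: "sym B \<Longrightarrow> sym C \<Longrightarrow> sym (\<lambda>x. B x - C x)"
  and sym_scaleR: "sym B \<Longrightarrow> sym (\<lambda>x. r *\<^sub>R B x)"
  unfolding sym_def by (auto simp: ip_simps intro: bounded_linear_add bounded_linear_sub
      bounded_linear_compose[OF bounded_linear_scaleR_right])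

lemma sym_comp: "sym B \<Longrightarrow> sym C \<Longrightarrow> commuting B C \<Longrightarrow> sym (\<lambda>x. B (C x))"
  unfolding sym_def commuting_def by (auto intro: bounded_linear_compose)

lemma sym_square: "sym B \<Longrightarrow> sym (\<lambda>x. B (B x))"
  by (rule sym_comp[of B B]) (simp_all add: commuting_def)

lemma pos_CS:
  assumes "sym B" "pos B"
  shows "(ip (B x) y)\<^sup>2 \<le> ip (B x) x * ip (B y) y"
proof (rule quadratic_nonneg_discriminant)
  have yx: "ip (B y) x = ip (B x) y" by (metis assms(1) ip_commute sym_ip)
  fix r
  have "0 \<le> ip (B (x - r *\<^sub>R y)) (x - r *\<^sub>R y)" using assms(2) by (simp add: pos_def)
  thus "0 \<le> ip (B x) x - 2 * r * ip (B x) y + r\<^sup>2 * ip (B y) y"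
    by (simp add: sym_arith[OF assms(1)] ip_simps yx power2_eq_square algebra_simps)
qed (use assms(2) in \<open>simp_all add: pos_def\<close>)

text \<open>Cauchy-Schwarz for the semidefinite form of \<open>B\<close>, taken at \<open>x\<close>
  and \<open>B x\<close>, followed by division by the square norm of \<open>B x\<close>. It turns a
  bound on the quadratic form into a bound on the norm, which is how monotone sequences become
  strongly convergent.\<close>

lemma pos_bound:
  assumes "sym B" "pos B" "\<And>x. ip (B x) x \<le> K * ip x x"
  shows "ip (B x) (B x) \<le> K * ip (B x) x"
proof (cases "B x = 0")
  case False
  hence p: "ip (B x) (B x) > 0" by (rule ip_pos)
  have "(ip (B x) (B x))\<^sup>2 \<le> ip (B x) x * ip (B (B x)) (B x)" by (rule pos_CS[OF assms(1,2)])
  also have "\<dots> \<le> ip (B x) x * (K * ip (B x) (B x))"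
    using assms(2) by (intro mult_left_mono assms(3)) (simp add: pos_def)
  finally have "ip (B x) (B x) * ip (B x) (B x) \<le> (K * ip (B x) x) * ip (B x) (B x)"
    by (simp add: power2_eq_square mult_ac)
  thus ?thesis using p by (simp only: mult_le_cancel_right_pos)
qed simp

lemma commuting_refl [simp]: "commuting B B" by (simp add: commuting_def)
lemma commuting_id [simp]: "commuting B (\<lambda>x. x)" "commuting (\<lambda>x. x) B" by (simp_all add: commuting_def)
lemma commuting_flip: "commuting X B \<Longrightarrow> commuting B X" by (simp add: commuting_def)

lemma commuting_add: "bounded_linear X \<Longrightarrow> commuting X B \<Longrightarrow> commuting X C \<Longrightarrow> commuting X (\<lambda>x. B x + C x)"
  and commuting_diff: "bounded_linear X \<Longrightarrow> commuting X B \<Longrightarrow> commuting X C \<Longrightarrow> commuting X (\<lambda>x. B x - C x)"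
  and commuting_scaleR: "bounded_linear X \<Longrightarrow> commuting X B \<Longrightarrow> commuting X (\<lambda>x. r *\<^sub>R B x)"
  and commuting_comp: "commuting X B \<Longrightarrow> commuting X C \<Longrightarrow> commuting X (\<lambda>x. B (C x))"
  by (simp_all add: commuting_def linear_simps)

section \<open>Strong limits, absolute values and kernel projections\<close>

lemma sym_limit:
  assumes B: "\<And>n. sym (B n)" and lim: "\<And>x. (\<lambda>n. B n x) \<longlonglongrightarrow> C x"
    and bound: "\<And>n x. ip (B n x) (B n x) \<le> ip x x"
  shows "sym C" "\<And>x. ip (C x) (C x) \<le> ip x x"
proof -
  show b: "ip (C x) (C x) \<le> ip x x" for x
    by (rule LIMSEQ_le_const2[OF tendsto_ip[OF lim lim]]) (use bound in auto)
  have add: "C (x + y) = C x + C y" for x y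
    using LIMSEQ_unique[OF lim[of "x + y"], of "C x + C y"] tendsto_add[OF lim[of x] lim[of y]]
    by (simp add: sym_arith[OF B])
  have scale: "C (r *\<^sub>R x) = r *\<^sub>R C x" for r x
    using LIMSEQ_unique[OF lim[of "r *\<^sub>R x"], of "r *\<^sub>R C x"] tendsto_scaleR[OF tendsto_const lim[of x], of r]
    by (simp add: sym_arith[OF B])
  have "bounded_linear C"
    by (rule bounded_linear_ipI[OF add scale, of 1]) (simp add: cnorm_eq b)
  moreover have "ip (C x) y = ip x (C y)" for x y
    using LIMSEQ_unique[OF tendsto_ip[OF lim[of x] tendsto_const[of y]], of "ip x (C y)"]
      tendsto_ip[OF tendsto_const[of x] lim[of y]]
    by (simp add: sym_ip[OF B])
  ultimately show "sym C" by (simp add: sym_def)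
qed

lemma commuting_limit:
  assumes "bounded_linear X" "\<And>n. commuting X (B n)" and lim: "\<And>x. (\<lambda>n. B n x) \<longlonglongrightarrow> C x"
  shows "commuting X C"
  unfolding commuting_def
proof
  fix x
  have "(\<lambda>n. X (B n x)) \<longlonglongrightarrow> X (C x)" by (rule bounded_linear.tendsto[OF assms(1) lim])
  moreover have "(\<lambda>n. X (B n x)) \<longlonglongrightarrow> C (X x)" using lim[of "X x"] assms(2) by (simp add: commuting_def)
  ultimately show "X (C x) = C (X x)" by (rule LIMSEQ_unique)
qed

text \<open>The telescoping \<open>A = \<Sum>k. A\<^sub>k\<^sup>2\<close> for \<open>A\<^bsub>k+1\<^esub> = A\<^sub>k - A\<^sub>k\<^sup>2\<close> replaces the square root.\<close>

fun telescope :: "('a \<Rightarrow> 'a) \<Rightarrow> nat \<Rightarrow> 'a \<Rightarrow> 'a" where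
  "telescope A 0 x = A x"
| "telescope A (Suc n) x = telescope A n x - telescope A n (telescope A n x)"

text \<open>In the telescoping sum, \<open><A_k^2 x, B x> = <B A_k x, A_k x>\<close> is nonnegative.
  The remainder \<open>A_n x\<close> tends to zero because the square norms of the
  \<open>A_k x\<close> have sum at most \<open><A x, x>\<close>.\<close>

lemma pos_comp_contraction:
  assumes A: "sym A" "pos A" "\<And>x. ip (A x) x \<le> ip x x" and B: "sym B" "pos B" and AB: "commuting B A"
  shows "pos (\<lambda>x. A (B x))"
proof -
  let ?A = "telescope A"
  have s: "sym (?A n) \<and> commuting B (?A n)" for n
  proof (induction n)
    case (Suc n)
    have "?A (Suc n) = (\<lambda>x. ?A n x - ?A n (?A n x))" by (simp add: fun_eq_iff)
    with Suc show ?case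
      by (auto intro!: sym_diff sym_square[of "?A n"] commuting_diff commuting_comp[of _ "?A n" "?A n"] sym_linear B)
  qed (use A AB in \<open>simp_all add: fun_eq_iff[symmetric]\<close>)
  have 1: "0 \<le> ip (?A n x) x \<and> ip (?A n x) x \<le> ip x x" for n x
  proof (induction n arbitrary: x)
    case (Suc n)
    let ?S = "?A n"
    have S: "sym ?S" using s by blast
    have le: "ip (?S y) y \<le> ip y y" and ge: "ip (?S y) y \<ge> 0" for y using Suc by auto
    have b: "ip (?S y) (?S y) \<le> ip (?S y) y" for y
      using pos_bound[OF S, of 1] le ge by (simp add: pos_def)
    have "ip (?A (Suc n) x) x = ip (?S x) x - ip (?S x) (?S x)"
      by (simp add: ip_simps sym_ip[OF S, of "?S x" x])
    with b[of x] le[of x] ge[of x] show ?case using ip_nonneg[of "?S x"] by linarith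
  qed (use A in \<open>simp add: pos_def\<close>)
  have tele: "A x - ?A n x = (\<Sum>k<n. ?A k (?A k x))" for n x
    by (induction n) (simp_all add: algebra_simps)
  have "0 \<le> ip (A (B x)) x" for x
  proof -
    have sq: "(\<Sum>k<n. ip (?A k x) (?A k x)) \<le> ip (A x) x" for n
    proof -
      have "(\<Sum>k<n. ip (?A k x) (?A k x)) = (\<Sum>k<n. ip (?A k (?A k x)) x)"
        using s by (simp add: sym_ip)
      also have "\<dots> = ip (\<Sum>k<n. ?A k (?A k x)) x"
        by (induction n) (simp_all add: ip_simps)
      also have "\<dots> = ip (A x) x - ip (?A n x) x" by (simp add: tele[symmetric] ip_simps)
      finally show ?thesis using 1[of n x] by simp
    qed
    have "summable (\<lambda>k. ip (?A k x) (?A k x))"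
      by (rule summableI_nonneg_bounded[OF _ sq]) simp
    hence "(\<lambda>k. ip (?A k x) (?A k x)) \<longlonglongrightarrow> 0" by (rule summable_LIMSEQ_zero)
    hence z: "(\<lambda>k. ?A k x) \<longlonglongrightarrow> 0" by (simp add: tendsto_zero_iff_ip)
    have "(\<lambda>n. ip (A x - ?A n x) (B x)) \<longlonglongrightarrow> ip (A x - 0) (B x)"
      by (intro tendsto_ip tendsto_diff tendsto_const z)
    moreover have "0 \<le> ip (A x - ?A n x) (B x)" for n
    proof -
      have "ip (A x - ?A n x) (B x) = (\<Sum>k<n. ip (?A k (?A k x)) (B x))"
        unfolding tele by (induction n) (simp_all add: ip_simps)
      also have "\<dots> = (\<Sum>k<n. ip (B (?A k x)) (?A k x))"
      proof (rule sum.cong)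
        fix k
        have "ip (?A k (?A k x)) (B x) = ip (?A k x) (B (?A k x))"
          using s[of k] by (simp add: sym_ip commuting_def)
        thus "ip (?A k (?A k x)) (B x) = ip (B (?A k x)) (?A k x)" by (simp add: ip_commute)
      qed simp
      also have "\<dots> \<ge> 0" using B(2) by (intro sum_nonneg) (simp add: pos_def)
      finally show ?thesis .
    qed
    ultimately have "0 \<le> ip (A x) (B x)" by (simp add: LIMSEQ_le_const)
    thus ?thesis by (metis A(1) ip_commute sym_ip AB commuting_def)
  qed
  thus ?thesis by (simp add: pos_def)
qed

text \<open>The quadratic forms converge as bounded monotone sequences. A difference
  \<open>D\<close> of two members satisfies \<open>0 <= D <= 1\<close>, so \<open>pos_bound\<close>
  gives \<open>|D x|^2 <= <D x, x>\<close>, and the vectors inherit the Cauchy property from the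
  forms.\<close>

lemma monotone_limit:
  assumes B: "\<And>n. sym (B n)" "\<And>n. pos (B n)" "\<And>n x. ip (B n x) x \<le> ip x x"
    and mono: "\<And>n x. ip (B n x) x \<le> ip (B (Suc n) x) x"
  shows "\<exists>C. sym C \<and> pos C \<and> (\<forall>x. ip (C x) x \<le> ip x x) \<and> (\<forall>x. (\<lambda>n. B n x) \<longlonglongrightarrow> C x)"
proof -
  have inc: "ip (B m x) x \<le> ip (B n x) x" if "m \<le> n" for m n x
    using that by (induction n rule: dec_induct) (auto intro: order_trans mono)
  have conv: "convergent (\<lambda>n. B n x)" for x
  proof (rule Cauchy_ipI)
    fix e :: real assume e: "e > 0"
    have "norm (ip (B n x) x) \<le> ip x x" for n
      using B(2)[of n] B(3)[of n x] by (simp add: pos_def)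
    hence "convergent (\<lambda>n. ip (B n x) x)"
      by (intro Bseq_mono_convergent BseqI'[of _ "ip x x"] allI impI inc)
    hence "Cauchy (\<lambda>n. ip (B n x) x)" by (rule convergent_Cauchy)
    from metric_CauchyD[OF this e] obtain N where
      N: "\<And>m n. m \<ge> N \<Longrightarrow> n \<ge> N \<Longrightarrow> dist (ip (B m x) x) (ip (B n x) x) < e" by blast
    show "\<exists>N. \<forall>m\<ge>N. \<forall>n\<ge>m. ip (B n x - B m x) (B n x - B m x) < e"
    proof (intro exI allI impI)
      fix m n assume mn: "m \<ge> N" "n \<ge> m"
      let ?D = "\<lambda>x. B n x - B m x"
      have D: "sym ?D" by (intro sym_diff B)
      have "pos ?D" using inc[OF mn(2)] by (simp add: pos_def ip_simps)
      moreover have "ip (?D y) y \<le> 1 * ip y y" for y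
        using B(2)[of m] B(3)[of n y] unfolding pos_def by (simp add: ip_simps) (smt (verit))
      ultimately have "ip (?D x) (?D x) \<le> 1 * ip (?D x) x" by (rule pos_bound[OF D])
      also have "\<dots> < e" using N[of m n] inc[OF mn(2), of x] mn by (simp add: ip_simps dist_real_def)
      finally show "ip (B n x - B m x) (B n x - B m x) < e" .
    qed
  qed
  define C where "C x = lim (\<lambda>n. B n x)" for x
  have lim: "(\<lambda>n. B n x) \<longlonglongrightarrow> C x" for x using conv by (simp add: C_def convergent_LIMSEQ_iff)
  have bd: "ip (B n x) (B n x) \<le> ip x x" for n x
    using pos_bound[OF B(1,2), of n 1 x] B(3)[of n] by (simp add: order_trans[OF _ B(3)])
  have "sym C" by (rule sym_limit[OF B(1) lim bd])
  moreover have "pos C" unfolding pos_def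
    using LIMSEQ_le_const[OF tendsto_ip[OF lim tendsto_const]] B(2) by (simp add: pos_def)
  moreover have "ip (C x) x \<le> ip x x" for x
    by (rule LIMSEQ_le_const2[OF tendsto_ip[OF lim tendsto_const]]) (use B(3) in auto)
  ultimately show ?thesis using lim by blast
qed

fun sqrt_iter :: "('a \<Rightarrow> 'a) \<Rightarrow> nat \<Rightarrow> 'a \<Rightarrow> 'a" where
  "sqrt_iter D 0 x = 0"
| "sqrt_iter D (Suc n) x = (1/2) *\<^sub>R (D x + sqrt_iter D n (sqrt_iter D n x))"

lemma sym_zero [simp]: "sym (\<lambda>x. 0)"
  by (simp add: sym_def)

lemma pos_comp:
  assumes A: "sym A" "pos A" "\<And>x. ip (A x) x \<le> K * ip x x" and B: "sym B" "pos B" and AB: "commuting B A"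
  shows "pos (\<lambda>x. A (B x))"
proof -
  define k where "k = max K 1"
  have k: "k > 0" "\<And>x. ip (A x) x \<le> k * ip x x"
    using A(3) by (auto simp: k_def) (smt (verit) ip_nonneg mult_right_mono)
  have "pos (\<lambda>x. (\<lambda>x. (1/k) *\<^sub>R A x) (B x))"
    by (rule pos_comp_contraction[OF _ _ _ B])
      (use A AB k in \<open>auto simp: pos_def ip_simps field_simps intro!: sym_scaleR commuting_scaleR sym_linear B\<close>)
  thus ?thesis using k by (simp add: pos_def ip_simps zero_le_divide_iff)
qed

text \<open>The iteration from zero increases to a solution of \<open>Z = (D + Z^2) / 2\<close> with
  \<open>D = 1 - B^2\<close>, that is, \<open>(1 - Z)^2 = B^2\<close>. The result
  \<open>R = 1 - Z\<close> is the absolute value of the contraction \<open>B\<close>. Whatever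
  commutes with \<open>B\<close> commutes with each iterate and so with the limit.\<close>

lemma sqrt_exists:
  assumes B: "sym B" and bd: "\<And>x. ip (B x) (B x) \<le> ip x x"
  shows "\<exists>R. sym R \<and> pos R \<and> (\<forall>x. ip (R x) x \<le> ip x x) \<and> (\<forall>x. R (R x) = B (B x)) \<and>
    (\<forall>X. bounded_linear X \<longrightarrow> commuting X B \<longrightarrow> commuting X R)"
proof -
  define D where "D x = x - B (B x)" for x
  let ?Y = "sqrt_iter D"
  have symD: "sym D" unfolding D_def by (intro sym_diff sym_square[OF B] sym_id)
  have ipD: "ip (D x) x = ip x x - ip (B x) (B x)" for x
    by (simp add: D_def ip_simps sym_ip[OF B])
  have posD: "pos D" using bd by (simp add: pos_def ipD)
  have leD: "ip (D x) x \<le> ip x x" for x by (simp add: ipD)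
  have commD: "commuting X D" if "bounded_linear X" "commuting X B" for X
    unfolding D_def using that by (intro commuting_diff commuting_comp[of _ B B]) auto
  have YS: "?Y (Suc n) = (\<lambda>x. (1/2) *\<^sub>R (D x + ?Y n (?Y n x)))" for n by (simp add: fun_eq_iff)
  have Y0: "?Y 0 = (\<lambda>x. 0)" by (simp add: fun_eq_iff)
  have symY: "sym (?Y n)" for n
    by (induction n) (auto simp: YS Y0 simp del: sqrt_iter.simps intro!: sym_scaleR sym_add symD sym_square[of "?Y _"])
  have commY: "commuting X (?Y n)" if "bounded_linear X" "commuting X D" for X n
    using that
    by (induction n) (auto simp: YS Y0 linear_simps commuting_def[of _ "\<lambda>x. 0"] simp del: sqrt_iter.simps
        intro!: commuting_scaleR commuting_add commuting_comp[of _ "?Y _" "?Y _"])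
  have commYY: "commuting (?Y m) (?Y n)" for m n
    by (intro commY sym_linear symY commuting_flip[OF commY[OF sym_linear[OF symD]]]) simp
  have Y: "pos (?Y n) \<and> (\<forall>x. ip (?Y n x) x \<le> ip x x)" for n
  proof (induction n)
    case 0
    show ?case by (simp add: pos_def)
  next
    case (Suc n)
    have e: "ip (?Y (Suc n) x) x = (ip (D x) x + ip (?Y n x) (?Y n x)) / 2" for x
      by (simp add: ip_simps sym_ip[OF symY[of n]])
    have "ip (?Y n x) (?Y n x) \<le> ip x x" for x
      using pos_bound[OF symY, of n 1 x] Suc order_trans by fastforce
    show ?case
    proof (intro conjI allI)
      show "pos (?Y (Suc n))" unfolding pos_def e using posD by (simp add: pos_def)
      show "ip (?Y (Suc n) x) x \<le> ip x x" for x
        using add_mono[OF leD[of x] \<open>ip (?Y n x) (?Y n x) \<le> ip x x\<close>] unfolding e by simp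
    qed
  qed
  \<comment> \<open>Consecutive increments satisfy
    \<open>Y (n+2) - Y (n+1) = (Y (n+1) + Y n) (Y (n+1) - Y n) / 2\<close>, a product of commuting
    positive operators.\<close>
  have incr: "pos (\<lambda>x. ?Y (Suc n) x - ?Y n x)" for n
  proof (induction n)
    case 0
    show ?case using posD by (simp add: pos_def ip_simps)
  next
    case (Suc n)
    let ?P = "\<lambda>x. ?Y (Suc n) x + ?Y n x" and ?M = "\<lambda>x. ?Y (Suc n) x - ?Y n x"
    have "pos (\<lambda>x. ?P (?M x))"
    proof (rule pos_comp[of ?P 2 ?M])
      show "sym ?P" "sym ?M" by (intro sym_add sym_diff symY)+
      show "pos ?P" using Y[of n] Y[of "Suc n"] unfolding pos_def ip_simps by fastforce
      show "ip (?P x) x \<le> 2 * ip x x" for x using Y[of n] Y[of "Suc n"] unfolding ip_simps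
        by (smt (verit))
      show "pos ?M" by (rule Suc)
      show "commuting ?M ?P"
        by (intro commuting_add commuting_flip[OF commuting_diff] commYY sym_linear symY sym_diff)
    qed
    moreover have "?Y (Suc (Suc n)) x - ?Y (Suc n) x = (1/2) *\<^sub>R ?P (?M x)" for x
    proof -
      have c: "?Y n (?Y (Suc n) x) = ?Y (Suc n) (?Y n x)" using commYY[of n "Suc n"] unfolding commuting_def by blast
      have "?P (?M x) = ?Y (Suc n) (?Y (Suc n) x) - ?Y n (?Y n x)"
        unfolding sym_arith[OF symY] c by simp
      moreover have "?Y (Suc (Suc n)) x - ?Y (Suc n) x =
          (1/2) *\<^sub>R (D x + ?Y (Suc n) (?Y (Suc n) x)) - (1/2) *\<^sub>R (D x + ?Y n (?Y n x))"
        by (simp only: sqrt_iter.simps)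
      ultimately show ?thesis by (simp only: scaleR_diff_right[symmetric] add_diff_cancel_left)
    qed
    ultimately show ?case unfolding pos_def by (simp only: ip_simps) simp
  qed
  from monotone_limit[of ?Y] obtain Z where Z: "sym Z" "pos Z" "\<And>x. ip (Z x) x \<le> ip x x"
    "\<And>x. (\<lambda>n. ?Y n x) \<longlonglongrightarrow> Z x"
    using symY Y incr unfolding pos_def ip_simps by (smt (verit))
  have bdY: "ip (?Y n x) (?Y n x) \<le> ip x x" for n x
    using pos_bound[OF symY, of n 1 x] Y order_trans by fastforce
  \<comment> \<open>The factors converge only strongly; the contraction bound on \<open>?Y n\<close>
    absorbs the error of the inner factor.\<close>
  have ZZ: "(\<lambda>n. ?Y n (?Y n x)) \<longlonglongrightarrow> Z (Z x)" for x
  proof -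
    have "(\<lambda>n. ?Y n (?Y n x - Z x)) \<longlonglongrightarrow> 0"
    proof (subst tendsto_zero_iff_ip, rule tendsto_sandwich[of "\<lambda>_. 0"])
      have "(\<lambda>n. ?Y n x - Z x) \<longlonglongrightarrow> 0" using Z(4)[of x] by (simp add: LIM_zero_iff)
      thus "(\<lambda>n. ip (?Y n x - Z x) (?Y n x - Z x)) \<longlonglongrightarrow> 0" by (simp add: tendsto_zero_iff_ip)
    qed (use bdY in auto)
    from tendsto_add[OF this Z(4)[of "Z x"]] show ?thesis by (simp add: sym_arith[OF symY])
  qed
  have eq: "Z x = (1/2) *\<^sub>R (D x + Z (Z x))" for x
  proof (rule LIMSEQ_unique)
    show "(\<lambda>n. ?Y (Suc n) x) \<longlonglongrightarrow> Z x" using Z(4) by (rule LIMSEQ_Suc)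
    show "(\<lambda>n. ?Y (Suc n) x) \<longlonglongrightarrow> (1/2) *\<^sub>R (D x + Z (Z x))"
      unfolding sqrt_iter.simps by (intro tendsto_intros ZZ)
  qed
  have eq2: "2 *\<^sub>R Z x = D x + Z (Z x)" for x by (subst eq) simp
  have "x - Z x - Z (x - Z x) = B (B x)" for x
  proof -
    have "x - Z x - Z (x - Z x) = x + Z (Z x) - 2 *\<^sub>R Z x"
      by (simp add: sym_arith[OF Z(1)] scaleR_2)
    also have "\<dots> = x - D x" by (simp only: eq2) simp
    finally show ?thesis by (simp add: D_def)
  qed
  moreover have "sym (\<lambda>x. x - Z x)" by (intro sym_diff Z sym_id)
  moreover have "pos (\<lambda>x. x - Z x)" using Z(3) by (simp add: pos_def ip_simps)
  moreover have "ip (x - Z x) x \<le> ip x x" for x using Z(2) by (simp add: pos_def ip_simps)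
  moreover have "commuting X (\<lambda>x. x - Z x)" if "bounded_linear X" "commuting X B" for X
    using that by (intro commuting_diff commuting_limit[OF _ _ Z(4)] commY commD) auto
  ultimately show ?thesis by (intro exI[of _ "\<lambda>x. x - Z x"]) auto
qed

text \<open>The powers of \<open>1 - C\<close> decrease to a strong limit \<open>Q\<close>. It is
  fixed by \<open>1 - C\<close>, so its range lies in the kernel of \<open>C\<close>, and it fixes
  that kernel. Together these two facts make it idempotent.\<close>

lemma kernel_projection:
  assumes C: "sym C" "pos C" "\<And>x. ip (C x) x \<le> ip x x"
  shows "\<exists>Q. sym Q \<and> (\<forall>x. Q (Q x) = Q x) \<and> (\<forall>x. C (Q x) = 0) \<and> (\<forall>x. C x = 0 \<longrightarrow> Q x = x) \<and>
    (\<forall>X. bounded_linear X \<longrightarrow> commuting X C \<longrightarrow> commuting X Q)"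
proof -
  define K where "K x = x - C x" for x
  have K: "sym K" "pos K" "\<And>x. ip (K x) x \<le> ip x x"
    using C unfolding K_def pos_def by (auto intro!: sym_diff simp: ip_simps)
  let ?P = "\<lambda>n. K ^^ n"
  have P0: "?P 0 = (\<lambda>x. x)" by (simp add: fun_eq_iff)
  have PS: "?P (Suc n) = (\<lambda>x. K (?P n x))" for n by (simp add: fun_eq_iff)
  have comm: "commuting X (?P n)" if "commuting X K" for X n
    using that by (induction n) (simp_all only: P0 PS commuting_id commuting_comp[of _ K "?P _"])
  have symP: "sym (?P n)" for n
    by (induction n) (simp_all only: P0 PS sym_id sym_comp[OF K(1) _ comm[OF commuting_refl]])
  have posP: "pos (?P n)" for n
  proof (induction n)
    case (Suc n)
    show ?case unfolding PS
      by (rule pos_comp_contraction[OF K symP Suc]) (rule commuting_flip[OF comm], simp)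
  qed (simp add: pos_def)
  have CP: "pos (\<lambda>x. C (?P n x))" for n
    by (rule pos_comp_contraction[OF C symP posP])
      (rule commuting_flip[OF comm], unfold K_def, intro commuting_diff sym_linear C, auto)
  have dec: "ip (?P (Suc n) x) x \<le> ip (?P n x) x" for n x
    using CP[of n] unfolding PS K_def pos_def ip_simps by simp
  have le: "ip (?P n x) x \<le> ip x x" for n x
  proof (induction n)
    case (Suc n)
    from dec[of n x] Suc show ?case by (rule order_trans)
  qed simp
  \<comment> \<open>\<open>monotone_limit\<close> expects an increasing sequence, so it is applied
    to \<open>1 - K^n\<close>.\<close>
  have "\<exists>Z. sym Z \<and> pos Z \<and> (\<forall>x. ip (Z x) x \<le> ip x x) \<and> (\<forall>x. (\<lambda>n. x - ?P n x) \<longlonglongrightarrow> Z x)"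
  proof (rule monotone_limit)
    show "sym (\<lambda>x. x - ?P n x)" for n by (intro sym_diff symP sym_id)
    show "pos (\<lambda>x. x - ?P n x)" for n using le by (simp add: pos_def ip_simps)
    show "ip (x - ?P n x) x \<le> ip x x" for n x using posP[of n] by (simp add: pos_def ip_simps)
    show "ip (x - ?P n x) x \<le> ip (x - ?P (Suc n) x) x" for n x using dec by (simp only: ip_simps) simp
  qed
  then obtain Z where Z: "sym Z" "\<And>x. (\<lambda>n. x - ?P n x) \<longlonglongrightarrow> Z x" by blast
  define Q where "Q x = x - Z x" for x
  have lim: "(\<lambda>n. ?P n x) \<longlonglongrightarrow> Q x" for x
    using tendsto_diff[OF tendsto_const[of x] Z(2)[of x]] by (simp add: Q_def)
  have symQ: "sym Q" unfolding Q_def by (intro sym_diff Z sym_id)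
  have KQ: "K (Q x) = Q x" for x
  proof (rule LIMSEQ_unique)
    show "(\<lambda>n. ?P (Suc n) x) \<longlonglongrightarrow> Q x" using lim by (rule LIMSEQ_Suc)
    show "(\<lambda>n. ?P (Suc n) x) \<longlonglongrightarrow> K (Q x)" unfolding PS
      by (rule bounded_linear.tendsto[OF sym_linear[OF K(1)] lim])
  qed
  hence CQ: "C (Q x) = 0" for x unfolding K_def by (metis cancel_comm_monoid_add_class.diff_cancel diff_diff_eq2 add_diff_cancel_left')
  have ker: "Q x = x" if "C x = 0" for x
  proof (rule LIMSEQ_unique[OF lim])
    have "?P n x = x" for n using that by (induction n) (simp_all add: K_def)
    thus "(\<lambda>n. ?P n x) \<longlonglongrightarrow> x" by simp
  qed
  have "commuting X Q" if "bounded_linear X" "commuting X C" for X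
    by (rule commuting_limit[OF that(1) comm lim])
      (unfold K_def, intro commuting_diff that, simp)
  thus ?thesis using symQ CQ ker by (intro exI[of _ Q]) auto
qed

text \<open>
  With \<open>R = |B|\<close>, the projection onto the kernel of \<open>R + B\<close> is the spectral projection of \<open>B\<close>
  for the nonpositive half-line.
\<close>

lemma sign_projection:
  assumes B: "sym B"
  shows "\<exists>Q. sym Q \<and> (\<forall>x. Q (Q x) = Q x) \<and> (\<forall>x. ip (B (Q x)) (Q x) \<le> 0) \<and>
    (\<forall>x. Q x = 0 \<longrightarrow> 0 \<le> ip (B x) x) \<and> (\<forall>x. Q x = 0 \<longrightarrow> ip (B x) x \<le> 0 \<longrightarrow> x = 0) \<and>
    (\<forall>X. bounded_linear X \<longrightarrow> commuting X B \<longrightarrow> commuting X Q)"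
proof -
  obtain K where K: "K > 0" "\<And>x. norm (B x) \<le> norm x * K"
    using bounded_linear.pos_bounded[OF sym_linear[OF B]] by blast
  obtain c C where c: "c > 0" "C > 0" "\<And>x. c * norm x \<le> cnorm g x" "\<And>x. cnorm g x \<le> C * norm x"
    using bounds_ex by blast
  \<comment> \<open>In the norm of \<open>g\<close> the operator \<open>B\<close> is bounded by
    \<open>C * K / c\<close>. The scaling makes it a contraction, as \<open>sqrt_exists\<close>
    requires, and changes no sign.\<close>
  define k where "k = c / (C * K)"
  have k: "k > 0" using K c by (simp add: k_def)
  define A where "A x = k *\<^sub>R B x" for x
  have A: "sym A" unfolding A_def by (intro sym_scaleR B)
  have bd: "ip (A x) (A x) \<le> ip x x" for x
  proof -
    have "cnorm g (A x) \<le> k * (C * norm (B x))" unfolding A_def cnorm_scaleR using k c by simp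
    also have "\<dots> \<le> k * (C * (norm x * K))" using K k c by simp
    also have "\<dots> = c * norm x" using K c by (simp add: k_def field_simps)
    also have "\<dots> \<le> cnorm g x" by (rule c)
    finally have "(cnorm g (A x))\<^sup>2 \<le> (cnorm g x)\<^sup>2" by (intro power_mono) auto
    thus ?thesis by (simp add: cnorm_power2)
  qed
  have AB: "ip (A x) x = k * ip (B x) x" for x by (simp add: A_def ip_simps)
  from sqrt_exists[OF A bd] obtain R where R: "sym R" "pos R" "\<And>x. ip (R x) x \<le> ip x x"
    "\<And>x. R (R x) = A (A x)" "\<And>X. bounded_linear X \<Longrightarrow> commuting X A \<Longrightarrow> commuting X R" by blast
  have RA: "A (R x) = R (A x)" for x
    using R(5)[OF sym_linear[OF A]] by (simp add: commuting_def)
  define S where "S x = (1/2) *\<^sub>R (R x + A x)" for x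
  have S: "sym S" unfolding S_def by (intro sym_scaleR sym_add A R)
  have bdR: "ip (R x) (R x) \<le> ip x x" for x
    using pos_bound[OF R(1,2), of 1 x] R(3) order_trans by fastforce
  have bdS: "ip (S x) (S x) \<le> ip x x" for x
  proof -
    have "ip (S x) (S x) = ip (R x + A x) (R x + A x) / 4"
      unfolding S_def ip_scaleR_left ip_scaleR_right by simp
    thus ?thesis using ip_triangle2[of "R x" "A x"] bd[of x] bdR[of x] by linarith
  qed
  \<comment> \<open>The kernel projection is taken for the square of \<open>S\<close>, which is
    positive at once and has the same kernel.\<close>
  have "\<exists>Q. sym Q \<and> (\<forall>x. Q (Q x) = Q x) \<and> (\<forall>x. S (S (Q x)) = 0) \<and> (\<forall>x. S (S x) = 0 \<longrightarrow> Q x = x) \<and>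
    (\<forall>X. bounded_linear X \<longrightarrow> commuting X (\<lambda>x. S (S x)) \<longrightarrow> commuting X Q)"
    by (rule kernel_projection) (use bdS in \<open>simp_all add: pos_def sym_ip[OF S, of "S _"] sym_square[OF S]\<close>)
  then obtain Q where Q: "sym Q" "\<And>x. Q (Q x) = Q x" "\<And>x. S (S (Q x)) = 0" "\<And>x. S (S x) = 0 \<Longrightarrow> Q x = x"
    "\<And>X. bounded_linear X \<Longrightarrow> commuting X (\<lambda>x. S (S x)) \<Longrightarrow> commuting X Q" by blast
  have SQ: "S (Q x) = 0" for x
  proof -
    have "ip (S (Q x)) (S (Q x)) = ip (S (S (Q x))) (Q x)" by (simp add: sym_ip[OF S])
    thus ?thesis using Q(3)[of x] by simp
  qed
  have commS: "commuting X S" if "bounded_linear X" "commuting X A" for X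
    unfolding S_def using that R by (intro commuting_scaleR commuting_add) auto
  have "A (Q x) = - R (Q x)" for x
    using SQ[of x] by (simp add: S_def add_eq_0_iff)
  hence 1: "ip (A (Q x)) (Q x) \<le> 0" for x
    using R(2) by (simp add: pos_def ip_simps)
  \<comment> \<open>\<open>S\<close> annihilates \<open>R x - A x\<close>, since \<open>R\<close>
    and \<open>A\<close> commute and have equal squares. So \<open>Q\<close> fixes this vector,
    while commutation moves \<open>Q\<close> onto \<open>x\<close>, where it vanishes.\<close>
  have AR: "A x = R x" if "Q x = 0" for x
  proof -
    have "S (R x - A x) = 0" by (simp add: S_def sym_arith[OF R(1)] sym_arith[OF A] RA R(4))
    hence "Q (R x - A x) = R x - A x" using Q(4) sym_arith(4)[OF S] by simp
    moreover have "commuting A Q" "commuting R Q"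
    proof -
      show "commuting A Q" using commS[OF sym_linear[OF A]] sym_linear[OF A] by (intro Q commuting_comp[of _ S S]) auto
      have "commuting R A" using RA by (simp add: commuting_def)
      thus "commuting R Q" using commS[OF sym_linear[OF R(1)]] sym_linear[OF R(1)] by (intro Q commuting_comp[of _ S S]) auto
    qed
    ultimately have "R x - A x = R (Q x) - A (Q x)" by (simp add: sym_arith[OF Q(1)] commuting_def)
    thus ?thesis by (simp add: that sym_arith[OF R(1)] sym_arith[OF A])
  qed
  have 2: "0 \<le> ip (A x) x" if "Q x = 0" for x using AR[OF that] R(2) by (simp add: pos_def)
  have 3: "x = 0" if "Q x = 0" "ip (A x) x \<le> 0" for x
  proof -
    have "ip (R x) x = 0" using that AR[OF that(1)] R(2) by (simp add: pos_def order_antisym)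
    hence "ip (R x) (R x) \<le> 0" using pos_bound[OF R(1,2), of 1 x] R(3) by simp
    hence "R x = 0" by (metis ip_pos linorder_not_le)
    hence "S (S x) = 0" using AR[OF that(1)] by (simp add: S_def sym_arith[OF R(1)] sym_arith[OF A])
    thus ?thesis using Q(4)[of x] that by simp
  qed
  have "commuting X Q" if "bounded_linear X" "commuting X B" for X
  proof -
    have "commuting X A" unfolding A_def by (intro commuting_scaleR that)
    with that have "commuting X S" by (intro commS)
    thus ?thesis using that by (intro Q commuting_comp[of _ S S])
  qed
  moreover have "ip (B (Q x)) (Q x) \<le> 0" for x
    using 1[of x] k unfolding AB by (simp add: mult_le_0_iff)
  moreover have "0 \<le> ip (B x) x" if "Q x = 0" for x
    using 2[OF that] k unfolding AB by (simp add: zero_le_mult_iff)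
  moreover have "x = 0" if "Q x = 0" "ip (B x) x \<le> 0" for x
    using 3[OF that(1)] that(2) k unfolding AB by (simp add: mult_le_0_iff)
  ultimately show ?thesis using Q(1,2) by (intro exI[of _ Q] conjI allI impI)
qed

end

section \<open>Spectral families and their measures\<close>

text \<open>The identity itself is propagated by Dynkin's argument from half-open intervals;
  finiteness and the value on the whole line serve the complements. Its shape is that of the
  parallelogram law with \<open>c = 2\<close>; scalings and restrictions fit it after inserting
  measures of the zero vector.\<close>

lemma finite_measures_eq_on_borel:
  fixes M1 M2 M3 M4 :: "real measure" and c :: real
  assumes fin: "finite_measure M1" "finite_measure M2" "finite_measure M3" "finite_measure M4"
    and sets [measurable_cong]: "sets M1 = sets borel" "sets M2 = sets borel" "sets M3 = sets borel" "sets M4 = sets borel"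
    and UNIV: "measure M1 UNIV + measure M2 UNIV = c * measure M3 UNIV + c * measure M4 UNIV"
    and Ioc: "\<And>a b. a \<le> b \<Longrightarrow> measure M1 {a<..b} + measure M2 {a<..b} = c * measure M3 {a<..b} + c * measure M4 {a<..b}"
    and S: "S \<in> sets borel"
  shows "measure M1 S + measure M2 S = c * measure M3 S + c * measure M4 S"
proof -
  interpret M1: finite_measure M1 by fact
  interpret M2: finite_measure M2 by fact
  interpret M3: finite_measure M3 by fact
  interpret M4: finite_measure M4 by fact
  let ?G = "range (\<lambda>(a, b). {a<..b::real})"
  have sp: "space M1 = UNIV" "space M2 = UNIV" "space M3 = UNIV" "space M4 = UNIV"
    using sets[THEN sets_eq_imp_space_eq] by simp_all
  have eq: "sigma_sets UNIV ?G = sets borel"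
    by (subst borel_sigma_sets_Ioc) (simp add: sets_measure_of)
  have Ioc': "measure M1 {a<..b} + measure M2 {a<..b} = c * measure M3 {a<..b} + c * measure M4 {a<..b}" for a b
    using Ioc[of a b] by (cases "a \<le> b") auto
  have int: "Int_stable ?G"
  proof (rule Int_stableI)
    fix a b assume "a \<in> ?G" "b \<in> ?G"
    then obtain p q u v where "a = {p<..q}" "b = {u<..v}" by auto
    hence "a \<inter> b = (\<lambda>(a, b). {a<..b}) (max p u, min q v)" by (simp add: Int_greaterThanAtMost)
    thus "a \<inter> b \<in> ?G" by blast
  qed
  have sub: "?G \<subseteq> Pow UNIV" by simp
  have "S \<in> sigma_sets UNIV ?G" using S eq by simp
  thus ?thesis
  proof (induction rule: sigma_sets_induct_disjoint[OF int sub, consumes 1, case_names basic empty compl union])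
    case (basic A)
    thus ?case using Ioc' by auto
  next
    case empty
    show ?case by simp
  next
    case (compl A)
    hence "A \<in> sets borel" using eq by simp
    hence A: "A \<in> sets M1" "A \<in> sets M2" "A \<in> sets M3" "A \<in> sets M4" using sets by auto
    show ?case
      using compl(2) UNIV
      unfolding M1.finite_measure_compl[OF A(1), unfolded sp] M2.finite_measure_compl[OF A(2), unfolded sp]
        M3.finite_measure_compl[OF A(3), unfolded sp] M4.finite_measure_compl[OF A(4), unfolded sp] right_diff_distrib
      by linarith
  next
    case (union A)
    have r: "range A \<subseteq> sets M1" "range A \<subseteq> sets M2" "range A \<subseteq> sets M3" "range A \<subseteq> sets M4"
      using union eq sets by auto
    have "(\<lambda>i. measure M1 (A i) + measure M2 (A i)) sums (measure M1 (\<Union>i. A i) + measure M2 (\<Union>i. A i))"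
      by (intro sums_add M1.finite_measure_UNION M2.finite_measure_UNION r union)
    moreover have "(\<lambda>i. c * measure M3 (A i) + c * measure M4 (A i)) sums (c * measure M3 (\<Union>i. A i) + c * measure M4 (\<Union>i. A i))"
      by (intro sums_add sums_mult M3.finite_measure_UNION M4.finite_measure_UNION r union)
    ultimately show ?case using union(3) sums_unique2 by fastforce
  qed
qed

lemma nn_integral_le_lincomb:
  assumes sets [measurable_cong]: "sets M1 = sets M" "sets M2 = sets M" "sets M3 = sets M"
    and le: "\<And>S. S \<in> sets M \<Longrightarrow> emeasure M1 S \<le> c * emeasure M2 S + c * emeasure M3 S"
    and f: "f \<in> borel_measurable M"
  shows "(\<integral>\<^sup>+t. f t \<partial>M1) \<le> c * (\<integral>\<^sup>+t. f t \<partial>M2) + c * (\<integral>\<^sup>+t. f t \<partial>M3)"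
  using f
proof (induction rule: borel_measurable_induct)
  case (cong f g)
  have sp: "space M1 = space M" "space M2 = space M" "space M3 = space M"
    using sets[THEN sets_eq_imp_space_eq] by simp_all
  have "(\<integral>\<^sup>+t. f t \<partial>M1) = (\<integral>\<^sup>+t. g t \<partial>M1)" "(\<integral>\<^sup>+t. f t \<partial>M2) = (\<integral>\<^sup>+t. g t \<partial>M2)" "(\<integral>\<^sup>+t. f t \<partial>M3) = (\<integral>\<^sup>+t. g t \<partial>M3)"
    using cong sp by (auto intro!: nn_integral_cong)
  thus ?case using cong by simp
next
  case (set A)
  thus ?case using le[OF set] sets by simp
next
  case (mult u a)
  hence [measurable]: "u \<in> borel_measurable M" by simp
  have "(\<integral>\<^sup>+t. a * u t \<partial>M1) = a * (\<integral>\<^sup>+t. u t \<partial>M1)" by (rule nn_integral_cmult) simp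
  also have "\<dots> \<le> a * (c * (\<integral>\<^sup>+t. u t \<partial>M2) + c * (\<integral>\<^sup>+t. u t \<partial>M3))" by (rule mult_left_mono[OF mult(4)]) simp
  also have "\<dots> = c * (\<integral>\<^sup>+t. a * u t \<partial>M2) + c * (\<integral>\<^sup>+t. a * u t \<partial>M3)"
    by (simp add: nn_integral_cmult distrib_left mult_ac)
  finally show ?case .
next
  case (add u v)
  hence [measurable]: "u \<in> borel_measurable M" "v \<in> borel_measurable M" by auto
  show ?case using add_mono[OF add.IH(1) add.IH(2)]
    by (simp add: nn_integral_add distrib_left ac_simps)
next
  case (seq U)
  hence [measurable]: "\<And>i. U i \<in> borel_measurable M" by simp
  have "(\<integral>\<^sup>+t. (SUP i. U i) t \<partial>M1) = (SUP i. (\<integral>\<^sup>+t. U i t \<partial>M1))"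
    using nn_integral_monotone_convergence_SUP[of U M1] seq by (simp add: SUP_apply image_comp)
  also have "\<dots> \<le> c * (\<integral>\<^sup>+t. (SUP i. U i) t \<partial>M2) + c * (\<integral>\<^sup>+t. (SUP i. U i) t \<partial>M3)"
  proof (rule SUP_least)
    fix i
    have "(\<integral>\<^sup>+t. U i t \<partial>M1) \<le> c * (\<integral>\<^sup>+t. U i t \<partial>M2) + c * (\<integral>\<^sup>+t. U i t \<partial>M3)" by (rule seq)
    also have "\<dots> \<le> c * (\<integral>\<^sup>+t. (SUP i. U i) t \<partial>M2) + c * (\<integral>\<^sup>+t. (SUP i. U i) t \<partial>M3)"
      by (intro add_mono mult_left_mono nn_integral_mono) (auto simp: SUP_apply image_comp intro: SUP_upper)
    finally show "(\<integral>\<^sup>+t. U i t \<partial>M1) \<le> \<dots>" .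
  qed
  finally show ?case .
qed

context equiv_inner begin

lemma g_eqI: "(\<And>y. g x y = g z y) \<Longrightarrow> x = z"
  using ip_eq_0[of "x - z"] unfolding ip_def by (simp add: g_diff_left)

lemma Im_g: "Im (g x y) = - ip x (\<i> *\<^sub>C y)"
  by (simp add: ip_def g_scaleC_right)

lemma ip_scaleC_self: "ip (a *\<^sub>C x) (a *\<^sub>C x) = (cmod a)\<^sup>2 * ip x x"
proof -
  have "g (a *\<^sub>C x) (a *\<^sub>C x) = (a * cnj a) * complex_of_real (ip x x)"
    by (simp only: g_scaleC_left g_scaleC_right g_self[of x] mult_ac)
  also have "\<dots> = complex_of_real ((cmod a)\<^sup>2 * ip x x)"
    by (simp only: complex_norm_square[symmetric] of_real_mult)
  finally show ?thesis by (simp add: ip_def)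
qed

lemma bounded_linear_scaleC: "bounded_linear (\<lambda>x::'a. a *\<^sub>C x)"
  by (rule bounded_linear_ipI[where K="cmod a"])
    (simp_all add: scaleC_add_right scaleR_scaleC scaleC_scaleC mult.commute cnorm_eq ip_scaleC_self real_sqrt_mult)

lemmas tendsto_scaleC = bounded_linear.tendsto[OF bounded_linear_scaleC]

lemma tendsto_g:
  assumes "(f \<longlongrightarrow> x) F"
  shows "((\<lambda>n. g (f n) y) \<longlongrightarrow> g x y) F"
proof (rule tendsto_complex_iff[THEN iffD2], intro conjI)
  show "((\<lambda>n. Re (g (f n) y)) \<longlongrightarrow> Re (g x y)) F"
    using tendsto_ip[OF assms tendsto_const[of y]] by (simp add: ip_def)
  show "((\<lambda>n. Im (g (f n) y)) \<longlongrightarrow> Im (g x y)) F"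
    unfolding Im_g by (intro tendsto_minus tendsto_ip assms tendsto_const)
qed

lemma g_conv_zero_on_dense:
  assumes "closure D = UNIV" "\<And>y. y \<in> D \<Longrightarrow> g x y = 0"
  shows "x = 0"
proof -
  have "x \<in> closure D" using assms by simp
  then obtain f where f: "\<And>n. f n \<in> D" "f \<longlonglongrightarrow> x" by (auto simp: closure_sequential)
  have "(\<lambda>n. ip x (f n)) \<longlonglongrightarrow> ip x x" by (intro tendsto_ip f tendsto_const)
  moreover have "ip x (f n) = 0" for n using assms(2)[OF f(1)] by (simp add: ip_def)
  ultimately have "ip x x = 0" by (simp add: LIMSEQ_const_iff)
  thus ?thesis by simp
qed

lemma clinear_onD:
  assumes "clinear_on D S"
  shows "csubspace D" "\<And>x y. x \<in> D \<Longrightarrow> y \<in> D \<Longrightarrow> S (x + y) = S x + S y" "\<And>a x. x \<in> D \<Longrightarrow> S (a *\<^sub>C x) = a *\<^sub>C S x"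
  using assms by (auto simp: clinear_on_def)

text \<open>Expanding the form at \<open>x + y\<close> and at \<open>x + \<i> y\<close> gives
  \<open>g (X x) y\<close> once as the negative of \<open>g (X y) x\<close> and once as equal to it.
  Complex scalars are essential: a rotation of the real plane has vanishing form. The lemma is the
  tool for \<open>is_spectral_integral\<close>, which prescribes the form only.\<close>

lemma polarization:
  assumes D: "csubspace D" and X: "clinear_on D X" and z: "\<And>x. x \<in> D \<Longrightarrow> g (X x) x = 0" and xy: "x \<in> D" "y \<in> D"
  shows "g (X x) y = 0"
proof -
  have e: "g (X x) y + g (X y) x = 0" if "y \<in> D" for y
  proof -
    have "g (X (x + y)) (x + y) = 0" by (intro z complex_vector.subspace_add[OF D] xy that)
    thus ?thesis using z[OF xy(1)] z[OF that] clinear_onD(2)[OF X xy(1) that]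
      by (simp add: g_add_left g_add_right add.commute)
  qed
  have iy: "\<i> *\<^sub>C y \<in> D" by (rule complex_vector.subspace_scale[OF D xy(2)])
  have "\<i> * (g (X x) y - g (X y) x) = 0"
    using e[OF iy] clinear_onD(3)[OF X xy(2)] by (simp add: g_scaleC_left g_scaleC_right algebra_simps)
  hence "g (X x) y = g (X y) x" by simp
  with e[OF xy(2)] show ?thesis by simp
qed

lemma symmetric_of_real_form:
  assumes D: "csubspace D" and X: "clinear_on D X" and z: "\<And>x. x \<in> D \<Longrightarrow> g (X x) x \<in> \<real>" and xy: "x \<in> D" "y \<in> D"
  shows "g (X x) y = g x (X y)"
proof -
  have r: "Im (g (X x) x) = 0" if "x \<in> D" for x using z[OF that] by (simp add: complex_is_Real_iff)
  have e: "Im (g (X x) y) + Im (g (X y) x) = 0" if "y \<in> D" for y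
  proof -
    have "Im (g (X (x + y)) (x + y)) = 0" by (intro r complex_vector.subspace_add[OF D] xy that)
    thus ?thesis using r[OF xy(1)] r[OF that] clinear_onD(2)[OF X xy(1) that]
      by (simp add: g_add_left g_add_right)
  qed
  have iy: "\<i> *\<^sub>C y \<in> D" by (rule complex_vector.subspace_scale[OF D xy(2)])
  have "Re (g (X x) y) = Re (g (X y) x)"
    using e[OF iy] clinear_onD(3)[OF X xy(2)] by (simp add: g_scaleC_left g_scaleC_right)
  with e[OF xy(2)] show ?thesis by (subst g_commute[of x]) (simp add: complex_eq_iff)
qed

end

locale spectral_fam = equiv_inner g for g :: "'a::complex_hilbert \<Rightarrow> 'a \<Rightarrow> complex" +
  fixes E :: "real \<Rightarrow> 'a \<Rightarrow> 'a"
  assumes family: "spectral_family g E"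
begin

lemma E_clinear: "clinear_on UNIV (E t)"
  and E_idem [simp]: "E t (E t x) = E t x"
  and E_g: "g (E t x) y = g x (E t y)"
  and E_mono: "s \<le> t \<Longrightarrow> E s (E t x) = E s x"
  and E_right: "((\<lambda>s. E s x) \<longlongrightarrow> E t x) (at_right t)"
  and E_bot: "((\<lambda>s. E s x) \<longlongrightarrow> 0) at_bot"
  and E_top: "((\<lambda>s. E s x) \<longlongrightarrow> x) at_top"
  using family unfolding spectral_family_def by blast+

lemma E_add: "E t (x + y) = E t x + E t y"
  and E_scaleC: "E t (a *\<^sub>C x) = a *\<^sub>C E t x"
  using clinear_onD[OF E_clinear] by auto

lemma E_zero [simp]: "E t 0 = 0"
  using E_add[of t 0 0] by simp

lemma E_minus: "E t (- x) = - E t x"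
  using E_add[of t x "- x"] by (simp add: eq_neg_iff_add_eq_0 add.commute)

lemma E_diff: "E t (x - y) = E t x - E t y"
  using E_add[of t x "- y"] by (simp add: E_minus)

lemma E_ip: "ip (E t x) y = ip x (E t y)"
  by (simp add: ip_def E_g)

lemma E_mono2: "s \<le> t \<Longrightarrow> E t (E s x) = E s x"
  by (rule g_eqI) (simp add: E_g E_mono)

lemma E_E: "E s (E t x) = E (min s t) x"
  using E_mono[of s t x] E_mono2[of t s x] by (cases "s \<le> t") (auto simp: min_def)

definition dist_fun :: "'a \<Rightarrow> real \<Rightarrow> real" where "dist_fun x t = ip (E t x) (E t x)"

lemma ip_E_E: "ip (E s x) (E t x) = dist_fun x (min s t)"
proof -
  have "ip (E s x) (E t x) = ip x (E s (E t x))" by (simp add: E_ip)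
  also have "\<dots> = ip x (E (min s t) (E (min s t) x))" by (simp add: E_E)
  also have "\<dots> = ip (E (min s t) x) (E (min s t) x)" by (simp only: E_ip)
  finally show ?thesis by (simp add: dist_fun_def)
qed

lemma ip_E_self: "ip (E t x) x = dist_fun x t"
proof -
  have "ip (E t x) (E t x) = ip (E t (E t x)) x" by (simp only: E_ip)
  thus ?thesis by (simp add: dist_fun_def)
qed

lemma dist_fun_le: "dist_fun x t \<le> ip x x"
proof -
  have "0 \<le> ip (x - E t x) (x - E t x)" by simp
  thus ?thesis by (simp add: ip_simps ip_E_self ip_commute[of x "E t x"] dist_fun_def[symmetric])
qed

lemma dist_fun_mono: "s \<le> t \<Longrightarrow> dist_fun x s \<le> dist_fun x t"
proof -
  assume st: "s \<le> t"
  have "dist_fun (E t x) s \<le> ip (E t x) (E t x)" by (rule dist_fun_le)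
  thus ?thesis using st by (simp add: dist_fun_def E_mono)
qed

lemma dist_fun_nonneg: "0 \<le> dist_fun x t" by (simp add: dist_fun_def)

lemma dist_fun_right: "continuous (at_right t) (dist_fun x)"
  unfolding continuous_within dist_fun_def by (intro tendsto_ip E_right)

lemma dist_fun_bot: "(dist_fun x \<longlongrightarrow> 0) at_bot"
  using tendsto_ip[OF E_bot[of x] E_bot[of x]] by (simp add: dist_fun_def[abs_def])

lemma dist_fun_top: "(dist_fun x \<longlongrightarrow> ip x x) at_top"
  using tendsto_ip[OF E_top[of x] E_top[of x]] by (simp add: dist_fun_def[abs_def])

abbreviation nu where "nu x \<equiv> spectral_measure g E x"

lemma nu_eq: "nu x = interval_measure (dist_fun x)"
  unfolding spectral_measure_def ip_def[symmetric] ip_E_self ..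

lemma sets_nu [simp, measurable_cong]: "sets (nu x) = sets borel"
  by (simp add: nu_eq)

lemma space_nu [simp]: "space (nu x) = UNIV"
  by (simp add: nu_eq)

lemma emeasure_nu_Ioc: "a \<le> b \<Longrightarrow> emeasure (nu x) {a<..b} = dist_fun x b - dist_fun x a"
  unfolding nu_eq by (rule emeasure_interval_measure_Ioc) (simp_all add: dist_fun_mono dist_fun_right)

lemma emeasure_nu_UNIV: "emeasure (nu x) UNIV = ip x x"
proof (rule LIMSEQ_unique)
  let ?A = "\<lambda>n::nat. {- real n<..real n}"
  have "(\<Union>n. ?A n) = UNIV"
  proof (intro equalityI subsetI)
    fix t :: real
    obtain n where "\<bar>t\<bar> < real n" using reals_Archimedean2 by blast
    thus "t \<in> (\<Union>n. ?A n)" by (intro UN_I[of n]) auto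
  qed auto
  moreover have "(\<lambda>n. emeasure (nu x) (?A n)) \<longlonglongrightarrow> emeasure (nu x) (\<Union>n. ?A n)"
    by (rule Lim_emeasure_incseq) (auto simp: incseq_def)
  ultimately show "(\<lambda>n. emeasure (nu x) (?A n)) \<longlonglongrightarrow> emeasure (nu x) UNIV" by simp
  have "(\<lambda>n. dist_fun x (real n) - dist_fun x (- real n)) \<longlonglongrightarrow> ip x x - 0"
    by (intro tendsto_diff filterlim_compose[OF dist_fun_top] filterlim_compose[OF dist_fun_bot]
        filterlim_real_sequentially filterlim_uminus_at_bot_at_top[THEN filterlim_compose])
  hence "(\<lambda>n. ennreal (dist_fun x (real n) - dist_fun x (- real n))) \<longlonglongrightarrow> ennreal (ip x x)"
    by (intro tendsto_ennrealI) simp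
  thus "(\<lambda>n. emeasure (nu x) (?A n)) \<longlonglongrightarrow> ennreal (ip x x)"
    by (simp add: emeasure_nu_Ioc)
qed

lemma finite_nu: "finite_measure (nu x)"
  by (rule finite_measureI) (simp add: emeasure_nu_UNIV)

lemma emeasure_nu_atMost: "emeasure (nu x) {..b} = dist_fun x b"
proof (rule LIMSEQ_unique)
  let ?A = "\<lambda>n::nat. {b - real n<..b}"
  have "(\<Union>n. ?A n) = {..b}"
  proof (intro equalityI subsetI)
    fix t :: real assume "t \<in> {..b}"
    obtain n where "b - t < real n" using reals_Archimedean2 by blast
    thus "t \<in> (\<Union>n. ?A n)" using \<open>t \<in> {..b}\<close> by (intro UN_I[of n]) auto
  qed auto
  moreover have "(\<lambda>n. emeasure (nu x) (?A n)) \<longlonglongrightarrow> emeasure (nu x) (\<Union>n. ?A n)"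
    by (rule Lim_emeasure_incseq) (auto simp: incseq_def)
  ultimately show "(\<lambda>n. emeasure (nu x) (?A n)) \<longlonglongrightarrow> emeasure (nu x) {..b}" by simp
  have "filterlim (\<lambda>n. - (real n + (- b))) at_bot sequentially"
    by (intro filterlim_uminus_at_bot_at_top[THEN filterlim_compose]
       filterlim_tendsto_add_at_top[OF tendsto_const filterlim_real_sequentially, THEN filterlim_cong[OF refl refl, THEN iffD1, rotated]])
      (auto intro: always_eventually)
  hence "filterlim (\<lambda>n. b - real n) at_bot sequentially" by simp
  hence "(\<lambda>n. dist_fun x b - dist_fun x (b - real n)) \<longlonglongrightarrow> dist_fun x b - 0"
    by (intro tendsto_diff tendsto_const filterlim_compose[OF dist_fun_bot])
  hence "(\<lambda>n. ennreal (dist_fun x b - dist_fun x (b - real n))) \<longlonglongrightarrow> ennreal (dist_fun x b)"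
    by (intro tendsto_ennrealI) simp
  thus "(\<lambda>n. emeasure (nu x) (?A n)) \<longlonglongrightarrow> ennreal (dist_fun x b)"
    by (simp add: emeasure_nu_Ioc)
qed

lemma emeasure_nu_zero: "emeasure (nu 0) A = 0"
  using emeasure_mono[of A UNIV "nu 0"] by (simp add: emeasure_nu_UNIV)

lemma measure_nu_Ioc: "a \<le> b \<Longrightarrow> measure (nu x) {a<..b} = dist_fun x b - dist_fun x a"
  by (simp add: measure_def emeasure_nu_Ioc dist_fun_mono)

lemma measure_nu_UNIV: "measure (nu x) UNIV = ip x x"
  by (simp add: measure_def emeasure_nu_UNIV)

lemma AE_nu_greater:
  assumes "E a x = 0" shows "AE t in nu x. a < t"
proof (rule AE_I')
  show "{..a} \<in> null_sets (nu x)" using assms by (simp add: null_sets_def emeasure_nu_atMost dist_fun_def)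
qed auto

lemma AE_nu_le:
  assumes "E b x = x" shows "AE t in nu x. t \<le> b"
proof (rule AE_I')
  interpret finite_measure "nu x" by (rule finite_nu)
  have "emeasure (nu x) {b<..} = emeasure (nu x) (space (nu x) - {..b})"
    by (rule arg_cong[of _ _ "emeasure (nu x)"]) auto
  also have "\<dots> = emeasure (nu x) UNIV - emeasure (nu x) {..b}"
    by (subst emeasure_compl) auto
  also have "\<dots> = 0" using assms by (simp add: emeasure_nu_UNIV emeasure_nu_atMost dist_fun_def)
  finally show "{b<..} \<in> null_sets (nu x)" by (simp add: null_sets_def)
qed auto

text \<open>The parallelogram law makes up for the missing additivity of \<open>x \<mapsto> nu x\<close>.\<close>

lemma dist_fun_parallelogram:
  "dist_fun (x + y) t + dist_fun (x - y) t = 2 * dist_fun x t + 2 * dist_fun y t"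
  by (simp add: dist_fun_def E_add E_diff ip_simps)

lemma emeasure_nu_add: "S \<in> sets borel \<Longrightarrow> emeasure (nu (x + y)) S \<le> 2 * emeasure (nu x) S + 2 * emeasure (nu y) S"
proof -
  assume S: "S \<in> sets borel"
  have eq: "measure (nu (x + y)) S + measure (nu (x - y)) S = 2 * measure (nu x) S + 2 * measure (nu y) S"
  proof (rule finite_measures_eq_on_borel[OF finite_nu finite_nu finite_nu finite_nu _ _ _ _ _ _ S])
    show "measure (nu (x + y)) UNIV + measure (nu (x - y)) UNIV = 2 * measure (nu x) UNIV + 2 * measure (nu y) UNIV"
      by (simp add: measure_nu_UNIV ip_simps)
    show "measure (nu (x + y)) {a<..b} + measure (nu (x - y)) {a<..b} = 2 * measure (nu x) {a<..b} + 2 * measure (nu y) {a<..b}"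
      if "a \<le> b" for a b using that dist_fun_parallelogram[of x y a] dist_fun_parallelogram[of x y b]
      by (simp add: measure_nu_Ioc)
  qed simp_all
  have em: "emeasure (nu z) S = ennreal (measure (nu z) S)" for z
    using finite_measure.emeasure_eq_measure[OF finite_nu] by auto
  have "measure (nu (x + y)) S \<le> 2 * measure (nu x) S + 2 * measure (nu y) S"
    using eq measure_nonneg[of "nu (x - y)" S] by linarith
  hence "emeasure (nu (x + y)) S \<le> ennreal (2 * measure (nu x) S + 2 * measure (nu y) S)"
    unfolding em by (rule ennreal_leI)
  thus ?thesis unfolding em by (simp add: ennreal_plus ennreal_mult)
qed

lemma nn_integral_nu_add:
  assumes [measurable]: "f \<in> borel_measurable borel"
  shows "(\<integral>\<^sup>+t. f t \<partial>nu (x + y)) \<le> 2 * (\<integral>\<^sup>+t. f t \<partial>nu x) + 2 * (\<integral>\<^sup>+t. f t \<partial>nu y)"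
  by (rule nn_integral_le_lincomb[where M=borel]) (use emeasure_nu_add in auto)

lemma nn_integral_nu_scaleC:
  assumes [measurable]: "f \<in> borel_measurable borel"
  shows "(\<integral>\<^sup>+t. f t \<partial>nu (a *\<^sub>C x)) \<le> ennreal ((cmod a)\<^sup>2) * (\<integral>\<^sup>+t. f t \<partial>nu x)"
proof -
  have d0: "dist_fun 0 t = 0" for t by (simp add: dist_fun_def)
  \<comment> \<open>The measure of the zero vector vanishes and fills the two remaining places of
    the four-measure identity.\<close>
  have eq: "measure (nu (a *\<^sub>C x)) S + measure (nu 0) S = (cmod a)\<^sup>2 * measure (nu x) S + (cmod a)\<^sup>2 * measure (nu 0) S"
    if "S \<in> sets borel" for S
  proof (rule finite_measures_eq_on_borel[OF finite_nu finite_nu finite_nu finite_nu _ _ _ _ _ _ that])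
    show "measure (nu (a *\<^sub>C x)) UNIV + measure (nu 0) UNIV = (cmod a)\<^sup>2 * measure (nu x) UNIV + (cmod a)\<^sup>2 * measure (nu 0) UNIV"
      by (simp add: measure_nu_UNIV ip_scaleC_self)
    show "measure (nu (a *\<^sub>C x)) {r<..s} + measure (nu 0) {r<..s} = (cmod a)\<^sup>2 * measure (nu x) {r<..s} + (cmod a)\<^sup>2 * measure (nu 0) {r<..s}"
      if "r \<le> s" for r s
      using that by (simp add: measure_nu_Ioc dist_fun_def E_scaleC ip_scaleC_self algebra_simps)
  qed simp_all
  have m0: "measure (nu 0) S = 0" for S by (simp add: measure_def emeasure_nu_zero)
  have em: "emeasure (nu z) S = ennreal (measure (nu z) S)" for z S
    using finite_measure.emeasure_eq_measure[OF finite_nu] by auto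
  have "(\<integral>\<^sup>+t. f t \<partial>nu (a *\<^sub>C x)) \<le> ennreal ((cmod a)\<^sup>2) * (\<integral>\<^sup>+t. f t \<partial>nu x) + ennreal ((cmod a)\<^sup>2) * (\<integral>\<^sup>+t. f t \<partial>nu 0)"
  proof (rule nn_integral_le_lincomb[where M=borel])
    fix S :: "real set" assume "S \<in> sets borel"
    from eq[OF this] show "emeasure (nu (a *\<^sub>C x)) S \<le> ennreal ((cmod a)\<^sup>2) * emeasure (nu x) S + ennreal ((cmod a)\<^sup>2) * emeasure (nu 0) S"
      by (simp add: em m0 ennreal_mult)
  qed auto
  also have "(\<integral>\<^sup>+t. f t \<partial>nu 0) = 0"
    by (subst nn_integral_0_iff_AE) (auto intro!: AE_I'[of UNIV] simp: null_sets_def emeasure_nu_zero)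
  finally show ?thesis by simp
qed

lemma integrable_sq_iff:
  assumes [measurable]: "f \<in> borel_measurable borel"
  shows "x \<in> spectral_dom g E f \<longleftrightarrow> (\<integral>\<^sup>+t. ennreal ((f t)\<^sup>2) \<partial>nu x) < \<infinity>"
  by (simp add: spectral_dom_def integrable_iff_bounded)

lemma csubspace_spectral_dom:
  assumes f [measurable]: "f \<in> borel_measurable borel"
  shows "csubspace (spectral_dom g E f)"
proof (rule complex_vector.subspaceI)
  have "(\<integral>\<^sup>+t. ennreal ((f t)\<^sup>2) \<partial>nu (0 *\<^sub>C 0)) \<le> ennreal ((cmod 0)\<^sup>2) * (\<integral>\<^sup>+t. ennreal ((f t)\<^sup>2) \<partial>nu 0)"
    by (rule nn_integral_nu_scaleC) simp
  thus "0 \<in> spectral_dom g E f" by (simp add: integrable_sq_iff)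
next
  fix x y assume "x \<in> spectral_dom g E f" "y \<in> spectral_dom g E f"
  hence "2 * (\<integral>\<^sup>+t. ennreal ((f t)\<^sup>2) \<partial>nu x) + 2 * (\<integral>\<^sup>+t. ennreal ((f t)\<^sup>2) \<partial>nu y) < \<infinity>"
    by (simp add: integrable_sq_iff ennreal_mult_less_top)
  thus "x + y \<in> spectral_dom g E f" unfolding integrable_sq_iff[OF f]
    by (rule le_less_trans[OF nn_integral_nu_add, rotated]) simp
next
  fix a x assume "x \<in> spectral_dom g E f"
  hence "ennreal ((cmod a)\<^sup>2) * (\<integral>\<^sup>+t. ennreal ((f t)\<^sup>2) \<partial>nu x) < \<infinity>"
    by (simp add: integrable_sq_iff ennreal_mult_less_top)
  thus "a *\<^sub>C x \<in> spectral_dom g E f" unfolding integrable_sq_iff[OF f]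
    by (rule le_less_trans[OF nn_integral_nu_scaleC, rotated]) simp
qed

lemma spectral_dom_bounded_support:
  assumes f: "continuous_on UNIV f" and y: "E b y = y" "E a y = 0"
  shows "y \<in> spectral_dom g E f"
proof -
  have [measurable]: "f \<in> borel_measurable borel" using f by (rule borel_measurable_continuous_onI)
  have "compact (f ` {a..b})" by (intro compact_continuous_image continuous_on_subset[OF f]) auto
  then obtain B where B: "\<And>t. t \<in> {a..b} \<Longrightarrow> norm (f t) \<le> B"
    by (metis (no_types, lifting) bounded_iff compact_imp_bounded imageI)
  have "AE t in nu y. a < t" "AE t in nu y. t \<le> b" by (rule AE_nu_greater AE_nu_le; rule y)+
  hence "AE t in nu y. norm ((f t)\<^sup>2) \<le> B\<^sup>2"
  proof eventually_elim
    case (elim t)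
    hence "norm (f t) \<le> B" by (intro B) auto
    thus ?case using power_mono[of "\<bar>f t\<bar>" B 2] by simp
  qed
  hence "integrable (nu y) (\<lambda>t. (f t)\<^sup>2)"
    by (intro finite_measure.integrable_const_bound[OF finite_nu]) auto
  thus ?thesis by (simp add: spectral_dom_def)
qed

lemma dense_spectral_dom:
  assumes f: "continuous_on UNIV f"
  shows "closure (spectral_dom g E f) = UNIV"
proof (intro equalityI subsetI)
  fix x :: 'a
  let ?x = "\<lambda>n::nat. E (real n) x - E (- real n) x"
  have "?x n \<in> spectral_dom g E f" for n
    by (rule spectral_dom_bounded_support[OF f, of "real n" _ "- real n"]) (simp_all add: E_diff E_E)
  moreover have "?x \<longlonglongrightarrow> x - 0"
    by (intro tendsto_diff filterlim_compose[OF E_top] filterlim_compose[OF E_bot]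
        filterlim_real_sequentially filterlim_uminus_at_bot_at_top[THEN filterlim_compose])
  ultimately show "x \<in> closure (spectral_dom g E f)"
    unfolding closure_sequential by (intro exI[of _ ?x]) simp
qed simp

end

section \<open>Spectral integrals\<close>

text \<open>
  The growth condition dominates the step functions that sample \<open>f\<close> at the right end points of
  the cells of a dyadic grid.
\<close>

definition tame :: "(real \<Rightarrow> real) \<Rightarrow> bool" where
  "tame f \<longleftrightarrow> continuous_on UNIV f \<and> (\<exists>C\<ge>0. \<forall>t s. t \<le> s \<longrightarrow> s \<le> t + 1 \<longrightarrow> \<bar>f s\<bar> \<le> C * (1 + \<bar>f t\<bar>))"

lemma tame_measurable: "tame f \<Longrightarrow> f \<in> borel_measurable borel"
  by (simp add: tame_def borel_measurable_continuous_onI)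

text \<open>With mesh \<open>1 / 2 ^ n\<close> these cells cover \<open>{- (2 ^ n)<..2 ^ n}\<close>:
  the grid is refined and extended at the same time.\<close>

definition grid :: "nat \<Rightarrow> int set" where "grid n = {- (4 ^ n)..<4 ^ n}"

definition node :: "nat \<Rightarrow> int \<Rightarrow> real" where "node n k = real_of_int k / 2 ^ n"

definition step_fun :: "(real \<Rightarrow> real) \<Rightarrow> nat \<Rightarrow> real \<Rightarrow> real" where
  "step_fun f n t = (\<Sum>k\<in>grid n. f (node n (k + 1)) * indicator {node n k<..node n (k + 1)} t)"

lemma finite_grid [simp]: "finite (grid n)" by (simp add: grid_def)

lemma node_le: "node n k \<le> node n (k + 1)" by (simp add: node_def field_simps)

lemma step_fun_measurable [measurable]: "step_fun f n \<in> borel_measurable borel"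
  unfolding step_fun_def by measurable

text \<open>Cells are open on the left, so \<open>t\<close> lies in cell \<open>k\<close> exactly
  when \<open>k\<close> is the ceiling of \<open>t * 2 ^ n\<close> minus one. The sample point then
  has the ceiling itself as index.\<close>

lemma step_fun_eq:
  "step_fun f n t = (if \<lceil>t * 2 ^ n\<rceil> - 1 \<in> grid n then f (node n \<lceil>t * 2 ^ n\<rceil>) else 0)"
proof -
  have ind: "indicator {node n k<..node n (k + 1)} t = (if k = \<lceil>t * 2 ^ n\<rceil> - 1 then 1 else 0 :: real)" for k
  proof -
    have "t \<in> {node n k<..node n (k + 1)} \<longleftrightarrow> real_of_int k < t * 2 ^ n \<and> t * 2 ^ n \<le> real_of_int (k + 1)"
      by (simp add: node_def field_simps)
    also have "\<dots> \<longleftrightarrow> \<lceil>t * 2 ^ n\<rceil> = k + 1" by (simp add: ceiling_eq_iff)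
    finally show ?thesis by (auto simp: indicator_def)
  qed
  show ?thesis unfolding step_fun_def ind by (simp add: if_distrib[of "\<lambda>x. _ * x"] sum.delta cong: if_cong)
qed

lemma node_ceiling: "t \<le> node n \<lceil>t * 2 ^ n\<rceil>" "node n \<lceil>t * 2 ^ n\<rceil> \<le> t + 1 / 2 ^ n"
proof -
  have "t * 2 ^ n \<le> \<lceil>t * 2 ^ n\<rceil>" "\<lceil>t * 2 ^ n\<rceil> \<le> t * 2 ^ n + 1" by linarith+
  thus "t \<le> node n \<lceil>t * 2 ^ n\<rceil>" "node n \<lceil>t * 2 ^ n\<rceil> \<le> t + 1 / 2 ^ n"
    by (simp_all add: node_def field_simps)
qed

lemma step_fun_tendsto:
  assumes "tame f"
  shows "(\<lambda>n. step_fun f n t) \<longlonglongrightarrow> f t"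
proof -
  have "isCont f t" using assms by (simp add: tame_def continuous_on_eq_continuous_at)
  moreover have "(\<lambda>n. node n \<lceil>t * 2 ^ n\<rceil>) \<longlonglongrightarrow> t"
  proof (rule tendsto_sandwich[of "\<lambda>_. t" _ _ "\<lambda>n. t + 1 / 2 ^ n"])
    have "(\<lambda>n. (1/2)^n) \<longlonglongrightarrow> (0::real)" by (rule LIMSEQ_power_zero) simp
    from tendsto_add[OF tendsto_const this]
    show "(\<lambda>n. t + 1 / 2 ^ n) \<longlonglongrightarrow> t" by (simp add: power_one_over)
  qed (use node_ceiling[where t=t] in auto)
  ultimately have "(\<lambda>n. f (node n \<lceil>t * 2 ^ n\<rceil>)) \<longlonglongrightarrow> f t" by (rule isCont_tendsto_compose)
  moreover have "\<forall>\<^sub>F n in sequentially. f (node n \<lceil>t * 2 ^ n\<rceil>) = step_fun f n t"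
  proof -
    obtain N :: nat where N: "\<bar>t\<bar> + 1 < 2 ^ N" using real_arch_pow[of 2 "\<bar>t\<bar> + 1"] by auto
    have "\<lceil>t * 2 ^ n\<rceil> - 1 \<in> grid n" if "n \<ge> N" for n
    proof -
      have "(2::real) ^ N \<le> 2 ^ n" using that by (intro power_increasing) auto
      hence t: "\<bar>t\<bar> + 1 < 2 ^ n" using N by linarith
      have 1: "(1::real) \<le> 2 ^ n" by simp
      have "\<bar>t * 2 ^ n\<bar> + 1 \<le> \<bar>t\<bar> * 2 ^ n + 2 ^ n" using 1 by (simp add: abs_mult)
      also have "\<dots> = (\<bar>t\<bar> + 1) * 2 ^ n" by (simp add: algebra_simps)
      also have "\<dots> < 2 ^ n * 2 ^ n" using t by simp
      also have "(2::real) ^ n * 2 ^ n = 4 ^ n" by (simp flip: power_mult_distrib)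
      finally have "\<bar>t * 2 ^ n\<bar> + 1 < 4 ^ n" .
      hence l: "real_of_int (- (4 ^ n) + 1) \<le> t * 2 ^ n" and u: "t * 2 ^ n \<le> real_of_int (4 ^ n)"
        by (auto simp: abs_if split: if_splits)
      have "\<lceil>t * 2 ^ n\<rceil> \<le> 4 ^ n" using u by (simp only: ceiling_le_iff)
      moreover have "- (4 ^ n) + 1 \<le> \<lceil>t * 2 ^ n\<rceil>"
        using order_trans[OF l le_of_int_ceiling] by (simp only: of_int_le_iff)
      ultimately show ?thesis unfolding grid_def by simp
    qed
    thus ?thesis unfolding eventually_sequentially by (intro exI[of _ N]) (simp add: step_fun_eq)
  qed
  ultimately show ?thesis by (rule Lim_transform_eventually)
qed

lemma step_fun_bound:
  assumes "tame f"
  shows "\<exists>C\<ge>0. \<forall>n t. \<bar>step_fun f n t\<bar> \<le> C * (1 + \<bar>f t\<bar>)"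
proof -
  from assms obtain C where C: "C \<ge> 0" "\<And>t s. t \<le> s \<Longrightarrow> s \<le> t + 1 \<Longrightarrow> \<bar>f s\<bar> \<le> C * (1 + \<bar>f t\<bar>)"
    by (auto simp: tame_def)
  have "\<bar>step_fun f n t\<bar> \<le> C * (1 + \<bar>f t\<bar>)" for n t
  proof -
    have "1 / 2 ^ n \<le> (1::real)" by simp
    hence "\<bar>f (node n \<lceil>t * 2 ^ n\<rceil>)\<bar> \<le> C * (1 + \<bar>f t\<bar>)"
      using node_ceiling[where t=t and n=n] by (intro C) linarith+
    thus ?thesis using C(1) by (simp add: step_fun_eq)
  qed
  thus ?thesis using C(1) by blast
qed

context spectral_fam begin

definition step_op :: "(real \<Rightarrow> real) \<Rightarrow> nat \<Rightarrow> 'a \<Rightarrow> 'a" where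
  "step_op f n x = (\<Sum>k\<in>grid n. f (node n (k + 1)) *\<^sub>R (E (node n (k + 1)) x - E (node n k) x))"

text \<open>Increments of \<open>E\<close> over disjoint intervals are orthogonal. This makes the
  Stieltjes sums isometric with respect to \<open>nu x\<close>.\<close>

lemma ip_jumps:
  assumes "a \<le> b" "c \<le> d"
  shows "ip (E b x - E a x) (E d x - E c x) = measure (nu x) ({a<..b} \<inter> {c<..d})"
proof -
  have "ip (E b x - E a x) (E d x - E c x) =
      dist_fun x (min b d) - dist_fun x (min b c) - dist_fun x (min a d) + dist_fun x (min a c)"
    by (simp add: ip_simps ip_E_E)
  also have "\<dots> = measure (nu x) {max a c<..min b d}"
  proof (cases "max a c \<le> min b d")
    case True
    thus ?thesis using assms by (auto simp: measure_nu_Ioc min_def max_def)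
  next
    case False
    thus ?thesis using assms by (auto simp: min_def max_def split: if_splits)
  qed
  also have "{max a c<..min b d} = {a<..b} \<inter> {c<..d}" by auto
  finally show ?thesis .
qed

lemma integrable_step [simp]: "integrable (nu x) (\<lambda>t. step_fun f n t * step_fun f m t)"
  and integrable_step1 [simp]: "integrable (nu x) (step_fun f n)"
  and ip_step_op: "ip (step_op f n x) (step_op f m x) = (\<integral>t. step_fun f n t * step_fun f m t \<partial>nu x)"
  and ip_step_op_self: "ip (step_op f n x) x = (\<integral>t. step_fun f n t \<partial>nu x)"
proof -
  interpret finite_measure "nu x" by (rule finite_nu)
  let ?c = "\<lambda>n k. f (node n (k + 1))" and ?I = "\<lambda>n k. {node n k<..node n (k + 1)}"
  have e: "step_fun f n t * step_fun f m t = (\<Sum>k\<in>grid n. \<Sum>j\<in>grid m. ?c n k * ?c m j * indicator (?I n k \<inter> ?I m j) t)" for t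
    unfolding step_fun_def sum_product by (simp add: indicator_inter_arith mult_ac del: Int_greaterThanAtMost)
  have int: "integrable (nu x) (\<lambda>t. ?c n k * ?c m j * indicator (?I n k \<inter> ?I m j) t)" for k j
    by (intro integrable_mult_right integrable_real_indicator) (auto simp: less_top[symmetric])
  show "integrable (nu x) (\<lambda>t. step_fun f n t * step_fun f m t)"
    unfolding e by (intro Bochner_Integration.integrable_sum int)
  have "(\<integral>t. step_fun f n t * step_fun f m t \<partial>nu x) =
      (\<Sum>k\<in>grid n. \<Sum>j\<in>grid m. ?c n k * ?c m j * measure (nu x) (?I n k \<inter> ?I m j))"
    unfolding e by (subst Bochner_Integration.integral_sum, intro Bochner_Integration.integrable_sum int)
      (subst Bochner_Integration.integral_sum, intro int, simp)
  also have "\<dots> = ip (step_op f n x) (step_op f m x)"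
    unfolding step_op_def ip_sum_left by (simp add: ip_sum_right ip_jumps[OF node_le node_le] ip_scaleR_left ip_scaleR_right mult_ac)
  finally show "ip (step_op f n x) (step_op f m x) = (\<integral>t. step_fun f n t * step_fun f m t \<partial>nu x)" ..
  have int1: "integrable (nu x) (\<lambda>t. ?c n k * indicator (?I n k) t)" for k
    by (intro integrable_mult_right integrable_real_indicator) (auto simp: less_top[symmetric])
  show "integrable (nu x) (step_fun f n)"
    unfolding step_fun_def[abs_def] by (intro Bochner_Integration.integrable_sum int1)
  have "(\<integral>t. step_fun f n t \<partial>nu x) = (\<Sum>k\<in>grid n. ?c n k * measure (nu x) (?I n k))"
    unfolding step_fun_def by (subst Bochner_Integration.integral_sum, intro int1, simp)
  also have "\<dots> = ip (step_op f n x) x"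
    unfolding step_op_def ip_sum_left by (simp add: measure_nu_Ioc[OF node_le] ip_scaleR_left ip_diff_left ip_E_self)
  finally show "ip (step_op f n x) x = (\<integral>t. step_fun f n t \<partial>nu x)" ..
qed

lemma step_op_add: "step_op f n (x + y) = step_op f n x + step_op f n y"
  by (simp add: step_op_def E_add sum.distrib[symmetric] algebra_simps)

lemma step_op_scaleC: "step_op f n (a *\<^sub>C x) = a *\<^sub>C step_op f n x"
  by (simp add: step_op_def E_scaleC complex_vector.scale_sum_right scaleR_scaleC scaleC_scaleC mult.commute
      flip: complex_vector.scale_right_diff_distrib)

definition spectral_int :: "(real \<Rightarrow> real) \<Rightarrow> 'a \<Rightarrow> 'a" where
  "spectral_int f x = lim (\<lambda>n. step_op f n x)"

context
  fixes f assumes tame: "tame f"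
begin

lemma f_measurable: "f \<in> borel_measurable borel"
  using tame by (rule tame_measurable)

lemma integrable_f:
  assumes "x \<in> spectral_dom g E f"
  shows "integrable (nu x) f" "integrable (nu x) (\<lambda>t. (f t)\<^sup>2)" "integrable (nu x) (\<lambda>t. (1 + \<bar>f t\<bar>)\<^sup>2)"
proof -
  note [measurable] = f_measurable
  interpret finite_measure "nu x" by (rule finite_nu)
  show i: "integrable (nu x) (\<lambda>t. (f t)\<^sup>2)" using assms by (simp add: spectral_dom_def)
  have "integrable (nu x) (\<lambda>t. 1 + (f t)\<^sup>2)" using i by simp
  thus f: "integrable (nu x) f"
  proof (rule Bochner_Integration.integrable_bound)
    have "\<bar>s\<bar> \<le> 1 + s\<^sup>2" for s :: real
    proof -
      have "0 \<le> (\<bar>s\<bar> - 1)\<^sup>2" by simp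
      thus ?thesis by (simp add: power2_diff)
    qed
    thus "AE t in nu x. norm (f t) \<le> norm (1 + (f t)\<^sup>2)" by simp
  qed simp
  have "(\<lambda>t. (1 + \<bar>f t\<bar>)\<^sup>2) = (\<lambda>t. 1 + 2 * \<bar>f t\<bar> + (f t)\<^sup>2)" by (simp add: fun_eq_iff power2_sum)
  thus "integrable (nu x) (\<lambda>t. (1 + \<bar>f t\<bar>)\<^sup>2)" using i f by simp
qed

lemma integral_step_tendsto:
  assumes x: "x \<in> spectral_dom g E f"
  shows "(\<lambda>n. \<integral>t. step_fun f n t \<partial>nu x) \<longlonglongrightarrow> (\<integral>t. f t \<partial>nu x)"
    "(\<lambda>n. \<integral>t. (step_fun f n t)\<^sup>2 \<partial>nu x) \<longlonglongrightarrow> (\<integral>t. (f t)\<^sup>2 \<partial>nu x)"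
    "(\<lambda>n. \<integral>t. (step_fun f n t - f t)\<^sup>2 \<partial>nu x) \<longlonglongrightarrow> 0"
    "\<And>n. integrable (nu x) (\<lambda>t. (step_fun f n t - f t)\<^sup>2)"
proof -
  note [measurable] = f_measurable
  interpret finite_measure "nu x" by (rule finite_nu)
  note i = integrable_f[OF x]
  from step_fun_bound[OF tame] obtain C where C: "C \<ge> 0" "\<And>n t. \<bar>step_fun f n t\<bar> \<le> C * (1 + \<bar>f t\<bar>)" by blast
  note lim = step_fun_tendsto[OF tame]
  show "(\<lambda>n. \<integral>t. step_fun f n t \<partial>nu x) \<longlonglongrightarrow> (\<integral>t. f t \<partial>nu x)"
    by (rule integral_dominated_convergence[where w="\<lambda>t. C * (1 + \<bar>f t\<bar>)"]) (use C i lim in auto)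
  have sq: "(step_fun f n t)\<^sup>2 \<le> C\<^sup>2 * (1 + \<bar>f t\<bar>)\<^sup>2" for n t
    using power_mono[OF C(2)[of n t], of 2] by (simp add: power_mult_distrib)
  show "(\<lambda>n. \<integral>t. (step_fun f n t)\<^sup>2 \<partial>nu x) \<longlonglongrightarrow> (\<integral>t. (f t)\<^sup>2 \<partial>nu x)"
    by (rule integral_dominated_convergence[where w="\<lambda>t. C\<^sup>2 * (1 + \<bar>f t\<bar>)\<^sup>2"])
      (use sq i lim in \<open>auto intro!: tendsto_power\<close>)
  have sq': "(step_fun f n t - f t)\<^sup>2 \<le> (C + 1)\<^sup>2 * (1 + \<bar>f t\<bar>)\<^sup>2" for n t
  proof -
    have "\<bar>step_fun f n t - f t\<bar> \<le> (C + 1) * (1 + \<bar>f t\<bar>)" using C(2)[of n t] by (simp add: algebra_simps)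
    from power_mono[OF this, of 2] show ?thesis by (simp add: power_mult_distrib)
  qed
  have "(\<lambda>n. \<integral>t. (step_fun f n t - f t)\<^sup>2 \<partial>nu x) \<longlonglongrightarrow> (\<integral>t. (f t - f t)\<^sup>2 \<partial>nu x)"
    by (rule integral_dominated_convergence[where w="\<lambda>t. (C + 1)\<^sup>2 * (1 + \<bar>f t\<bar>)\<^sup>2"])
      (use sq' i LIM_zero[OF lim] in \<open>auto intro!: tendsto_power\<close>)
  thus "(\<lambda>n. \<integral>t. (step_fun f n t - f t)\<^sup>2 \<partial>nu x) \<longlonglongrightarrow> 0" by simp
  show "integrable (nu x) (\<lambda>t. (step_fun f n t - f t)\<^sup>2)" for n
    by (rule Bochner_Integration.integrable_bound[where f="\<lambda>t. (C + 1)\<^sup>2 * (1 + \<bar>f t\<bar>)\<^sup>2"]) (use sq' i in auto)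
qed

text \<open>By \<open>ip_step_op\<close>, the square distance of two Stieltjes sums at
  \<open>x\<close> is the square mean distance of the step functions under \<open>nu x\<close>, and
  the step functions converge to \<open>f\<close> in square mean.\<close>

lemma step_op_tendsto:
  assumes x: "x \<in> spectral_dom g E f"
  shows "(\<lambda>n. step_op f n x) \<longlonglongrightarrow> spectral_int f x"
proof -
  let ?d = "\<lambda>n. \<integral>t. (step_fun f n t - f t)\<^sup>2 \<partial>nu x"
  have le: "ip (step_op f n x - step_op f m x) (step_op f n x - step_op f m x) \<le> 2 * ?d n + 2 * ?d m" for m n
  proof -
    have "ip (step_op f n x - step_op f m x) (step_op f n x - step_op f m x) =
        (\<integral>t. step_fun f n t * step_fun f n t \<partial>nu x) - (\<integral>t. step_fun f n t * step_fun f m t \<partial>nu x)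
        - (\<integral>t. step_fun f m t * step_fun f n t \<partial>nu x) + (\<integral>t. step_fun f m t * step_fun f m t \<partial>nu x)"
      by (simp add: ip_diff_left ip_diff_right ip_step_op)
    also have "\<dots> = (\<integral>t. (step_fun f n t - step_fun f m t)\<^sup>2 \<partial>nu x)"
      by (simp add: power2_eq_square left_diff_distrib right_diff_distrib mult.commute[of "step_fun f m _" "step_fun f n _"])
    also have "\<dots> \<le> (\<integral>t. 2 * (step_fun f n t - f t)\<^sup>2 + 2 * (step_fun f m t - f t)\<^sup>2 \<partial>nu x)"
    proof (rule integral_mono)
      show "integrable (nu x) (\<lambda>t. (step_fun f n t - step_fun f m t)\<^sup>2)"
        by (simp add: power2_eq_square left_diff_distrib right_diff_distrib)
      show "integrable (nu x) (\<lambda>t. 2 * (step_fun f n t - f t)\<^sup>2 + 2 * (step_fun f m t - f t)\<^sup>2)"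
        using integral_step_tendsto(4)[OF x] by simp
      fix t
      have "0 \<le> (step_fun f n t - f t + (step_fun f m t - f t))\<^sup>2" by simp
      thus "(step_fun f n t - step_fun f m t)\<^sup>2 \<le> 2 * (step_fun f n t - f t)\<^sup>2 + 2 * (step_fun f m t - f t)\<^sup>2"
        by (simp add: power2_eq_square algebra_simps)
    qed
    also have "\<dots> = 2 * ?d n + 2 * ?d m"
      using integral_step_tendsto(4)[OF x] by simp
    finally show ?thesis .
  qed
  have "convergent (\<lambda>n. step_op f n x)"
  proof (rule Cauchy_ipI)
    fix e :: real assume "e > 0"
    hence "e / 4 > 0" by simp
    from LIMSEQ_D[OF integral_step_tendsto(3)[OF x] this]
    obtain N where N: "\<And>n. n \<ge> N \<Longrightarrow> ?d n < e / 4" by auto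
    have "2 * ?d n + 2 * ?d m < e" if "m \<ge> N" "n \<ge> m" for m n
      using N[of m] N[of n] that by simp
    thus "\<exists>N. \<forall>m\<ge>N. \<forall>n\<ge>m. ip (step_op f n x - step_op f m x) (step_op f n x - step_op f m x) < e"
      by (intro exI[of _ N] allI impI le_less_trans[OF le])
  qed
  thus ?thesis by (simp add: spectral_int_def convergent_LIMSEQ_iff)
qed

lemma spectral_int_norm:
  assumes x: "x \<in> spectral_dom g E f"
  shows "ip (spectral_int f x) (spectral_int f x) = (\<integral>t. (f t)\<^sup>2 \<partial>nu x)"
  by (rule LIMSEQ_unique[OF tendsto_ip[OF step_op_tendsto[OF x] step_op_tendsto[OF x]]])
    (use integral_step_tendsto(2)[OF x] in \<open>simp add: ip_step_op power2_eq_square\<close>)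

lemma spectral_int_form:
  assumes x: "x \<in> spectral_dom g E f"
  shows "g (spectral_int f x) x = complex_of_real (\<integral>t. f t \<partial>nu x)"
proof (rule LIMSEQ_unique[OF tendsto_g[OF step_op_tendsto[OF x]]])
  have E: "g (E t x) x = complex_of_real (ip (E t x) x)" for t
  proof -
    have "g (E t x) x = g (E t (E t x)) x" by simp
    also have "\<dots> = g (E t x) (E t x)" by (simp only: E_g)
    finally show ?thesis by (simp add: g_self ip_E_self dist_fun_def)
  qed
  have "g (step_op f n x) x = complex_of_real (ip (step_op f n x) x)" for n
    unfolding step_op_def g_sum_left ip_sum_left
    by (simp add: scaleR_scaleC[of _ "_ - _"] g_scaleC_left g_diff_left E ip_scaleR_left ip_diff_left flip: of_real_diff of_real_mult)
      (simp add: ip_diff_left[symmetric] flip: scaleR_scaleC ip_scaleR_left)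
  thus "(\<lambda>n. g (step_op f n x) x) \<longlonglongrightarrow> complex_of_real (\<integral>t. f t \<partial>nu x)"
    using integral_step_tendsto(1)[OF x] by (simp add: ip_step_op_self tendsto_of_real)
qed

lemma clinear_on_spectral_int: "clinear_on (spectral_dom g E f) (spectral_int f)"
  unfolding clinear_on_def
proof (intro conjI ballI allI)
  show s: "csubspace (spectral_dom g E f)" by (rule csubspace_spectral_dom[OF f_measurable])
  fix x y assume xy: "x \<in> spectral_dom g E f" "y \<in> spectral_dom g E f"
  show "spectral_int f (x + y) = spectral_int f x + spectral_int f y"
    using tendsto_add[OF step_op_tendsto[OF xy(1)] step_op_tendsto[OF xy(2)]]
    by (intro LIMSEQ_unique[OF step_op_tendsto[OF complex_vector.subspace_add[OF s xy]]]) (simp add: step_op_add)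
next
  fix x a assume x: "x \<in> spectral_dom g E f"
  have s: "csubspace (spectral_dom g E f)" by (rule csubspace_spectral_dom[OF f_measurable])
  show "spectral_int f (a *\<^sub>C x) = a *\<^sub>C spectral_int f x"
    using tendsto_scaleC[OF step_op_tendsto[OF x]]
    by (intro LIMSEQ_unique[OF step_op_tendsto[OF complex_vector.subspace_scale[OF s x]]]) (simp add: step_op_scaleC)
qed

lemma is_spectral_integral_spectral_int: "is_spectral_integral g E f (spectral_dom g E f) (spectral_int f)"
  by (simp add: is_spectral_integral_def clinear_on_spectral_int spectral_int_form)

text \<open>The difference of two candidates has vanishing quadratic form, so polarization and
  density of the domain make it zero. This identifies operators that are only chosen by
  \<open>SOME\<close>.\<close>

lemma spectral_integral_unique:
  assumes S: "is_spectral_integral g E f D S" and x: "x \<in> D"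
  shows "S x = spectral_int f x"
proof -
  have D: "D = spectral_dom g E f" and lin: "clinear_on D S"
    and form: "\<And>x. x \<in> D \<Longrightarrow> g (S x) x = complex_of_real (\<integral>t. f t \<partial>nu x)"
    using S by (auto simp: is_spectral_integral_def)
  have sub: "csubspace D" unfolding D by (rule csubspace_spectral_dom[OF f_measurable])
  have "S x - spectral_int f x = 0"
  proof (rule g_conv_zero_on_dense)
    show "closure D = UNIV" unfolding D using tame by (intro dense_spectral_dom) (simp add: tame_def)
    fix y assume y: "y \<in> D"
    show "g (S x - spectral_int f x) y = 0"
    proof (rule polarization[OF sub _ _ x y])
      show "clinear_on D (\<lambda>x. S x - spectral_int f x)"
        using lin clinear_on_spectral_int unfolding D[symmetric] clinear_on_def
        by (auto simp: complex_vector.scale_right_diff_distrib)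
      show "g (S x - spectral_int f x) x = 0" if "x \<in> D" for x
        using form[OF that] spectral_int_form[of x] that unfolding D by (simp add: g_diff_left)
    qed
  qed
  thus ?thesis by simp
qed

lemma spectral_integral_norm:
  assumes S: "is_spectral_integral g E f D S" and x: "x \<in> D"
  shows "ip (S x) (S x) = (\<integral>t. (f t)\<^sup>2 \<partial>nu x)"
  using spectral_integral_unique[OF S x] spectral_int_norm[of x] S x
  by (simp add: is_spectral_integral_def)

end

lemma spectral_integral_sym:
  assumes S: "is_spectral_integral g E f D S" and xy: "x \<in> D" "y \<in> D"
  shows "g (S x) y = g x (S y)"
  using S xy by (intro symmetric_of_real_form[of D]) (auto simp: is_spectral_integral_def clinear_on_def)

text \<open>It permits replacing \<open>t powr r\<close> by a tame function that agrees with it on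
  the support of the measures.\<close>

lemma is_spectral_integral_cong:
  assumes [measurable]: "f \<in> borel_measurable borel" "f' \<in> borel_measurable borel"
    and eq: "\<And>x. AE t in nu x. f t = f' t"
  shows "is_spectral_integral g E f D S \<longleftrightarrow> is_spectral_integral g E f' D S"
proof -
  have "integrable (nu x) (\<lambda>t. (f t)\<^sup>2) \<longleftrightarrow> integrable (nu x) (\<lambda>t. (f' t)\<^sup>2)" for x
  proof (rule integrable_cong_AE)
    show "(\<lambda>t. (f t)\<^sup>2) \<in> borel_measurable (nu x)" "(\<lambda>t. (f' t)\<^sup>2) \<in> borel_measurable (nu x)" by measurable
    show "AE t in nu x. (f t)\<^sup>2 = (f' t)\<^sup>2" using eq[of x] by eventually_elim simp
  qed
  hence "spectral_dom g E f = spectral_dom g E f'" by (simp add: spectral_dom_def)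
  moreover have "(\<integral>t. f t \<partial>nu x) = (\<integral>t. f' t \<partial>nu x)" for x
    by (rule integral_cong_AE) (use eq in auto)
  ultimately show ?thesis by (simp add: is_spectral_integral_def)
qed

end

section \<open>The spectral theorem\<close>

context equiv_inner begin

text \<open>The vector is \<open>y\<close> minus its nearest point in \<open>V\<close>. A minimizing
  sequence is Cauchy by the parallelogram law, since midpoints stay in \<open>V\<close>;
  orthogonality follows by varying the minimum along \<open>u\<close>.\<close>

lemma exists_orthogonal:
  assumes V: "csubspace V" "closed V" "V \<noteq> UNIV"
  shows "\<exists>w. w \<noteq> 0 \<and> (\<forall>v\<in>V. g w v = 0)"
proof -
  from V(3) obtain y where y: "y \<notin> V" by blast
  let ?q = "\<lambda>v. ip (y - v) (y - v)"
  define d where "d = Inf (?q ` V)"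
  have ne: "V \<noteq> {}" using complex_vector.subspace_0[OF V(1)] by blast
  have bb: "bdd_below (?q ` V)" by (rule bdd_belowI[of _ 0]) auto
  have d_le: "d \<le> ?q v" if "v \<in> V" for v
    unfolding d_def by (rule cInf_lower) (use that bb in auto)
  have "\<exists>v\<in>V. ?q v < d + 1 / real (Suc n)" for n
    using cInf_lessD[of "?q ` V" "d + 1 / real (Suc n)"] ne by (auto simp: d_def)
  then obtain v where v: "\<And>n. v n \<in> V" "\<And>n. ?q (v n) < d + 1 / real (Suc n)" by metis
  have "convergent v"
  proof (rule Cauchy_ipI)
    fix e :: real assume "e > 0"
    then obtain N where N: "inverse (real (Suc N)) < e / 4"
      using reals_Archimedean[of "e / 4"] by auto
    have "ip (v n - v m) (v n - v m) < e" if mn: "m \<ge> N" "n \<ge> m" for m n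
    proof -
      let ?h = "(1/2) *\<^sub>R (v n + v m)"
      have "?h \<in> V" unfolding scaleR_scaleC
        by (intro complex_vector.subspace_scale[OF V(1)] complex_vector.subspace_add[OF V(1)] v)
      hence "d \<le> ?q ?h" by (rule d_le)
      moreover have "ip (v n - v m) (v n - v m) = 2 * ?q (v n) + 2 * ?q (v m) - 4 * ?q ?h"
      proof -
        define a b where "a = y - v n" and "b = y - v m"
        have "(1/2) *\<^sub>R (2 *\<^sub>R y) = y" unfolding scaleR_scaleR by simp
        hence "y - ?h = (1/2) *\<^sub>R (2 *\<^sub>R y) - ?h" by (simp only:)
        also have "\<dots> = (1/2) *\<^sub>R (a + b)" unfolding a_def b_def scaleR_right_diff_distrib[symmetric]
          by (simp add: scaleR_2 algebra_simps)
        finally have h: "4 * ?q ?h = ip (a + b) (a + b)" by (simp add: ip_scaleR_left ip_scaleR_right)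
        have "v n - v m = b - a" by (simp add: a_def b_def)
        thus ?thesis unfolding h a_def[symmetric] b_def[symmetric] by (simp add: ip_simps ip_commute[of a b])
      qed
      moreover have k: "4 * (1 / real (Suc k)) < e" if "k \<ge> N" for k
      proof -
        have "1 / real (Suc k) < e / 4"
          using that N by (intro le_less_trans[OF _ N]) (simp add: inverse_eq_divide frac_le)
        thus ?thesis by simp
      qed
      ultimately show ?thesis using v(2)[of n] v(2)[of m] k[of n] k[of m] mn by linarith
    qed
    thus "\<exists>N. \<forall>m\<ge>N. \<forall>n\<ge>m. ip (v n - v m) (v n - v m) < e" by blast
  qed
  then obtain l where l: "v \<longlonglongrightarrow> l" by (auto simp: convergent_def)
  have lV: "l \<in> V" using closed_sequentially[OF V(2) v(1) l] .
  have "(\<lambda>n. ?q (v n)) \<longlonglongrightarrow> ?q l" by (intro tendsto_ip tendsto_diff tendsto_const l)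
  moreover have "(\<lambda>n. d + 1 / real (Suc n)) \<longlonglongrightarrow> d + 0"
    by (intro tendsto_add tendsto_const LIMSEQ_inverse_real_of_nat[unfolded inverse_eq_divide])
  ultimately have "?q l \<le> d + 0" by (rule LIMSEQ_le) (use v(2) less_imp_le in blast)
  hence le: "?q l \<le> ?q u" if "u \<in> V" for u using d_le[OF that] by simp
  let ?w = "y - l"
  have orth: "ip ?w u = 0" if u: "u \<in> V" for u
  proof (cases "u = 0")
    case False
    let ?s = "ip ?w u / ip u u"
    have "l + ?s *\<^sub>R u \<in> V" unfolding scaleR_scaleC
      by (intro complex_vector.subspace_add[OF V(1)] complex_vector.subspace_scale[OF V(1)] u lV)
    from le[OF this] have "ip ?w ?w \<le> ip (?w - ?s *\<^sub>R u) (?w - ?s *\<^sub>R u)" by (simp add: algebra_simps)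
    also have "\<dots> = ip ?w ?w - 2 * ?s * ip ?w u + ?s * ?s * ip u u"
      unfolding ip_diff_left[of "?w"] ip_diff_right[of _ "?w"] ip_scaleR_left ip_scaleR_right
      by (simp add: ip_commute[of u ?w])
    also have "?s * ?s * ip u u = ?s * ip ?w u" using False by simp
    finally have "?s * ip ?w u \<le> 0" by simp
    hence "(ip ?w u)\<^sup>2 / ip u u \<le> 0" by (simp add: power2_eq_square)
    thus ?thesis using ip_pos[OF False] by (simp add: divide_le_0_iff)
  qed simp
  have "g ?w u = 0" if "u \<in> V" for u
    using orth[OF that] orth[OF complex_vector.subspace_scale[OF V(1) that, of \<i>]]
    by (simp add: complex_eq_iff Im_g ip_def)
  moreover have "?w \<noteq> 0" using y lV by auto
  ultimately show ?thesis by blast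
qed

end

lemma tame_id: "tame (\<lambda>t. t)"
  unfolding tame_def by (intro conjI exI[of _ 1]) (auto intro: continuous_intros)

locale posdef_selfadjoint = equiv_inner g for g :: "'a::complex_hilbert \<Rightarrow> 'a \<Rightarrow> complex" +
  fixes D :: "'a set" and S :: "'a \<Rightarrow> 'a"
  assumes selfadjoint: "selfadjoint_op g D S" and posdef: "posdef_op g D S"
begin

lemma S_clinear: "clinear_on D S"
  and D_dense: "closure D = UNIV"
  and S_adjoint: "(x \<in> D \<and> S x = y) \<longleftrightarrow> (\<forall>z\<in>D. g y z = g x (S z))"
  using selfadjoint unfolding selfadjoint_op_def by blast+

lemma D_subspace: "csubspace D"
  using S_clinear by (simp add: clinear_on_def)

lemmas S_add = clinear_onD(2)[OF S_clinear]
  and S_scaleC = clinear_onD(3)[OF S_clinear]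

lemma S_sym: "x \<in> D \<Longrightarrow> z \<in> D \<Longrightarrow> g (S x) z = g x (S z)"
  using S_adjoint by blast

lemma lower_bound: "\<exists>\<alpha>>0. \<forall>x\<in>D. \<alpha> * ip x x \<le> ip (S x) x"
  using posdef unfolding posdef_op_def cnorm_power2 ip_def by blast

lemma S_bounded_below:
  assumes "\<alpha> > 0" "\<And>x. x \<in> D \<Longrightarrow> \<alpha> * ip x x \<le> ip (S x) x" "x \<in> D"
  shows "\<alpha> * cnorm g x \<le> cnorm g (S x)"
proof (cases "x = 0")
  case False
  have "\<alpha> * cnorm g x * cnorm g x \<le> ip (S x) x" using assms(2)[OF assms(3)] by (simp add: cnorm_power2[symmetric] power2_eq_square)
  also have "\<dots> \<le> cnorm g (S x) * cnorm g x" using ip_CS_abs[of "S x" x] by simp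
  finally show ?thesis using False by (simp add: less_le)
qed (simp add: cnorm_eq)

lemma S_inj: "x \<in> D \<Longrightarrow> S x = 0 \<Longrightarrow> x = 0"
  using lower_bound by (smt (verit) ip_pos ip_zero_left mult_pos_pos)

lemma S_zero [simp]: "S 0 = 0"
  using S_scaleC[of 0 0] complex_vector.subspace_0[OF D_subspace] by simp

lemma S_diff: "x \<in> D \<Longrightarrow> y \<in> D \<Longrightarrow> S (x - y) = S x - S y"
proof -
  assume xy: "x \<in> D" "y \<in> D"
  have "x - y \<in> D" by (rule complex_vector.subspace_diff[OF D_subspace xy])
  from S_add[OF this xy(2)] show ?thesis by simp
qed

text \<open>The lower bound makes the range closed. A vector orthogonal to the range satisfies the
  adjoint relation with value zero, so it lies in \<open>D\<close> and \<open>S\<close> annihilates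
  it; injectivity then excludes a proper range.\<close>

lemma S_surj: "S ` D = UNIV"
proof (rule ccontr)
  assume neq: "S ` D \<noteq> UNIV"
  obtain \<alpha> where \<alpha>: "\<alpha> > 0" "\<And>x. x \<in> D \<Longrightarrow> \<alpha> * ip x x \<le> ip (S x) x" using lower_bound by blast
  have sub: "csubspace (S ` D)"
  proof (rule complex_vector.subspaceI)
    show "0 \<in> S ` D" using complex_vector.subspace_0[OF D_subspace] by (metis S_zero image_eqI)
    show "x + y \<in> S ` D" if "x \<in> S ` D" "y \<in> S ` D" for x y
    proof -
      from that obtain z w where "z \<in> D" "x = S z" "w \<in> D" "y = S w" by blast
      thus ?thesis using complex_vector.subspace_add[OF D_subspace, of z w]
        by (intro image_eqI[of _ S "z + w"]) (simp_all add: S_add)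
    qed
    show "a *\<^sub>C x \<in> S ` D" if "x \<in> S ` D" for a x
    proof -
      from that obtain z where "z \<in> D" "x = S z" by blast
      thus ?thesis using complex_vector.subspace_scale[OF D_subspace, of z a]
        by (intro image_eqI[of _ S "a *\<^sub>C z"]) (simp_all add: S_scaleC)
    qed
  qed
  have "closed (S ` D)"
  proof (rule closed_sequential_limits[THEN iffD2], intro allI impI, elim conjE)
    fix X y assume X: "\<forall>n. X n \<in> S ` D" "X \<longlonglongrightarrow> y"
    hence "\<forall>n. \<exists>x. x \<in> D \<and> X n = S x" by blast
    then obtain x where x: "\<And>n. x n \<in> D" "\<And>n. X n = S (x n)" by metis
    have le: "\<alpha>\<^sup>2 * ip (x n - x m) (x n - x m) \<le> ip (X n - X m) (X n - X m)" for m n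
    proof -
      have "x n - x m \<in> D" by (intro complex_vector.subspace_diff[OF D_subspace] x)
      from S_bounded_below[OF \<alpha> this] have "\<alpha> * cnorm g (x n - x m) \<le> cnorm g (X n - X m)"
        by (simp add: x S_diff)
      from power_mono[OF this, of 2] show ?thesis using \<alpha> by (simp add: power_mult_distrib cnorm_power2)
    qed
    have "convergent x"
    proof (rule Cauchy_ipI)
      fix e :: real assume e: "e > 0"
      have "(\<lambda>n. ip (X n - y) (X n - y)) \<longlonglongrightarrow> 0"
        using LIM_zero[OF X(2)] by (simp add: tendsto_zero_iff_ip)
      moreover have "\<alpha>\<^sup>2 * e / 4 > 0" using e \<alpha> by simp
      ultimately have "\<forall>\<^sub>F n in sequentially. ip (X n - y) (X n - y) < \<alpha>\<^sup>2 * e / 4"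
        by (rule order_tendstoD)
      then obtain N where N: "\<And>n. n \<ge> N \<Longrightarrow> ip (X n - y) (X n - y) < \<alpha>\<^sup>2 * e / 4"
        by (auto simp: eventually_sequentially)
      have "ip (x n - x m) (x n - x m) < e" if "m \<ge> N" "n \<ge> m" for m n
      proof -
        have "ip (X n - X m) (X n - X m) = ip ((X n - y) + (y - X m)) ((X n - y) + (y - X m))" by simp
        also have "\<dots> \<le> 2 * ip (X n - y) (X n - y) + 2 * ip (y - X m) (y - X m)" by (rule ip_triangle2)
        also have "ip (y - X m) (y - X m) = ip (X m - y) (X m - y)" by (simp add: ip_simps)
        finally have "ip (X n - X m) (X n - X m) < \<alpha>\<^sup>2 * e" using N[of m] N[of n] that by simp
        with le[of n m] have "\<alpha>\<^sup>2 * ip (x n - x m) (x n - x m) < \<alpha>\<^sup>2 * e" by linarith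
        thus ?thesis using \<alpha> by simp
      qed
      thus "\<exists>N. \<forall>m\<ge>N. \<forall>n\<ge>m. ip (x n - x m) (x n - x m) < e" by blast
    qed
    then obtain l where l: "x \<longlonglongrightarrow> l" by (auto simp: convergent_def)
    have "\<forall>z\<in>D. g y z = g l (S z)"
    proof
      fix z assume z: "z \<in> D"
      have "(\<lambda>n. g (X n) z) \<longlonglongrightarrow> g y z" by (rule tendsto_g[OF X(2)])
      moreover have "(\<lambda>n. g (X n) z) \<longlonglongrightarrow> g l (S z)" using tendsto_g[OF l, of "S z"] x z by (simp add: S_sym)
      ultimately show "g y z = g l (S z)" by (rule LIMSEQ_unique)
    qed
    hence "l \<in> D" "S l = y" using S_adjoint by blast+
    thus "y \<in> S ` D" by blast
  qed
  from exists_orthogonal[OF sub this neq] obtain w where w: "w \<noteq> 0" "\<And>z. z \<in> D \<Longrightarrow> g w (S z) = 0" by blast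
  hence "\<forall>z\<in>D. g 0 z = g w (S z)" by simp
  hence "w \<in> D" "S w = 0" using S_adjoint by blast+
  with S_inj w show False by blast
qed

definition T :: "'a \<Rightarrow> 'a" where "T = inv_into D S"

lemma T_in [simp]: "T y \<in> D" and S_T [simp]: "S (T y) = y"
  using S_surj by (auto simp: T_def inv_into_into f_inv_into_f)

lemma S_inj_on: "inj_on S D"
  by (rule inj_onI) (metis S_diff S_inj complex_vector.subspace_diff[OF D_subspace] eq_iff_diff_eq_0)

lemma T_S [simp]: "x \<in> D \<Longrightarrow> T (S x) = x"
  by (simp add: T_def S_inj_on)

lemma T_eqI: "x \<in> D \<Longrightarrow> S x = y \<Longrightarrow> T y = x"
  by auto

lemma T_scaleC: "T (a *\<^sub>C y) = a *\<^sub>C T y"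
  by (rule T_eqI) (simp_all add: complex_vector.subspace_scale[OF D_subspace] S_scaleC)

lemma T_add: "T (x + y) = T x + T y"
  by (rule T_eqI) (simp_all add: complex_vector.subspace_add[OF D_subspace] S_add)

lemma T_bound: "\<alpha> > 0 \<Longrightarrow> (\<And>x. x \<in> D \<Longrightarrow> \<alpha> * ip x x \<le> ip (S x) x) \<Longrightarrow> cnorm g (T y) \<le> inverse \<alpha> * cnorm g y"
  using S_bounded_below[of \<alpha> "T y"] by (simp add: field_simps)

lemma T_sym: "sym T"
  unfolding sym_def
proof
  obtain \<alpha> where \<alpha>: "\<alpha> > 0" "\<And>x. x \<in> D \<Longrightarrow> \<alpha> * ip x x \<le> ip (S x) x" using lower_bound by blast
  show "bounded_linear T"
    by (rule bounded_linear_ipI[OF _ _ T_bound[OF \<alpha>]]) (simp_all add: T_add T_scaleC scaleR_scaleC)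
  show "\<forall>x y. ip (T x) y = ip x (T y)"
    using S_sym[of "T _" "T _"] by (simp add: ip_def)
qed

lemma T_strict: "y \<noteq> 0 \<Longrightarrow> 0 < ip (T y) y"
proof -
  assume y: "y \<noteq> 0"
  obtain \<alpha> where \<alpha>: "\<alpha> > 0" "\<And>x. x \<in> D \<Longrightarrow> \<alpha> * ip x x \<le> ip (S x) x" using lower_bound by blast
  have "T y \<noteq> 0" using y S_T[of y] by force
  hence "0 < \<alpha> * ip (T y) (T y)" using \<alpha>(1) ip_pos by simp
  also have "\<dots> \<le> ip (S (T y)) (T y)" by (rule \<alpha>) simp
  finally show ?thesis by (simp add: ip_commute)
qed

lemma T_pos: "pos T"
  unfolding pos_def
proof
  show "0 \<le> ip (T y) y" for y using T_strict[of y] by (cases "y = 0") auto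
qed

section \<open>Spectral projections from the sign of \<open>1 - t T\<close>\<close>

definition neg_projection :: "('a \<Rightarrow> 'a) \<Rightarrow> ('a \<Rightarrow> 'a) \<Rightarrow> bool" where
  "neg_projection B Q \<longleftrightarrow> sym Q \<and> (\<forall>x. Q (Q x) = Q x) \<and> (\<forall>x. ip (B (Q x)) (Q x) \<le> 0) \<and>
    (\<forall>x. Q x = 0 \<longrightarrow> 0 \<le> ip (B x) x) \<and> (\<forall>x. Q x = 0 \<longrightarrow> ip (B x) x \<le> 0 \<longrightarrow> x = 0) \<and>
    (\<forall>X. bounded_linear X \<longrightarrow> commuting X B \<longrightarrow> commuting X Q)"

text \<open>A nonpositive form of \<open>1 - t T\<close> means that \<open>S\<close> is at most
  \<open>t\<close>, so this is the spectral projection of \<open>S\<close> for \<open>{..t}\<close>.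
  The strictness clause puts the kernel of \<open>1 - t T\<close> into the range; an eigenvalue
  \<open>t\<close> is thus included, which is the source of right continuity. For
  \<open>t \<le> 0\<close> the projection is zero, as \<open>S\<close> is positive.\<close>

definition proj :: "real \<Rightarrow> 'a \<Rightarrow> 'a" where
  "proj t = (if t \<le> 0 then (\<lambda>x. 0) else (SOME Q. neg_projection (\<lambda>x. x - t *\<^sub>R T x) Q))"

lemma proj_nonpos [simp]: "t \<le> 0 \<Longrightarrow> proj t x = 0"
  by (simp add: proj_def)

lemma proj_props:
  assumes t: "t > 0"
  shows "sym (proj t)" "proj t (proj t x) = proj t x" "ip (proj t x - t *\<^sub>R T (proj t x)) (proj t x) \<le> 0"
    "proj t x = 0 \<Longrightarrow> 0 \<le> ip (x - t *\<^sub>R T x) x" "proj t x = 0 \<Longrightarrow> ip (x - t *\<^sub>R T x) x \<le> 0 \<Longrightarrow> x = 0"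
    "bounded_linear X \<Longrightarrow> commuting X (\<lambda>x. x - t *\<^sub>R T x) \<Longrightarrow> commuting X (proj t)"
proof -
  have "sym (\<lambda>x. x - t *\<^sub>R T x)" by (intro sym_diff sym_scaleR T_sym sym_id)
  from sign_projection[OF this] have "\<exists>Q. neg_projection (\<lambda>x. x - t *\<^sub>R T x) Q"
    unfolding neg_projection_def .
  from someI_ex[OF this] have n: "neg_projection (\<lambda>x. x - t *\<^sub>R T x) (proj t)"
    using t by (simp add: proj_def)
  note n = n[unfolded neg_projection_def]
  show "sym (proj t)" using n by (elim conjE)
  show "proj t (proj t x) = proj t x" using n by (elim conjE) (erule spec)
  show "ip (proj t x - t *\<^sub>R T (proj t x)) (proj t x) \<le> 0" using n by (elim conjE) (erule spec)
  show "proj t x = 0 \<Longrightarrow> 0 \<le> ip (x - t *\<^sub>R T x) x"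
    and "proj t x = 0 \<Longrightarrow> ip (x - t *\<^sub>R T x) x \<le> 0 \<Longrightarrow> x = 0"
    and "bounded_linear X \<Longrightarrow> commuting X (\<lambda>x. x - t *\<^sub>R T x) \<Longrightarrow> commuting X (proj t)"
    using n by blast+
qed

lemma proj_sym: "sym (proj t)"
proof (cases "t > 0")
  case False
  hence "proj t = (\<lambda>x. 0)" by (simp add: proj_def)
  thus ?thesis by simp
qed (rule proj_props)

lemma proj_idem [simp]: "proj t (proj t x) = proj t x"
  using proj_props(2)[of t x] by (cases "t > 0") auto

lemma proj_commuting: "bounded_linear X \<Longrightarrow> commuting X T \<Longrightarrow> commuting X (proj t)"
proof (cases "t > 0")
  case True
  assume "bounded_linear X" "commuting X T"
  thus ?thesis by (intro proj_props True commuting_diff commuting_scaleR) auto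
qed (simp add: commuting_def linear_simps)

lemma proj_T: "proj t (T x) = T (proj t x)"
  using proj_commuting[OF sym_linear[OF T_sym] commuting_refl, of t] by (simp add: commuting_def)

lemma proj_commute: "proj s (proj t x) = proj t (proj s x)"
  using proj_commuting[OF sym_linear[OF proj_sym[of s]], of t] proj_T by (simp add: commuting_def)

lemma proj_le: "proj t x = x \<Longrightarrow> ip x x \<le> t * ip (T x) x"
  using proj_props(3)[of t x] by (cases "t > 0") (auto simp: ip_simps)

lemma proj_ge: "proj t x = 0 \<Longrightarrow> t \<ge> 0 \<Longrightarrow> t * ip (T x) x \<le> ip x x"
  using proj_props(4)[of t x] by (cases "t > 0") (auto simp: ip_simps)

lemma proj_strict: "proj t x = 0 \<Longrightarrow> ip x x \<le> t * ip (T x) x \<Longrightarrow> x = 0"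
proof (cases "t > 0")
  case False
  assume "ip x x \<le> t * ip (T x) x"
  also have "\<dots> \<le> 0" using False T_pos by (simp add: pos_def mult_nonpos_nonneg)
  finally show ?thesis by (metis ip_pos linorder_not_le)
qed (use proj_props(5)[of t x] in \<open>auto simp: ip_simps\<close>)

text \<open>A vector in the range of \<open>proj s\<close> and the kernel of \<open>proj t\<close>
  would satisfy \<open>t * ip (T y) y \<le> ip y y \<le> s * ip (T y) y\<close>, which for
  \<open>s < t\<close> forces it to be zero.\<close>

lemma proj_mono: "s \<le> t \<Longrightarrow> proj t (proj s x) = proj s x"
proof (cases "s = t")
  case False
  assume "s \<le> t"
  hence st: "s < t" using False by simp
  show ?thesis
  proof (cases "s > 0")
    case True
    let ?y = "proj s x - proj t (proj s x)"
    have "proj s ?y = ?y" by (simp add: sym_arith[OF proj_sym] proj_commute[of s t])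
    hence 1: "ip ?y ?y \<le> s * ip (T ?y) ?y" by (rule proj_le)
    have "proj t ?y = 0" by (simp add: sym_arith[OF proj_sym])
    hence 2: "t * ip (T ?y) ?y \<le> ip ?y ?y" by (rule proj_ge) (use st True in simp)
    have "?y = 0"
    proof (rule ccontr)
      assume "?y \<noteq> 0"
      from mult_strict_right_mono[OF st T_strict[OF this]] 1 2 show False by simp
    qed
    thus ?thesis by simp
  qed (simp add: sym_arith[OF proj_sym])
qed simp

lemma proj_mono': "s \<le> t \<Longrightarrow> proj s (proj t x) = proj s x"
  by (simp add: proj_commute[of s t] proj_mono)

lemma ip_proj: "ip (proj t x) (proj t x) = ip (proj t x) x"
  using sym_ip[OF proj_sym, of t "proj t x" x] by simp

lemma ip_proj_diff: "s \<le> t \<Longrightarrow> ip (proj t x - proj s x) (proj t x - proj s x) = ip (proj t x) x - ip (proj s x) x"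
proof -
  assume st: "s \<le> t"
  have "ip (proj t x) (proj s x) = ip (proj s x) x" "ip (proj s x) (proj t x) = ip (proj s x) x"
    using sym_ip[OF proj_sym, of s "proj t x" x] sym_ip[OF proj_sym, of s x "proj t x"] proj_mono'[OF st, of x]
    by (simp_all add: ip_commute)
  thus ?thesis by (simp add: ip_simps ip_proj)
qed

lemma ip_proj_mono: "s \<le> t \<Longrightarrow> ip (proj s x) x \<le> ip (proj t x) x"
  using ip_proj_diff[of s t x] by (metis diff_ge_0_iff_ge ip_nonneg)

lemma ip_proj_le: "ip (proj t x) x \<le> ip x x"
proof -
  have "0 \<le> ip (x - proj t x) (x - proj t x)" by simp
  thus ?thesis by (simp add: ip_simps ip_proj ip_commute[of x "proj t x"])
qed

lemma ip_proj_nonneg: "0 \<le> ip (proj t x) x"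
  by (simp flip: ip_proj)

lemma proj_convergent:
  assumes "monoseq s"
  shows "convergent (\<lambda>n. proj (s n) x)"
proof (rule Cauchy_ipI)
  fix e :: real assume e: "e > 0"
  have "monoseq (\<lambda>n. ip (proj (s n) x) x)"
    using assms by (auto simp: monoseq_def intro: ip_proj_mono)
  moreover have "Bseq (\<lambda>n. ip (proj (s n) x) x)"
    by (rule BseqI'[of _ "ip x x"]) (simp add: ip_proj_le ip_proj_nonneg)
  ultimately have "Cauchy (\<lambda>n. ip (proj (s n) x) x)"
    by (intro convergent_Cauchy Bseq_monoseq_convergent)
  from metric_CauchyD[OF this e] obtain N where
    N: "\<And>m n. m \<ge> N \<Longrightarrow> n \<ge> N \<Longrightarrow> \<bar>ip (proj (s m) x) x - ip (proj (s n) x) x\<bar> < e"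
    by (auto simp: dist_real_def)
  have "ip (proj (s n) x - proj (s m) x) (proj (s n) x - proj (s m) x) \<le> \<bar>ip (proj (s n) x) x - ip (proj (s m) x) x\<bar>" for m n
  proof (cases "s m \<le> s n")
    case False
    have "ip (proj (s n) x - proj (s m) x) (proj (s n) x - proj (s m) x) = ip (proj (s m) x - proj (s n) x) (proj (s m) x - proj (s n) x)"
      by (simp add: ip_simps)
    thus ?thesis using False by (simp add: ip_proj_diff)
  qed (simp add: ip_proj_diff)
  thus "\<exists>N. \<forall>m\<ge>N. \<forall>n\<ge>m. ip (proj (s n) x - proj (s m) x) (proj (s n) x - proj (s m) x) < e"
    using N by (meson le_less_trans le_trans)
qed

text \<open>Along a sequence decreasing to \<open>t\<close> the projections converge to some
  \<open>y\<close>. The difference \<open>y - proj t x\<close> lies in the kernel of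
  \<open>proj t\<close> and in the range of \<open>proj r\<close> for every \<open>r > t\<close>, so
  \<open>proj_strict\<close> kills it. Monotonicity of \<open>ip (proj r x) x\<close> passes from
  the sequence to the full one-sided limit.\<close>

lemma proj_right: "((\<lambda>s. proj s x) \<longlongrightarrow> proj t x) (at_right t)"
proof (cases "t < 0")
  case True
  have "\<forall>\<^sub>F s in at_right t. proj s x = 0"
    using eventually_at_right_real[OF True] by eventually_elim simp
  thus ?thesis using True by (simp add: tendsto_eventually)
next
  case False
  define s where "s n = t + 1 / real (Suc n)" for n
  have s_lim: "s \<longlonglongrightarrow> t"
    using tendsto_add[OF tendsto_const[of t] LIMSEQ_inverse_real_of_nat] by (simp add: s_def[abs_def] inverse_eq_divide)
  have dec: "s n \<le> s m" if "m \<le> n" for m n using that by (simp add: s_def frac_le)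
  have gt: "s n > t" for n by (simp add: s_def)
  have "monoseq s" using dec by (auto simp: monoseq_def)
  from proj_convergent[OF this, of x] obtain y where y: "(\<lambda>n. proj (s n) x) \<longlonglongrightarrow> y" by (auto simp: convergent_def)
  have up: "proj r y = y" if "r > t" for r
  proof (rule LIMSEQ_unique)
    show "(\<lambda>n. proj r (proj (s n) x)) \<longlonglongrightarrow> proj r y" by (rule bounded_linear.tendsto[OF sym_linear[OF proj_sym] y])
    have "\<forall>\<^sub>F n in sequentially. s n < r" using order_tendstoD(2)[OF s_lim that] .
    hence "\<forall>\<^sub>F n in sequentially. proj (s n) x = proj r (proj (s n) x)"
      by eventually_elim (simp add: proj_mono)
    with y show "(\<lambda>n. proj r (proj (s n) x)) \<longlonglongrightarrow> y" by (rule Lim_transform_eventually)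
  qed
  have down: "proj t y = proj t x"
  proof (rule LIMSEQ_unique)
    show "(\<lambda>n. proj t (proj (s n) x)) \<longlonglongrightarrow> proj t y" by (rule bounded_linear.tendsto[OF sym_linear[OF proj_sym] y])
    show "(\<lambda>n. proj t (proj (s n) x)) \<longlonglongrightarrow> proj t x" using gt by (simp add: proj_mono' less_imp_le)
  qed
  let ?d = "y - proj t x"
  have "proj t ?d = 0" by (simp add: sym_arith[OF proj_sym] down)
  moreover have "ip ?d ?d \<le> t * ip (T ?d) ?d"
  proof (rule LIMSEQ_le_const[OF tendsto_mult_right[OF s_lim]], intro exI allI impI)
    fix n
    have "proj (s n) ?d = ?d" using up[OF gt[of n]] proj_mono[of t "s n" x] gt[of n] by (simp add: sym_arith[OF proj_sym])
    thus "ip ?d ?d \<le> s n * ip (T ?d) ?d" by (rule proj_le)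
  qed
  ultimately have "?d = 0" by (rule proj_strict)
  hence y': "(\<lambda>n. proj (s n) x) \<longlonglongrightarrow> proj t x" using y by simp
  have F: "(\<lambda>n. ip (proj (s n) x) x) \<longlonglongrightarrow> ip (proj t x) x" by (intro tendsto_ip y' tendsto_const)
  have "((\<lambda>r. ip (proj r x - proj t x) (proj r x - proj t x)) \<longlongrightarrow> 0) (at_right t)"
  proof (rule order_tendstoI)
    fix a :: real assume "a < 0"
    thus "\<forall>\<^sub>F r in at_right t. a < ip (proj r x - proj t x) (proj r x - proj t x)"
      by (intro always_eventually allI less_le_trans[OF _ ip_nonneg])
  next
    fix a :: real assume "0 < a"
    hence "\<forall>\<^sub>F n in sequentially. ip (proj (s n) x) x < ip (proj t x) x + a"
      by (intro order_tendstoD(2)[OF F]) simp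
    then obtain n where n: "ip (proj (s n) x) x < ip (proj t x) x + a" by (auto simp: eventually_sequentially)
    show "\<forall>\<^sub>F r in at_right t. ip (proj r x - proj t x) (proj r x - proj t x) < a"
      using eventually_at_right_real[OF gt[of n]]
    proof eventually_elim
      case (elim r)
      hence "ip (proj r x) x \<le> ip (proj (s n) x) x" by (intro ip_proj_mono) auto
      with n elim show ?case by (simp add: ip_proj_diff)
    qed
  qed
  hence "((\<lambda>r. proj r x - proj t x) \<longlongrightarrow> 0) (at_right t)" by (simp add: tendsto_zero_iff_ip)
  thus ?thesis by (rule LIM_zero_cancel)
qed

text \<open>A vector \<open>d\<close> annihilated by every \<open>proj (real m)\<close> satisfies
  \<open>m * ip (T d) d \<le> ip d d\<close> for all \<open>m\<close>, which strict positivity of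
  \<open>T\<close> allows for zero only.\<close>

lemma proj_top: "((\<lambda>s. proj s x) \<longlongrightarrow> x) at_top"
proof -
  have "monoseq real" by (simp add: monoseq_def)
  from proj_convergent[OF this, of x] obtain y where y: "(\<lambda>n. proj (real n) x) \<longlonglongrightarrow> y" by (auto simp: convergent_def)
  have same: "proj (real m) y = proj (real m) x" for m
  proof (rule LIMSEQ_unique)
    show "(\<lambda>n. proj (real m) (proj (real n) x)) \<longlonglongrightarrow> proj (real m) y"
      by (rule bounded_linear.tendsto[OF sym_linear[OF proj_sym] y])
    have "\<forall>\<^sub>F n in sequentially. proj (real m) x = proj (real m) (proj (real n) x)"
      using eventually_ge_at_top[of m] by eventually_elim (simp add: proj_mono')
    with tendsto_const show "(\<lambda>n. proj (real m) (proj (real n) x)) \<longlonglongrightarrow> proj (real m) x"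
      by (rule Lim_transform_eventually)
  qed
  let ?d = "x - y"
  have le: "real m * ip (T ?d) ?d \<le> ip ?d ?d" for m
    by (rule proj_ge) (simp_all add: sym_arith[OF proj_sym] same)
  have "?d = 0"
  proof (rule ccontr)
    assume "?d \<noteq> 0"
    hence p: "ip (T ?d) ?d > 0" by (rule T_strict)
    obtain m where "ip ?d ?d / ip (T ?d) ?d < real m" using reals_Archimedean2 by blast
    with le[of m] p show False by (simp add: field_simps)
  qed
  hence y': "(\<lambda>n. proj (real n) x) \<longlonglongrightarrow> x" using y by simp
  have F: "(\<lambda>n. ip (proj (real n) x) x) \<longlonglongrightarrow> ip x x" by (intro tendsto_ip y' tendsto_const)
  have d: "ip (x - proj r x) (x - proj r x) = ip x x - ip (proj r x) x" for r
    by (simp add: ip_simps ip_proj ip_commute[of x "proj r x"])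
  have "((\<lambda>r. ip (x - proj r x) (x - proj r x)) \<longlongrightarrow> 0) at_top"
  proof (rule order_tendstoI)
    fix a :: real assume "a < 0"
    thus "\<forall>\<^sub>F r in at_top. a < ip (x - proj r x) (x - proj r x)"
      by (intro always_eventually allI less_le_trans[OF _ ip_nonneg])
  next
    fix a :: real assume "0 < a"
    hence "\<forall>\<^sub>F n in sequentially. ip x x - a < ip (proj (real n) x) x"
      by (intro order_tendstoD(1)[OF F]) simp
    then obtain n where n: "ip x x - a < ip (proj (real n) x) x" by (auto simp: eventually_sequentially)
    show "\<forall>\<^sub>F r in at_top. ip (x - proj r x) (x - proj r x) < a"
      using eventually_ge_at_top[of "real n"]
    proof eventually_elim
      case (elim r)
      hence "ip (proj (real n) x) x \<le> ip (proj r x) x" by (rule ip_proj_mono)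
      with n show ?case by (simp add: d)
    qed
  qed
  hence "((\<lambda>r. x - proj r x) \<longlongrightarrow> 0) at_top" by (simp add: tendsto_zero_iff_ip)
  from tendsto_diff[OF tendsto_const[of x] this] show ?thesis by simp
qed

lemma spectral_family_proj: "spectral_family g proj"
  unfolding spectral_family_def
proof (intro conjI allI impI)
  fix t
  \<comment> \<open>Multiplication by a complex scalar is bounded, real linear and commutes with
    \<open>T\<close>, so \<open>proj_commuting\<close> makes the projections complex linear.\<close>
  have sc: "proj t (a *\<^sub>C x) = a *\<^sub>C proj t x" for a x
  proof -
    have "commuting (\<lambda>x. a *\<^sub>C x) (proj t)"
    proof (rule proj_commuting)
      show "bounded_linear (\<lambda>x::'a. a *\<^sub>C x)" by (rule bounded_linear_scaleC)
      show "commuting (\<lambda>x. a *\<^sub>C x) T" by (simp add: commuting_def T_scaleC)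
    qed
    thus ?thesis by (simp add: commuting_def)
  qed
  show "clinear_on UNIV (proj t)" by (simp add: clinear_on_def sym_arith[OF proj_sym] sc)
  show "g (proj t x) y = g x (proj t y)" for x y
    using sym_ip[OF proj_sym, of t x y] sym_ip[OF proj_sym, of t x "\<i> *\<^sub>C y"]
    by (intro complex_eqI) (simp_all add: ip_def Im_g[unfolded ip_def] sc)
qed (simp_all add: proj_mono' proj_right proj_top tendsto_eventually eventually_at_bot_linorder exI[of _ 0])

sublocale proj: spectral_fam g proj
  by unfold_locales (rule spectral_family_proj)

text \<open>With \<open>x = T y\<close> the bounds read
  \<open>a |x|^2 <= <S x, x> <= b |x|^2\<close> and \<open>a^2 |x|^2 <= |S x|^2\<close>. They follow
  from \<open>proj_le\<close> and \<open>proj_ge\<close> by Cauchy-Schwarz, with only the bounded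
  operator \<open>T\<close> involved.\<close>

lemma T_piece:
  assumes ab: "0 \<le> a" "a \<le> b" and y: "proj b y = y" "proj a y = 0"
  shows "a * ip (T y) (T y) \<le> ip (T y) y" "ip (T y) y \<le> b * ip (T y) (T y)" "a\<^sup>2 * ip (T y) (T y) \<le> ip y y"
proof -
  have Ty: "proj b (T y) = T y" "proj a (T y) = 0" using y by (simp_all add: proj_T sym_arith[OF T_sym])
  have pos: "0 \<le> ip (T y) y" using T_pos by (simp add: pos_def)
  show 1: "a * ip (T y) (T y) \<le> ip (T y) y"
  proof (cases "T y = 0")
    case False
    hence p: "ip (T y) (T y) > 0" by (rule ip_pos)
    have "a * (ip (T y) (T y))\<^sup>2 \<le> a * (ip (T y) y * ip (T (T y)) (T y))"
      by (intro mult_left_mono pos_CS T_sym T_pos ab)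
    also have "\<dots> = ip (T y) y * (a * ip (T (T y)) (T y))" by simp
    also have "\<dots> \<le> ip (T y) y * ip (T y) (T y)" by (intro mult_left_mono proj_ge Ty ab pos)
    finally have "(a * ip (T y) (T y)) * ip (T y) (T y) \<le> ip (T y) y * ip (T y) (T y)"
      by (simp add: power2_eq_square mult_ac)
    thus ?thesis using p by (simp only: mult_le_cancel_right_pos)
  qed simp
  have "a\<^sup>2 * ip (T y) (T y) = a * (a * ip (T y) (T y))" by (simp add: power2_eq_square)
  also have "\<dots> \<le> a * ip (T y) y" by (intro mult_left_mono 1 ab)
  also have "\<dots> \<le> ip y y" by (intro proj_ge y ab)
  finally show "a\<^sup>2 * ip (T y) (T y) \<le> ip y y" .
  show "ip (T y) y \<le> b * ip (T y) (T y)"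
  proof (cases "y = 0")
    case False
    hence p: "ip (T y) y > 0" by (rule T_strict)
    have "(ip (T y) y)\<^sup>2 \<le> ip (T y) (T y) * ip y y" by (rule ip_CS)
    also have "\<dots> \<le> ip (T y) (T y) * (b * ip (T y) y)" by (intro mult_left_mono proj_le y) simp
    finally have "ip (T y) y * ip (T y) y \<le> (b * ip (T y) (T y)) * ip (T y) y"
      by (simp add: power2_eq_square mult_ac)
    thus ?thesis using p by (simp only: mult_le_cancel_right_pos)
  qed (simp add: sym_arith[OF T_sym])
qed

section \<open>Moments of the constructed spectral family\<close>

definition piece :: "nat \<Rightarrow> int \<Rightarrow> 'a \<Rightarrow> 'a" where
  "piece n k x = proj (node n (k + 1)) x - proj (node n k) x"

lemma dist_fun_piece:
  "proj.dist_fun x (node n (k + 1)) - proj.dist_fun x (node n k) = ip (piece n k x) (piece n k x)"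
  by (simp add: piece_def ip_proj_diff node_le proj.ip_E_self)

lemma integral_step_fun:
  "(\<integral>t. step_fun f n t \<partial>proj.nu x) = (\<Sum>k\<in>grid n. f (node n (k + 1)) * ip (piece n k x) (piece n k x))"
  unfolding proj.ip_step_op_self[symmetric] proj.step_op_def ip_sum_left dist_fun_piece[symmetric]
  by (simp add: ip_scaleR_left ip_diff_left proj.ip_E_self)

lemma piece_nonpos: "k < 0 \<Longrightarrow> piece n k x = 0"
  by (simp add: piece_def node_def divide_nonpos_pos)

lemma piece_T: "piece n k (T z) = T (piece n k z)"
  by (simp add: piece_def proj_T sym_arith[OF T_sym])

text \<open>The first bound compares the Stieltjes term of a cell with the share of that cell in the
  form of \<open>S\<close> at \<open>T z\<close>, up to the mesh width. The second bounds the second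
  moment independently of the mesh.\<close>

lemma piece_bounds:
  "\<bar>node n (k + 1) * ip (piece n k (T z)) (piece n k (T z)) - ip (piece n k (T z)) z\<bar> \<le> (1 / 2 ^ n) * ip (piece n k (T z)) (piece n k (T z))"
  "(node n (k + 1))\<^sup>2 * ip (piece n k (T z)) (piece n k (T z)) \<le> 2 * ip (piece n k z) (piece n k z) + 2 * ip (piece n k (T z)) (piece n k (T z))"
proof -
  let ?y = "piece n k z" and ?a = "node n k" and ?b = "node n (k + 1)"
  have b: "?b = ?a + 1 / 2 ^ n" by (simp add: node_def add_divide_distrib)
  have y: "proj ?b ?y = ?y" "proj ?a ?y = 0"
    using node_le[of n k] by (simp_all add: piece_def sym_arith[OF proj_sym] proj_mono proj_mono')
  have e: "ip (piece n k (T z)) z = ip (T ?y) ?y"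
  proof -
    have "ip (T ?y) ?y = ip (T ?y) (proj ?b z) - ip (T ?y) (proj ?a z)" by (simp add: piece_def ip_diff_right)
    also have "\<dots> = ip (proj ?b (T ?y)) z - ip (proj ?a (T ?y)) z" by (simp only: sym_ip[OF proj_sym])
    also have "\<dots> = ip (T ?y) z" by (simp add: proj_T y sym_arith[OF T_sym])
    finally show ?thesis by (simp add: piece_T)
  qed
  have "\<bar>?b * ip (T ?y) (T ?y) - ip (T ?y) ?y\<bar> \<le> (1 / 2 ^ n) * ip (T ?y) (T ?y) \<and>
      ?b\<^sup>2 * ip (T ?y) (T ?y) \<le> 2 * ip ?y ?y + 2 * ip (T ?y) (T ?y)"
  proof (cases "k < 0")
    case True
    thus ?thesis by (simp add: piece_nonpos sym_arith[OF T_sym])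
  next
    case False
    hence a: "0 \<le> ?a" by (simp add: node_def)
    note p = T_piece[OF a node_le y]
    \<comment> \<open>The right end point is at most \<open>?a + 1\<close>, and the square of a sum
      is at most twice the sum of the squares.\<close>
    have "?b\<^sup>2 \<le> 2 * ?a\<^sup>2 + 2"
    proof -
      have "?b\<^sup>2 \<le> (?a + 1)\<^sup>2" by (rule power_mono) (use a in \<open>simp_all add: b\<close>)
      also have "\<dots> \<le> 2 * ?a\<^sup>2 + 2" using zero_le_power2[of "?a - 1"] by (simp add: power2_eq_square algebra_simps)
      finally show ?thesis .
    qed
    hence "?b\<^sup>2 * ip (T ?y) (T ?y) \<le> (2 * ?a\<^sup>2 + 2) * ip (T ?y) (T ?y)" by (rule mult_right_mono) simp
    moreover have "(2 * ?a\<^sup>2 + 2) * ip (T ?y) (T ?y) = 2 * (?a\<^sup>2 * ip (T ?y) (T ?y)) + 2 * ip (T ?y) (T ?y)"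
      by (simp add: algebra_simps)
    moreover have "?b * ip (T ?y) (T ?y) = ?a * ip (T ?y) (T ?y) + (1 / 2 ^ n) * ip (T ?y) (T ?y)"
      unfolding b by (rule distrib_right)
    moreover have "0 \<le> (1 / 2 ^ n) * ip (T ?y) (T ?y)" by simp
    ultimately show ?thesis using p by (intro conjI abs_leI) linarith+
  qed
  thus "\<bar>?b * ip (piece n k (T z)) (piece n k (T z)) - ip (piece n k (T z)) z\<bar> \<le> (1 / 2 ^ n) * ip (piece n k (T z)) (piece n k (T z))"
    "?b\<^sup>2 * ip (piece n k (T z)) (piece n k (T z)) \<le> 2 * ip ?y ?y + 2 * ip (piece n k (T z)) (piece n k (T z))"
    unfolding e by (simp_all only: piece_T)
qed

lemma sum_piece: "(\<Sum>k\<in>grid n. piece n k x) = proj (2 ^ n) x"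
proof -
  have tele: "(\<Sum>k\<in>{a..<b}. piece n k x) = proj (node n b) x - proj (node n a) x" if "a \<le> b" for a b
    using that
  proof (induction b rule: int_ge_induct)
    case (step i)
    have "{a..<i + 1} = insert i {a..<i}" using step(1) by auto
    thus ?case using step by (simp add: piece_def)
  qed simp
  have "(4::real) ^ n / 2 ^ n = 2 ^ n" by (simp flip: power_divide)
  thus ?thesis unfolding grid_def by (subst tele) (auto simp: node_def)
qed

lemma sum_ip_piece: "(\<Sum>k\<in>grid n. ip (piece n k x) (piece n k x)) \<le> ip x x"
proof -
  have "(\<Sum>k\<in>grid n. ip (piece n k x) (piece n k x)) = (\<Sum>k\<in>grid n. ip (piece n k x) x)"
    by (simp only: piece_def ip_proj_diff node_le ip_diff_left[of _ _ x])
  also have "\<dots> = ip (proj (2 ^ n) x) x" by (simp only: ip_sum_left[symmetric] sum_piece)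
  finally show ?thesis using ip_proj_le by simp
qed

text \<open>By \<open>piece_bounds\<close> the second moments of the step functions are bounded
  uniformly in \<open>n\<close>; Fatou's lemma transfers the bound to
  \<open>t\<^sup>2\<close>.\<close>

lemma T_in_spectral_dom: "T z \<in> spectral_dom g proj (\<lambda>t. t)"
proof -
  let ?x = "T z"
  have bound: "(\<integral>\<^sup>+t. ennreal ((step_fun (\<lambda>t. t) n t)\<^sup>2) \<partial>proj.nu ?x) \<le> ennreal (2 * ip z z + 2 * ip ?x ?x)" for n
  proof -
    have sq: "(step_fun (\<lambda>t. t) n t)\<^sup>2 = step_fun (\<lambda>t. t\<^sup>2) n t" for t by (simp add: step_fun_eq)
    have eq: "(\<integral>\<^sup>+t. ennreal ((step_fun (\<lambda>t. t) n t)\<^sup>2) \<partial>proj.nu ?x) = ennreal (\<integral>t. step_fun (\<lambda>t. t\<^sup>2) n t \<partial>proj.nu ?x)"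
      unfolding sq by (rule nn_integral_eq_integral[OF proj.integrable_step1]) (simp add: step_fun_eq)
    have "(\<integral>t. step_fun (\<lambda>t. t\<^sup>2) n t \<partial>proj.nu ?x) \<le>
        (\<Sum>k\<in>grid n. 2 * ip (piece n k z) (piece n k z) + 2 * ip (piece n k ?x) (piece n k ?x))"
      unfolding integral_step_fun by (intro sum_mono piece_bounds)
    also have "\<dots> \<le> 2 * ip z z + 2 * ip ?x ?x"
      using sum_ip_piece[of n z] sum_ip_piece[of n ?x] by (simp add: sum.distrib sum_distrib_left[symmetric])
    finally show ?thesis unfolding eq by (rule ennreal_leI)
  qed
  have "(\<integral>\<^sup>+t. ennreal (t\<^sup>2) \<partial>proj.nu ?x) = (\<integral>\<^sup>+t. liminf (\<lambda>n. ennreal ((step_fun (\<lambda>t. t) n t)\<^sup>2)) \<partial>proj.nu ?x)"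
  proof (rule nn_integral_cong)
    fix t
    have "(\<lambda>n. ennreal ((step_fun (\<lambda>t. t) n t)\<^sup>2)) \<longlonglongrightarrow> ennreal (t\<^sup>2)"
      by (intro tendsto_ennrealI tendsto_power step_fun_tendsto[OF tame_id])
    thus "ennreal (t\<^sup>2) = liminf (\<lambda>n. ennreal ((step_fun (\<lambda>t. t) n t)\<^sup>2))"
      by (intro lim_imp_Liminf[symmetric]) simp_all
  qed
  also have "\<dots> \<le> liminf (\<lambda>n. \<integral>\<^sup>+t. ennreal ((step_fun (\<lambda>t. t) n t)\<^sup>2) \<partial>proj.nu ?x)"
    by (rule nn_integral_liminf) measurable
  also have "\<dots> \<le> ennreal (2 * ip z z + 2 * ip ?x ?x)"
    by (rule Liminf_le) (use bound in auto)
  also have "\<dots> < \<infinity>" by simp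
  finally show ?thesis by (simp add: proj.integrable_sq_iff)
qed

text \<open>The Stieltjes sums differ from \<open>ip (proj (2 ^ n) (T z)) z\<close> by at most the
  mesh width times the square norm of \<open>T z\<close>, and these projections tend to the
  identity.\<close>

lemma integral_T: "(\<integral>t. t \<partial>proj.nu (T z)) = ip (T z) z"
proof (rule LIMSEQ_unique)
  let ?x = "T z" and ?S = "\<lambda>n. \<integral>t. step_fun (\<lambda>t. t) n t \<partial>proj.nu (T z)"
  show S: "?S \<longlonglongrightarrow> (\<integral>t. t \<partial>proj.nu (T z))"
    by (rule proj.integral_step_tendsto[OF tame_id T_in_spectral_dom])
  have le: "\<bar>?S n - ip (proj (2 ^ n) ?x) z\<bar> \<le> (1/2) ^ n * ip ?x ?x" for n
  proof -
    have e: "?S n - ip (proj (2 ^ n) ?x) z =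
        (\<Sum>k\<in>grid n. node n (k + 1) * ip (piece n k ?x) (piece n k ?x) - ip (piece n k ?x) z)"
      unfolding sum_piece[symmetric] ip_sum_left integral_step_fun by (simp add: sum_subtractf)
    have "\<bar>?S n - ip (proj (2 ^ n) ?x) z\<bar> \<le> (\<Sum>k\<in>grid n. (1 / 2 ^ n) * ip (piece n k ?x) (piece n k ?x))"
      unfolding e by (rule order_trans[OF sum_abs sum_mono]) (rule piece_bounds)
    also have "\<dots> = (1/2) ^ n * (\<Sum>k\<in>grid n. ip (piece n k ?x) (piece n k ?x))"
      by (simp add: sum_distrib_left power_one_over)
    also have "\<dots> \<le> (1/2) ^ n * ip ?x ?x"
      by (intro mult_left_mono sum_ip_piece) simp
    finally show ?thesis .
  qed
  have "(\<lambda>n. (1/2) ^ n * ip ?x ?x) \<longlonglongrightarrow> 0"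
    by (intro tendsto_mult_left_zero LIMSEQ_power_zero) simp
  hence 1: "(\<lambda>n. ?S n - ip (proj (2 ^ n) ?x) z) \<longlonglongrightarrow> 0"
    by (rule Lim_null_comparison[OF always_eventually, rotated]) (use le in auto)
  have "filterlim (\<lambda>n. (2::real) ^ n) at_top sequentially"
    by (intro filterlim_at_infinity_imp_filterlim_at_top filterlim_realpow_sequentially_gt1) auto
  hence "(\<lambda>n. ip (proj (2 ^ n) ?x) z) \<longlonglongrightarrow> ip ?x z"
    by (intro tendsto_ip tendsto_const filterlim_compose[OF proj_top])
  from tendsto_add[OF 1 this] show "?S \<longlonglongrightarrow> ip ?x z" by simp
qed

theorem spectral_theorem: "is_spectral_integral g proj (\<lambda>t. t) D S"
proof -
  let ?D = "spectral_dom g proj (\<lambda>t. t)" and ?S = "proj.spectral_int (\<lambda>t. t)"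
  have sub: "D \<subseteq> ?D"
  proof
    fix x assume "x \<in> D"
    with T_in_spectral_dom[of "S x"] show "x \<in> ?D" by simp
  qed
  have form: "g (S x) x = complex_of_real (\<integral>t. t \<partial>proj.nu x)" if x: "x \<in> D" for x
  proof -
    have "Re (g (S x) x) = (\<integral>t. t \<partial>proj.nu x)"
      using integral_T[of "S x"] x by (simp add: ip_commute flip: ip_def)
    moreover have "Im (g (S x) x) = 0"
      using S_sym[OF x x] g_commute[of "S x" x] by (metis cnj.simps(2) equal_neg_zero)
    ultimately show ?thesis by (simp add: complex_eq_iff)
  qed
  note lin = proj.clinear_on_spectral_int[OF tame_id]
  have eq: "S x = ?S x" if x: "x \<in> D" for x
  proof -
    have "S x - ?S x = 0"
    proof (rule g_conv_zero_on_dense[OF D_dense])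
      fix y assume y: "y \<in> D"
      show "g (S x - ?S x) y = 0"
      proof (rule polarization[OF D_subspace _ _ x y])
        show "clinear_on D (\<lambda>x. S x - ?S x)"
          using S_clinear lin sub unfolding clinear_on_def
          by (auto simp: complex_vector.scale_right_diff_distrib subset_eq)
        show "g (S x - ?S x) x = 0" if "x \<in> D" for x
          using form[OF that] proj.spectral_int_form[OF tame_id, of x] that sub by (auto simp: g_diff_left)
      qed
    qed
    thus ?thesis by simp
  qed
  \<comment> \<open>The spectral integral is a symmetric extension of \<open>S\<close>. Testing it
    against \<open>D\<close> gives the adjoint relation, and the graph condition in
    \<open>selfadjoint_op\<close> puts its domain inside \<open>D\<close>.\<close>
  have "?D \<subseteq> D"
  proof
    fix x assume x: "x \<in> ?D"
    have "\<forall>z\<in>D. g (?S x) z = g x (S z)"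
      using proj.spectral_integral_sym[OF proj.is_spectral_integral_spectral_int[OF tame_id] x] sub eq by auto
    thus "x \<in> D" using S_adjoint by blast
  qed
  with sub have "D = ?D" by blast
  thus ?thesis using form S_clinear by (simp add: is_spectral_integral_def)
qed

end

section \<open>Eigenvalues and spectral gaps\<close>

context spectral_fam begin

lemma AE_nu_ge:
  assumes "\<And>s. s < t \<Longrightarrow> E s x = 0"
  shows "AE r in nu x. t \<le> r"
proof -
  have "AE r in nu x. \<forall>n. t - 1 / real (Suc n) < r"
    unfolding AE_all_countable by (intro allI AE_nu_greater assms) simp
  thus ?thesis
  proof eventually_elim
    case (elim r)
    have "(\<lambda>n. t - 1 / real (Suc n)) \<longlonglongrightarrow> t - 0"
      by (intro tendsto_diff tendsto_const LIMSEQ_inverse_real_of_nat[unfolded inverse_eq_divide])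
    thus ?case using elim by (intro LIMSEQ_le_const2[of _ t]) (auto intro: less_imp_le)
  qed
qed

text \<open>Cutting with \<open>E s\<close> restricts the measure. On half-open intervals this is
  \<open>E s (E t x) = E (min s t) x\<close>; Borel sets follow from the four-measure identity with
  \<open>c = 1\<close> and the measure of the zero vector in two places.\<close>

lemma nn_integral_nu_E:
  assumes [measurable]: "f \<in> borel_measurable borel"
  shows "(\<integral>\<^sup>+t. f t \<partial>nu (E s x)) = (\<integral>\<^sup>+t. f t * indicator {..s} t \<partial>nu x)"
    and "(\<integral>\<^sup>+t. f t \<partial>nu (x - E s x)) = (\<integral>\<^sup>+t. f t * indicator {s<..} t \<partial>nu x)"
proof -
  have eq: "nu y = density (nu x) (indicator H)"
    if H [measurable]: "H \<in> sets borel"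
      and Ioc: "\<And>a b. a \<le> b \<Longrightarrow> dist_fun y b - dist_fun y a = measure (nu x) ({a<..b} \<inter> H)"
      and UNIV: "ip y y = measure (nu x) H" for y H
  proof (rule measure_eqI)
    fix A assume "A \<in> sets (nu y)"
    hence A [measurable]: "A \<in> sets borel" by simp
    interpret x: finite_measure "nu x" by (rule finite_nu)
    have em: "emeasure (density (nu x) (indicator H)) B = emeasure (nu x) (B \<inter> H)" if [measurable]: "B \<in> sets borel" for B
      by (subst emeasure_density) (simp_all add: indicator_inter_arith[symmetric] Int_commute)
    have m: "measure (density (nu x) (indicator H)) B = measure (nu x) (B \<inter> H)" if "B \<in> sets borel" for B
      using em[OF that] by (simp add: measure_def)
    have fin: "finite_measure (density (nu x) (indicator H))"
      by (rule finite_measureI) (simp add: em)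
    have m0: "measure (nu 0) B = 0" for B
by (simp add: measure_def emeasure_nu_zero)
    have "measure (nu y) A + measure (nu 0) A = 1 * measure (density (nu x) (indicator H)) A + 1 * measure (nu 0) A"
      by (rule finite_measures_eq_on_borel[OF finite_nu finite_nu fin finite_nu _ _ _ _ _ _ A])
        (simp_all add: m m0 measure_nu_UNIV measure_nu_Ioc UNIV Ioc del: Int_greaterThanAtMost)
    thus "emeasure (nu y) A = emeasure (density (nu x) (indicator H)) A"
      using finite_measure.emeasure_eq_measure[OF finite_nu] finite_measure.emeasure_eq_measure[OF fin] m0 by simp
  qed simp
  have mA: "measure (nu x) {..s} = dist_fun x s"
    by (simp add: measure_def emeasure_nu_atMost dist_fun_nonneg)
  have "nu (E s x) = density (nu x) (indicator {..s})"
  proof (rule eq)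
    fix a b :: real assume ab: "a \<le> b"
    have "{a<..b} \<inter> {..s} = {a<..min b s}" by auto
    moreover have "measure (nu x) {a<..min b s} = dist_fun x (min b s) - dist_fun x (min a s)"
      using ab by (cases "a \<le> min b s") (auto simp: measure_nu_Ioc min_def split: if_splits)
    ultimately show "dist_fun (E s x) b - dist_fun (E s x) a = measure (nu x) ({a<..b} \<inter> {..s})"
      by (simp add: dist_fun_def E_E)
  qed (simp_all add: mA dist_fun_def)
  thus "(\<integral>\<^sup>+t. f t \<partial>nu (E s x)) = (\<integral>\<^sup>+t. f t * indicator {..s} t \<partial>nu x)"
    by (simp add: nn_integral_density mult.commute)
  have "nu (x - E s x) = density (nu x) (indicator {s<..})"
  proof (rule eq)
    have d: "dist_fun (x - E s x) c = dist_fun x c - dist_fun x (min c s)" for c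
    proof -
      have "dist_fun (x - E s x) c = ip (E c x - E (min c s) x) (E c x - E (min c s) x)"
        by (simp add: dist_fun_def E_diff E_E)
      thus ?thesis by (simp add: ip_simps ip_E_E)
    qed
    fix a b :: real assume ab: "a \<le> b"
    have "{a<..b} \<inter> {s<..} = {max a s<..b}" by auto
    moreover have "measure (nu x) {max a s<..b} = dist_fun x b - dist_fun x (min b s) - (dist_fun x a - dist_fun x (min a s))"
      using ab by (cases "max a s \<le> b") (auto simp: measure_nu_Ioc min_def max_def split: if_splits)
    ultimately show "dist_fun (x - E s x) b - dist_fun (x - E s x) a = measure (nu x) ({a<..b} \<inter> {s<..})"
      by (simp add: d)
  next
    interpret x: finite_measure "nu x" by (rule finite_nu)
    have "{s<..} = space (nu x) - {..s}" by auto
    hence "measure (nu x) {s<..} = measure (nu x) UNIV - measure (nu x) {..s}"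
      using x.finite_measure_compl[of "{..s}"] by simp
    thus "ip (x - E s x) (x - E s x) = measure (nu x) {s<..}"
      by (simp add: mA measure_nu_UNIV ip_simps ip_E_self ip_commute[of x "E s x"] ip_E_E)
  qed simp
  thus "(\<integral>\<^sup>+t. f t \<partial>nu (x - E s x)) = (\<integral>\<^sup>+t. f t * indicator {s<..} t \<partial>nu x)"
    by (simp add: nn_integral_density mult.commute)
qed

end

context posdef_selfadjoint begin

abbreviation E where "E \<equiv> spectral_family_of g D S"

text \<open>\<open>proj\<close> only witnesses existence. From here on \<open>E\<close> is the
  chosen family, and facts such as its vanishing below a positive bound are derived from these two
  properties.\<close>

lemma spectral_family_of_props: "spectral_family g E \<and> is_spectral_integral g E (\<lambda>t. t) D S"
  unfolding spectral_family_of_def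
  by (rule someI[of _ proj]) (simp add: spectral_family_proj spectral_theorem)

sublocale spectral_fam g E
  by unfold_locales (simp add: spectral_family_of_props)

lemmas S_integral = conjunct2[OF spectral_family_of_props]

lemma in_D_iff: "x \<in> D \<longleftrightarrow> x \<in> spectral_dom g E (\<lambda>t. t)"
  using S_integral unfolding is_spectral_integral_def by (elim conjE) (rule arg_cong)

lemma S_moments:
  assumes "x \<in> D"
  shows "integrable (nu x) (\<lambda>t. t)" "integrable (nu x) (\<lambda>t. t\<^sup>2)"
    "ip (S x) (S x) = (\<integral>t. t\<^sup>2 \<partial>nu x)" "ip (S x) x = (\<integral>t. t \<partial>nu x)"
proof -
  show "integrable (nu x) (\<lambda>t. t)" "integrable (nu x) (\<lambda>t. t\<^sup>2)"
    using integrable_f(1,2)[OF tame_id in_D_iff[THEN iffD1, OF assms]] by auto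
  show "ip (S x) (S x) = (\<integral>t. t\<^sup>2 \<partial>nu x)"
    by (rule spectral_integral_norm[OF tame_id S_integral assms])
  show "ip (S x) x = (\<integral>t. t \<partial>nu x)"
    using S_integral assms by (simp add: is_spectral_integral_def ip_def)
qed

lemma integral_const_nu: "(\<integral>t. c \<partial>nu x) = c * ip x x"
  by (simp add: measure_nu_UNIV)

text \<open>The square expands into the first two moments. It makes eigenvectors, and approximate
  eigenvectors, visible as concentration of the measure near \<open>m\<close>.\<close>

lemma S_shift_norm:
  assumes x: "x \<in> D"
  shows "integrable (nu x) (\<lambda>t. (t - m)\<^sup>2)"
    "ip (S x - complex_of_real m *\<^sub>C x) (S x - complex_of_real m *\<^sub>C x) = (\<integral>t. (t - m)\<^sup>2 \<partial>nu x)"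
proof -
  interpret finite_measure "nu x" by (rule finite_nu)
  note i = S_moments[OF x]
  have e: "(\<lambda>t. (t - m)\<^sup>2) = (\<lambda>t. t\<^sup>2 - 2 * m * t + m\<^sup>2)" by (simp add: fun_eq_iff power2_diff)
  show "integrable (nu x) (\<lambda>t. (t - m)\<^sup>2)" unfolding e using i by simp
  have "(\<integral>t. (t - m)\<^sup>2 \<partial>nu x) = ip (S x) (S x) - 2 * m * ip (S x) x + m\<^sup>2 * ip x x"
    unfolding e using i by (simp add: measure_nu_UNIV)
  also have "\<dots> = ip (S x - m *\<^sub>R x) (S x - m *\<^sub>R x)"
    by (simp add: ip_simps ip_commute[of x "S x"] power2_eq_square algebra_simps)
  finally show "ip (S x - complex_of_real m *\<^sub>C x) (S x - complex_of_real m *\<^sub>C x) = (\<integral>t. (t - m)\<^sup>2 \<partial>nu x)"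
    by (simp add: scaleR_scaleC)
qed

lemma in_D: "E b y = y \<Longrightarrow> E a y = 0 \<Longrightarrow> y \<in> D"
  by (rule in_D_iff[THEN iffD2], rule spectral_dom_bounded_support) (simp_all add: continuous_on_id)

text \<open>The increment \<open>E s x - E r x\<close> has its measure on \<open>{r<..s}\<close>, so
  its form is at most \<open>s\<close> times, and at least the lower bound times, its square norm;
  it vanishes. Thus \<open>E\<close> is constant below the lower bound, and its limit at
  \<open>at_bot\<close> is zero.\<close>

lemma E_below: "\<exists>\<alpha>>0. \<forall>s<\<alpha>. \<forall>x. E s x = 0"
proof -
  obtain \<alpha> where \<alpha>: "\<alpha> > 0" "\<And>x. x \<in> D \<Longrightarrow> \<alpha> * ip x x \<le> ip (S x) x" using lower_bound by blast
  have "E s x = 0" if s: "s < \<alpha>" for s x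
  proof -
    have eq: "E s x = E r x" if r: "r \<le> s" for r
    proof -
      let ?y = "E s x - E r x"
      have y: "E s ?y = ?y" "E r ?y = 0" using r by (simp_all add: E_diff E_E min_def)
      hence yD: "?y \<in> D" by (rule in_D)
      interpret finite_measure "nu ?y" by (rule finite_nu)
      have "\<alpha> * ip ?y ?y \<le> (\<integral>t. t \<partial>nu ?y)" using \<alpha>(2)[OF yD] S_moments(4)[OF yD] by simp
      also have "\<dots> \<le> (\<integral>t. s \<partial>nu ?y)"
        by (rule integral_mono_AE) (use S_moments(1)[OF yD] AE_nu_le[OF y(1)] in auto)
      also have "\<dots> = s * ip ?y ?y" by (rule integral_const_nu)
      finally have "(\<alpha> - s) * ip ?y ?y \<le> 0" by (simp add: algebra_simps)
      hence "ip ?y ?y \<le> 0" using s by (simp add: mult_le_0_iff)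
      hence "?y = 0" by (metis ip_pos linorder_not_le)
      thus ?thesis by simp
    qed
    have h: "((\<lambda>r. E r x) \<longlongrightarrow> E s x) at_bot"
      by (rule tendsto_eventually) (unfold eventually_at_bot_linorder, use eq in \<open>auto intro!: exI[of _ s]\<close>)
    show ?thesis using tendsto_unique[OF _ h E_bot[of x]] by simp
  qed
  with \<alpha>(1) show ?thesis by blast
qed

definition \<alpha> where "\<alpha> = (SOME \<alpha>. \<alpha> > 0 \<and> (\<forall>s<\<alpha>. \<forall>x. E s x = 0))"

lemma \<alpha>_pos: "\<alpha> > 0" and E_below_\<alpha>: "s < \<alpha> \<Longrightarrow> E s x = 0"
  using someI_ex[OF E_below] unfolding \<alpha>_def by blast+

lemma AE_nu_\<alpha>: "AE t in nu x. \<alpha> \<le> t"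
  by (rule AE_nu_ge) (rule E_below_\<alpha>)

lemma eigen_of_concentrated:
  assumes low: "\<And>s. s < t \<Longrightarrow> E s y = 0" and up: "E t y = y"
  shows "y \<in> eigenspace D S (complex_of_real t)"
proof -
  have y: "y \<in> D" by (rule in_D[OF up low[of "t - 1"]]) simp
  have "AE r in nu y. (r - t)\<^sup>2 = 0"
  proof -
    have "AE r in nu y. t \<le> r" by (rule AE_nu_ge) (rule low)
    with AE_nu_le[OF up] show ?thesis by eventually_elim auto
  qed
  hence "(\<integral>r. (r - t)\<^sup>2 \<partial>nu y) = 0"
    by (subst integral_cong_AE[of _ _ "\<lambda>_. 0"]) auto
  hence "S y - complex_of_real t *\<^sub>C y = 0" using S_shift_norm(2)[OF y, of t] by simp
  thus ?thesis using y by (simp add: eigenspace_def)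
qed

lemma AE_nu_eigen:
  assumes "q \<in> eigenspace D S (complex_of_real m)"
  shows "AE t in nu q. t = m"
proof -
  from assms have q: "q \<in> D" and e: "S q - complex_of_real m *\<^sub>C q = 0" by (auto simp: eigenspace_def)
  have "(\<integral>t. (t - m)\<^sup>2 \<partial>nu q) = 0" using S_shift_norm(2)[OF q, of m] by (simp add: e)
  hence "AE t in nu q. (t - m)\<^sup>2 = 0"
    using integral_nonneg_eq_0_iff_AE[OF S_shift_norm(1)[OF q, of m]] by simp
  thus ?thesis by simp
qed

lemma E_eigen:
  assumes q: "q \<in> eigenspace D S (complex_of_real m)"
  shows "E t q = (if m \<le> t then q else 0)"
proof (cases "m \<le> t")
  case True
  have "emeasure (nu q) {..t} = emeasure (nu q) UNIV"
    by (rule emeasure_eq_AE) (use AE_nu_eigen[OF q] True in auto)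
  hence "dist_fun q t = ip q q" by (simp add: emeasure_nu_atMost emeasure_nu_UNIV dist_fun_nonneg)
  hence "ip (q - E t q) (q - E t q) = 0" by (simp add: ip_simps ip_commute[of q "E t q"] ip_E_self ip_E_E)
  thus ?thesis using True by simp
next
  case False
  have "emeasure (nu q) {..t} = emeasure (nu q) {}"
    by (rule emeasure_eq_AE) (use AE_nu_eigen[OF q] False in auto)
  hence "dist_fun q t = 0" by (simp add: emeasure_nu_atMost dist_fun_nonneg)
  thus ?thesis using False by (simp add: dist_fun_def)
qed

text \<open>
  The first jump of \<open>t \<mapsto> E t x\<close> would be an eigenvector that is not orthogonal to \<open>x\<close>.
\<close>

lemma no_lower_part:
  fixes bnd :: ereal
  assumes gap: "\<And>t. ereal t < bnd \<Longrightarrow> E t x = 0 \<Longrightarrow> \<exists>s>t. E s x = 0"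
    and orth: "\<And>t e. ereal t < bnd \<Longrightarrow> e \<in> eigenspace D S (complex_of_real t) \<Longrightarrow> g e x = 0"
    and t: "ereal t < bnd"
  shows "E t x = 0"
proof (rule ccontr)
  assume ne: "E t x \<noteq> 0"
  let ?A = "{s. E s x = 0}"
  have down: "E r x = 0" if "E s x = 0" "r \<le> s" for r s using E_mono[OF that(2), of x] that(1) by simp
  have le: "s \<le> t" if "s \<in> ?A" for s using that ne down[of s t] by (cases "s \<le> t") auto
  have bdd: "bdd_above ?A" using le by (auto intro!: bdd_aboveI[of _ t])
  have A0: "0 \<in> ?A" using E_below_\<alpha>[OF \<alpha>_pos] by simp
  define s where "s = Sup ?A"
  have below: "E r x = 0" if "r < s" for r
    using less_cSupD[of ?A r] that A0 unfolding s_def by (auto intro: down[OF _ less_imp_le])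
  have st: "s \<le> t" unfolding s_def using le A0 by (intro cSup_least) auto
  hence sT: "ereal s < bnd" using t by (meson ereal_less_eq(3) le_less_trans)
  have "E s x \<in> eigenspace D S (complex_of_real s)"
    by (rule eigen_of_concentrated) (simp_all add: E_mono below)
  from orth[OF sT this] have "ip (E s x) x = 0" by (simp add: ip_def)
  hence "E s x = 0" by (simp add: ip_E_self dist_fun_def)
  \<comment> \<open>The gap assumption excludes continuous growth of \<open>E\<close> to the right
    of the supremum: without a jump at \<open>s\<close> the zero set would extend beyond it.\<close>
  from gap[OF sT this] obtain r where "r > s" "r \<in> ?A" by blast
  with cSup_upper[OF _ bdd, of r] show False by (simp add: s_def)
qed

text \<open>Spectral pieces close to \<open>t\<close> consist of approximate eigenvectors, which the
  resolvent bound forbids.\<close>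

lemma resolvent_gap:
  assumes "complex_of_real t \<in> resolvent_set D S"
  shows "\<exists>e>0. \<forall>r s x. t - e < r \<longrightarrow> r \<le> s \<longrightarrow> s < t + e \<longrightarrow> E r x = E s x"
proof -
  from assms obtain K where K: "\<And>x. x \<in> D \<Longrightarrow> norm x \<le> K * norm (S x - complex_of_real t *\<^sub>C x)"
    by (auto simp: resolvent_set_def)
  obtain c C where c: "c > 0" "C > 0" "\<And>x. c * norm x \<le> cnorm g x" "\<And>x. cnorm g x \<le> C * norm x"
    using bounds_ex by blast
  define K' where "K' = max K 1"
  have K': "K' > 0" "\<And>x. x \<in> D \<Longrightarrow> norm x \<le> K' * norm (S x - complex_of_real t *\<^sub>C x)"
    using K by (auto simp: K'_def) (smt (verit) mult_right_mono norm_ge_zero)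
  \<comment> \<open>On the range of \<open>E s - E r\<close> the operator \<open>S - t\<close> is
    bounded by \<open>e\<close> in the norm of \<open>g\<close>. The factor \<open>c / C\<close>
    converts the norms, \<open>K'\<close> is the resolvent bound, and the 2 leaves the contradiction
    \<open>norm y \<le> norm y / 2\<close> for nonzero \<open>y\<close>.\<close>
  define e where "e = c / (2 * K' * C)"
  have e: "e > 0" using c K' by (simp add: e_def)
  have "E r x = E s x" if rs: "t - e < r" "r \<le> s" "s < t + e" for r s x
  proof -
    let ?y = "E s x - E r x" and ?z = "\<lambda>y. S y - complex_of_real t *\<^sub>C y"
    have y: "E s ?y = ?y" "E r ?y = 0" using rs by (simp_all add: E_diff E_E min_def)
    hence yD: "?y \<in> D" by (rule in_D)
    interpret finite_measure "nu ?y" by (rule finite_nu)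
    have "ip (?z ?y) (?z ?y) = (\<integral>l. (l - t)\<^sup>2 \<partial>nu ?y)" by (rule S_shift_norm[OF yD])
    also have "\<dots> \<le> (\<integral>l. e\<^sup>2 \<partial>nu ?y)"
    proof (rule integral_mono_AE)
      show "AE l in nu ?y. (l - t)\<^sup>2 \<le> e\<^sup>2"
        using AE_nu_le[OF y(1)] AE_nu_greater[OF y(2)]
      proof eventually_elim
        case (elim l)
        hence "\<bar>l - t\<bar> \<le> \<bar>e\<bar>" using rs by linarith
        thus ?case by (rule abs_le_square_iff[THEN iffD1])
      qed
    qed (use S_shift_norm(1)[OF yD] in auto)
    also have "\<dots> = (e * cnorm g ?y)\<^sup>2" by (simp only: integral_const_nu power_mult_distrib cnorm_power2)
    finally have "(cnorm g (?z ?y))\<^sup>2 \<le> (e * cnorm g ?y)\<^sup>2" by (simp only: cnorm_power2)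
    hence "cnorm g (?z ?y) \<le> e * cnorm g ?y" by (rule power2_le_imp_le) (use e in simp)
    also have "\<dots> \<le> e * (C * norm ?y)" using e c by simp
    finally have "c * norm (?z ?y) \<le> e * (C * norm ?y)" using c(3)[of "?z ?y"] by linarith
    hence "norm (?z ?y) \<le> e * C * norm ?y / c" using c by (simp add: field_simps)
    hence "K' * norm (?z ?y) \<le> K' * (e * C * norm ?y / c)" using K'(1) by (intro mult_left_mono) auto
    also have "\<dots> = norm ?y / 2" using c K'(1) by (simp add: e_def)
    finally have "norm ?y \<le> norm ?y / 2" using K'(2)[OF yD] by linarith
    thus ?thesis by simp
  qed
  with e show ?thesis by blast
qed

text \<open>A point below the essential spectrum is regular or isolated in the spectrum. In the
  second case \<open>E\<close> is locally constant at all points just to the right, hence constant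
  there by connectedness, and right continuity carries the value to \<open>t\<close> itself.\<close>

lemma gap_below_essential:
  assumes "ereal t < essential_bottom D S"
  shows "\<exists>s>t. \<forall>x. E s x = E t x"
proof -
  have "complex_of_real t \<notin> essential_spectrum D S"
  proof
    assume "complex_of_real t \<in> essential_spectrum D S"
    hence "essential_bottom D S \<le> ereal (Re (complex_of_real t))"
      unfolding essential_bottom_def by (rule INF_lower)
    with assms show False by simp
  qed
  then consider "complex_of_real t \<in> resolvent_set D S" | "complex_of_real t isolated_in spectrum_op D S"
    by (auto simp: essential_spectrum_def spectrum_op_def)
  thus ?thesis
  proof cases
    case 1
    from resolvent_gap[OF this] obtain e where e: "e > 0"
      "\<And>r s x. t - e < r \<Longrightarrow> r \<le> s \<Longrightarrow> s < t + e \<Longrightarrow> E r x = E s x" by blast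
    show ?thesis using e(1) by (intro exI[of _ "t + e / 2"]) (auto intro!: e(2)[symmetric])
  next
    case 2
    then obtain e where e: "e > 0" "\<And>y. y \<in> spectrum_op D S \<Longrightarrow> dist (complex_of_real t) y < e \<Longrightarrow> y = complex_of_real t"
      unfolding isolated_in_dist_Ex_iff by blast
    let ?A = "{t<..<t + e}"
    have loc: "eventually (\<lambda>b. E a = E b) (at a within ?A)" if a: "a \<in> ?A" for a
    proof -
      have "complex_of_real a \<in> resolvent_set D S"
        using e(2)[of "complex_of_real a"] a by (auto simp: spectrum_op_def dist_of_real dist_real_def)
      from resolvent_gap[OF this] obtain d where d: "d > 0"
        "\<And>r s x. a - d < r \<Longrightarrow> r \<le> s \<Longrightarrow> s < a + d \<Longrightarrow> E r x = E s x" by blast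
      have "E a = E b" if "dist b a < d" for b
      proof (cases "a \<le> b")
        case True
        thus ?thesis using that d(1) by (intro ext d(2)) (auto simp: dist_real_def)
      next
        case False
        thus ?thesis using that d(1) by (intro ext d(2)[symmetric]) (auto simp: dist_real_def)
      qed
      thus ?thesis unfolding eventually_at using d(1) by blast
    qed
    have const: "E a = E b" if "a \<in> ?A" "b \<in> ?A" for a b
      by (rule connected_local_const[OF _ that]) (use loc in auto)
    define s where "s = t + e / 2"
    have s: "s \<in> ?A" using e(1) by (simp add: s_def)
    have "E s x = E t x" for x
    proof (rule tendsto_unique[OF _ _ E_right])
      have "\<forall>\<^sub>F r in at_right t. r \<in> ?A" using e(1) by (intro eventually_at_right_real) simp
      hence "\<forall>\<^sub>F r in at_right t. E r x = E s x" by eventually_elim (simp add: const[OF _ s])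
      thus "((\<lambda>r. E r x) \<longlongrightarrow> E s x) (at_right t)" by (rule tendsto_eventually)
    qed simp
    thus ?thesis using s by (intro exI[of _ s]) auto
  qed
qed

text \<open>
  If \<open>E s x \<noteq> 0\<close> for all \<open>s > t\<close>, then the normalized vectors \<open>E s x\<close> have an accumulation point as \<open>s\<close>
  decreases to \<open>t\<close>, and it lies in the range of \<open>E t\<close> as well as in its kernel.
\<close>

lemma gap_of_compact:
  assumes K: "compact_map (inv_into D S)" and x: "E t x = 0"
  shows "\<exists>s>t. E s x = 0"
proof (rule ccontr)
  assume "\<not> ?thesis"
  hence ne: "E s x \<noteq> 0" if "s > t" for s using that by blast
  have t: "t \<ge> 0"
  proof (rule ccontr)
    assume "\<not> t \<ge> 0"
    thus False using ne[of "t / 2"] E_below_\<alpha>[of "t / 2" x] \<alpha>_pos by simp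
  qed
  define s where "s n = t + 1 / real (Suc n)" for n
  have s: "s n > t" "s n \<le> t + 1" for n by (simp_all add: s_def)
  have s_lim: "s \<longlonglongrightarrow> t"
    using tendsto_add[OF tendsto_const[of t] LIMSEQ_inverse_real_of_nat] by (simp add: s_def[abs_def] inverse_eq_divide)
  define y where "y n = complex_of_real (1 / cnorm g (E (s n) x)) *\<^sub>C E (s n) x" for n
  have ip_y: "ip (y n) (y n) = 1" for n
  proof -
    have "cnorm g (E (s n) x) > 0" using ne[OF s(1)[of n]] by (simp add: less_le)
    thus ?thesis using ne[OF s(1)[of n]] by (simp add: y_def ip_scaleC_self norm_divide power_divide cnorm_power2)
  qed
  have Ey: "E t (y n) = 0" "r \<ge> s n \<Longrightarrow> E r (y n) = y n" for n r
    using x s(1)[of n] by (simp_all add: y_def E_scaleC E_mono E_mono2 complex_vector.scale_zero_right)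
  have yD: "y n \<in> D" for n by (rule in_D[OF Ey(2)[OF order_refl] Ey(1)])
  obtain c C where c: "c > 0" "C > 0" "\<And>x. c * norm x \<le> cnorm g x" "\<And>x. cnorm g x \<le> C * norm x"
    using bounds_ex by blast
  have "norm (S (y n)) \<le> (t + 1) / c" for n
  proof -
    interpret finite_measure "nu (y n)" by (rule finite_nu)
    have "ip (S (y n)) (S (y n)) = (\<integral>l. l\<^sup>2 \<partial>nu (y n))" by (rule S_moments[OF yD])
    also have "\<dots> \<le> (\<integral>l. (t + 1)\<^sup>2 \<partial>nu (y n))"
    proof (rule integral_mono_AE)
      show "AE l in nu (y n). l\<^sup>2 \<le> (t + 1)\<^sup>2"
        using AE_nu_le[OF Ey(2)[OF s(2)]] AE_nu_\<alpha>
      proof eventually_elim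
        case (elim l)
        show ?case by (rule power_mono) (use elim \<alpha>_pos in linarith)+
      qed
    qed (use S_moments(2)[OF yD] in auto)
    also have "\<dots> = (t + 1)\<^sup>2" by (simp only: integral_const_nu ip_y mult_1_right)
    finally have "(cnorm g (S (y n)))\<^sup>2 \<le> (t + 1)\<^sup>2" by (simp only: cnorm_power2)
    hence "cnorm g (S (y n)) \<le> t + 1"
      by (rule power2_le_imp_le) (use t in simp)
    with c(3)[of "S (y n)"] have "c * norm (S (y n)) \<le> t + 1" by linarith
    thus ?thesis using c(1) by (simp add: field_simps)
  qed
  hence "bounded (range (\<lambda>n. S (y n)))" by (auto simp: bounded_iff)
  \<comment> \<open>The \<open>y n\<close> are concentrated on \<open>{t<..t + 1}\<close>, so the
    vectors \<open>S (y n)\<close> are bounded, and \<open>y n = T (S (y n))\<close> lies in a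
    compact set.\<close>
  with K have comp: "compact (closure (T ` range (\<lambda>n. S (y n))))" by (simp add: compact_map_def T_def)
  have "y n \<in> closure (T ` range (\<lambda>n. S (y n)))" for n
    by (rule subsetD[OF closure_subset], rule image_eqI[of _ _ "S (y n)"]) (simp_all add: yD)
  with comp obtain l \<rho> where l: "strict_mono \<rho>" "(y \<circ> \<rho>) \<longlonglongrightarrow> l"
    unfolding compact_def by blast
  have lin: "bounded_linear (E r)" for r
  proof (rule bounded_linear_ipI[where K=1])
    show "E r (a *\<^sub>R x) = a *\<^sub>R E r x" for a x by (simp add: scaleR_scaleC E_scaleC)
    show "cnorm g (E r x) \<le> 1 * cnorm g x" for x
      using dist_fun_le[of x r] by (simp add: cnorm_eq dist_fun_def)
  qed (rule E_add)
  have "ip l l = 1"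
    by (rule LIMSEQ_unique[OF tendsto_ip[OF l(2) l(2)]]) (simp add: ip_y)
  moreover have "E t l = 0"
    by (rule LIMSEQ_unique[OF bounded_linear.tendsto[OF lin l(2)]]) (simp add: Ey)
  moreover have "E r l = l" if "r > t" for r
  proof (rule LIMSEQ_unique[OF bounded_linear.tendsto[OF lin l(2)]])
    have "\<forall>\<^sub>F n in sequentially. s (\<rho> n) < r"
      using order_tendstoD(2)[OF LIMSEQ_subseq_LIMSEQ[OF s_lim l(1)] that] by simp
    hence "\<forall>\<^sub>F n in sequentially. (y \<circ> \<rho>) n = E r ((y \<circ> \<rho>) n)"
      by eventually_elim (simp add: Ey)
    with l(2) show "(\<lambda>n. E r ((y \<circ> \<rho>) n)) \<longlonglongrightarrow> l" by (rule Lim_transform_eventually)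
  qed
  hence "\<forall>\<^sub>F r in at_right t. E r l = l" unfolding eventually_at by (auto intro!: exI[of _ 1])
  hence h: "((\<lambda>r. E r l) \<longlongrightarrow> l) (at_right t)" by (rule tendsto_eventually)
  have "E t l = l" using tendsto_unique[OF _ E_right h] by simp
  ultimately show False by simp
qed

lemma eigen_orth:
  assumes list: "eigenpair_listing g D S bnd I lam u"
    and t: "ereal t < bnd" and e: "e \<in> eigenspace D S (complex_of_real t)"
    and x: "\<And>i. i \<in> I \<Longrightarrow> lam i = t \<Longrightarrow> g (u i) x = 0"
  shows "g e x = 0"
proof -
  have "e \<in> cspan (u ` {i\<in>I. lam i = t})" using list t e by (auto simp: eigenpair_listing_def)
  thus ?thesis
  proof (induction rule: complex_vector.span_induct_alt)
    case (step c b e)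
    thus ?case using x by (auto simp: g_add_left g_scaleC_left)
  qed simp
qed

text \<open>The candidate \<open>p\<close> is the Fourier sum over the eigenvalues up to
  \<open>s\<close>. Its difference from \<open>E s x\<close> is orthogonal to all eigenvectors, and
  \<open>no_lower_part\<close> with infinite bound makes every projection of it vanish. Completeness
  of the eigenvectors is contained in this argument.\<close>

lemma E_in_span:
  assumes K: "compact_map (inv_into D S)" and list: "eigenpair_listing g D S \<infinity> {1..} mu q"
    and fin: "finite {k\<in>{1..}. mu k \<le> s}"
  shows "E s x \<in> cspan (q ` {k\<in>{1..}. mu k \<le> s})"
proof -
  let ?K = "{k\<in>{1..}. mu k \<le> s}"
  from list have q: "\<And>k. k \<ge> 1 \<Longrightarrow> q k \<in> eigenspace D S (complex_of_real (mu k))"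
    and on: "\<And>i j. i \<ge> 1 \<Longrightarrow> j \<ge> 1 \<Longrightarrow> g (q i) (q j) = (if i = j then 1 else 0)"
    by (auto simp: eigenpair_listing_def)
  define p where "p = (\<Sum>k\<in>?K. g (q k) x *\<^sub>C q k)"
  have orth_q: "g (q k) (E s x - p) = 0" if k: "k \<ge> 1" for k
  proof -
    have "g (q k) p = (\<Sum>i\<in>?K. if i = k then g (q k) x else 0)"
      unfolding p_def g_sum_right by (rule sum.cong) (use on k in \<open>auto simp: g_scaleC_right\<close>)
    also have "\<dots> = (if mu k \<le> s then g (q k) x else 0)" using fin k by (simp add: sum.delta)
    also have "\<dots> = g (E s (q k)) x" by (simp add: E_eigen[OF q[OF k]])
    finally show ?thesis by (simp add: g_diff_right E_g)
  qed
  have "E t (E s x - p) = 0" for t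
  proof (rule no_lower_part[where bnd=\<infinity>])
    fix t e assume e: "e \<in> eigenspace D S (complex_of_real t)"
    show "g e (E s x - p) = 0"
      by (rule eigen_orth[OF list _ e]) (use orth_q in auto)
  qed (use gap_of_compact[OF K] in auto)
  hence "E s x - p = 0" using tendsto_unique[OF _ E_top[of "E s x - p"], of 0] by simp
  hence "E s x = p" by simp
  moreover have "p \<in> cspan (q ` ?K)" unfolding p_def
    by (intro complex_vector.span_sum complex_vector.span_scale complex_vector.span_base) auto
  ultimately show ?thesis by simp
qed

end

section \<open>Powers and the Heinz inequality\<close>

lemma powr_power2: "((t::real) powr r)\<^sup>2 = t powr (2 * r)"
  by (simp add: power2_eq_square powr_add[symmetric])

text \<open>Cutting at a positive level removes the singularity of negative powers at zero. For
  nonnegative exponents the growth over a unit step is controlled by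
  \<open>max s a \<le> (1 + 1 / a) * max t a\<close>; for negative ones the function
  decreases.\<close>

lemma tame_max_powr:
  assumes a: "a > 0"
  shows "tame (\<lambda>t. max t a powr r)"
proof -
  have "continuous_on UNIV (\<lambda>t. max t a powr r)"
    using a by (intro continuous_intros) auto
  moreover have "\<bar>max s a powr r\<bar> \<le> ((1 + 1 / a) powr r + 1) * (1 + \<bar>max t a powr r\<bar>)"
    if ts: "t \<le> s" "s \<le> t + 1" for s t
  proof -
    have pos: "0 < max t a" "max t a \<le> max s a" using a ts by auto
    have le: "max s a powr r \<le> ((1 + 1 / a) powr r + 1) * max t a powr r"
    proof (cases "r \<ge> 0")
      case True
      have "a \<le> max t a" by simp
      hence "1 \<le> max t a / a" using a by (simp del: max.cobounded2)
      hence "max s a \<le> max t a + max t a / a" using ts by (auto simp: max_def split: if_splits)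
      also have "\<dots> = (1 + 1 / a) * max t a" by (simp add: distrib_right)
      finally have "max s a powr r \<le> ((1 + 1 / a) * max t a) powr r"
        using True pos by (intro powr_mono2) auto
      also have "\<dots> = (1 + 1 / a) powr r * max t a powr r" using a pos by (intro powr_mult)
      finally show ?thesis by (simp add: distrib_right add_increasing2)
    next
      case False
      hence "max s a powr r \<le> max t a powr r" using pos by (intro powr_mono2') auto
      thus ?thesis by (simp add: distrib_right add_increasing)
    qed
    also have "\<dots> \<le> ((1 + 1 / a) powr r + 1) * (1 + max t a powr r)"
      by (intro mult_left_mono) auto
    finally show ?thesis by simp
  qed
  ultimately show ?thesis unfolding tame_def
    by (intro conjI exI[of _ "(1 + 1 / a) powr r + 1"]) auto
qed

text \<open>The minimum switches at \<open>s = t\<close>. Below, the integrand is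
  \<open>s powr (2 * \<tau> - 1)\<close>, integrable at zero as \<open>\<tau> > 0\<close>; above, it
  is \<open>t\<^sup>2 * s powr (2 * \<tau> - 3)\<close>, integrable at infinity as
  \<open>\<tau> < 1\<close>. Each piece contributes one summand of the constant.\<close>

lemma kernel_integral:
  fixes t \<tau> :: real
  assumes t: "t > 0" and \<tau>: "0 < \<tau>" "\<tau> < 1"
  shows "(\<integral>\<^sup>+s. ennreal (s powr (2 * \<tau> - 1) * min (t\<^sup>2 / s\<^sup>2) 1) * indicator {0<..} s \<partial>lborel) =
    ennreal ((1 / (2 * \<tau>) + 1 / (2 - 2 * \<tau>)) * (t powr \<tau>)\<^sup>2)"
proof -
  have "(\<integral>\<^sup>+s. ennreal (s powr (2 * \<tau> - 1) * min (t\<^sup>2 / s\<^sup>2) 1) * indicator {0<..} s \<partial>lborel) =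
      (\<integral>\<^sup>+s. ennreal (s powr (2 * \<tau> - 1)) * indicator {0..t} s +
        ennreal (t\<^sup>2) * (ennreal (s powr (2 * \<tau> - 3)) * indicator {t..} s) \<partial>lborel)"
  proof (rule nn_integral_cong_AE)
    have "AE s in lborel. s \<noteq> t" by (rule AE_lborel_singleton)
    thus "AE s in lborel. ennreal (s powr (2 * \<tau> - 1) * min (t\<^sup>2 / s\<^sup>2) 1) * indicator {0<..} s =
        ennreal (s powr (2 * \<tau> - 1)) * indicator {0..t} s +
        ennreal (t\<^sup>2) * (ennreal (s powr (2 * \<tau> - 3)) * indicator {t..} s)"
    proof eventually_elim
      case (elim s)
      consider "s \<le> 0" | "0 < s" "s < t" | "t < s" using elim by linarith
      thus ?case
      proof cases
        case 1
        thus ?thesis using t by (cases "s = 0") auto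
      next
        case 2
        hence "s\<^sup>2 \<le> t\<^sup>2" by (intro power_mono) auto
        hence "min (t\<^sup>2 / s\<^sup>2) 1 = 1" using 2 by (simp add: min_def)
        thus ?thesis using 2 by simp
      next
        case 3
        hence "t\<^sup>2 \<le> s\<^sup>2" using t by (intro power_mono) auto
        hence "min (t\<^sup>2 / s\<^sup>2) 1 = t\<^sup>2 / s\<^sup>2" using 3 t by (simp add: min_def)
        moreover have "s powr (2 * \<tau> - 1) = s powr (2 * \<tau> - 3) * s\<^sup>2"
        proof -
          have "s powr (2 * \<tau> - 1) = s powr ((2 * \<tau> - 3) + 2)" by simp
          also have "\<dots> = s powr (2 * \<tau> - 3) * s powr 2" by (rule powr_add)
          finally show ?thesis using 3 t by (simp add: powr_numeral)
        qed
        ultimately have "s powr (2 * \<tau> - 1) * min (t\<^sup>2 / s\<^sup>2) 1 = t\<^sup>2 * s powr (2 * \<tau> - 3)"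
          using 3 t by simp
        thus ?thesis using 3 t by (simp add: ennreal_mult)
      qed
    qed
  qed
  also have "\<dots> = (\<integral>\<^sup>+s. ennreal (s powr (2 * \<tau> - 1)) * indicator {0..t} s \<partial>lborel) +
      ennreal (t\<^sup>2) * (\<integral>\<^sup>+s. ennreal (s powr (2 * \<tau> - 3)) * indicator {t..} s \<partial>lborel)"
    by (subst nn_integral_add) (auto simp: nn_integral_cmult)
  also have "(\<integral>\<^sup>+s. ennreal (s powr (2 * \<tau> - 1)) * indicator {0..t} s \<partial>lborel) = ennreal (t powr (2 * \<tau> - 1 + 1) / (2 * \<tau> - 1 + 1))"
    using \<tau> t by (intro nn_integral_has_integral_lebesgue' has_integral_powr_from_0) auto
  also have "(\<integral>\<^sup>+s. ennreal (s powr (2 * \<tau> - 3)) * indicator {t..} s \<partial>lborel) = ennreal (- (t powr (2 * \<tau> - 3 + 1)) / (2 * \<tau> - 3 + 1))"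
    using \<tau> t by (intro nn_integral_has_integral_lebesgue' has_integral_powr_to_inf) auto
  also have "ennreal (t powr (2 * \<tau> - 1 + 1) / (2 * \<tau> - 1 + 1)) + ennreal (t\<^sup>2) * ennreal (- (t powr (2 * \<tau> - 3 + 1)) / (2 * \<tau> - 3 + 1)) =
      ennreal (t powr (2 * \<tau>) / (2 * \<tau>) + t\<^sup>2 * (t powr (2 * \<tau> - 2) / (2 - 2 * \<tau>)))"
  proof -
    have "- (t powr (2 * \<tau> - 3 + 1)) / (2 * \<tau> - 3 + 1) = t powr (2 * \<tau> - 2) / (2 - 2 * \<tau>)"
      using \<tau> by (simp add: divide_simps) (simp add: algebra_simps)
    thus ?thesis using \<tau> by (simp add: ennreal_plus ennreal_mult[symmetric])
  qed
  also have "t\<^sup>2 * (t powr (2 * \<tau> - 2) / (2 - 2 * \<tau>)) = t powr (2 * \<tau>) / (2 - 2 * \<tau>)"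
  proof -
    have "t powr (2 * \<tau>) = t powr (2 + (2 * \<tau> - 2))" by simp
    also have "\<dots> = t powr 2 * t powr (2 * \<tau> - 2)" by (rule powr_add)
    finally show ?thesis using t by (simp add: powr_numeral)
  qed
  finally show ?thesis by (simp add: powr_power2 distrib_right)
qed

lemma equiv_inner_cinner: "equiv_inner (cinner :: 'a::complex_hilbert \<Rightarrow> 'a \<Rightarrow> complex)"
proof
  have "cnorm cinner x = norm x" for x :: 'a
    by (simp add: cnorm_def norm_eq_sqrt_inner inner_eq_Re_cinner)
  hence "\<exists>c>0. \<exists>C>0. \<forall>x::'a. c * norm x \<le> cnorm cinner x \<and> cnorm cinner x \<le> C * norm x"
    by (intro exI[of _ "1::real"] conjI) auto
  moreover have "is_cinner (cinner :: 'a \<Rightarrow> 'a \<Rightarrow> complex)"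
    unfolding is_cinner_def
  proof (intro conjI allI impI)
    fix x y :: 'a
    show "cinner x y = cnj (cinner y x)" by (rule cinner_commute)
    assume "x \<noteq> 0"
    thus "0 < Re (cinner x x)" by (simp flip: inner_eq_Re_cinner)
  qed (simp_all add: cinner_add_right cinner_scaleC_right)
  ultimately show "equivalent_cinner (cinner :: 'a \<Rightarrow> 'a \<Rightarrow> complex)"
    unfolding equivalent_cinner_def by blast
qed

section \<open>Powers of a positive definite selfadjoint operator\<close>

context posdef_selfadjoint begin

abbreviation R where "R r \<equiv> power_op g D S r"
abbreviation Dom where "Dom r \<equiv> power_dom g D S r"

lemma powr_eq_AE: "AE t in nu x. t powr r = max t \<alpha> powr r"
  using AE_nu_\<alpha> by eventually_elim (simp add: max_absorb1)

lemma is_spectral_integral_powr_iff: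
  "is_spectral_integral g E (\<lambda>t. t powr r) U X \<longleftrightarrow> is_spectral_integral g E (\<lambda>t. max t \<alpha> powr r) U X"
  by (rule is_spectral_integral_cong[OF _ _ powr_eq_AE]) measurable

text \<open>This justifies the choice in \<open>power_op\<close>. The witness is the spectral
  integral of \<open>max t \<alpha> powr r\<close>, a tame function that agrees with the power
  almost everywhere because the measures live on \<open>{\<alpha>..}\<close>.\<close>

lemma power_integral: "is_spectral_integral g E (\<lambda>t. t powr r) (Dom r) (R r)"
proof -
  let ?f = "\<lambda>t. max t \<alpha> powr r"
  have "is_spectral_integral g E (\<lambda>t. t powr r) (spectral_dom g E ?f) (spectral_int ?f)"
    unfolding is_spectral_integral_powr_iff by (rule is_spectral_integral_spectral_int[OF tame_max_powr[OF \<alpha>_pos]])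
  moreover from this have "spectral_dom g E ?f = Dom r"
    by (simp add: is_spectral_integral_def power_dom_def)
  ultimately have "is_spectral_integral g E (\<lambda>t. t powr r) (Dom r) (spectral_int ?f)" by simp
  thus ?thesis unfolding power_op_def
    by (rule someI[of "is_spectral_integral g E (\<lambda>t. t powr r) (Dom r)"])
qed

lemma Dom_iff: "x \<in> Dom r \<longleftrightarrow> (\<integral>\<^sup>+t. ennreal ((t powr r)\<^sup>2) \<partial>nu x) < \<infinity>"
  unfolding power_dom_def by (rule integrable_sq_iff) measurable

lemma Dom_integrable: "x \<in> Dom r \<longleftrightarrow> integrable (nu x) (\<lambda>t. (t powr r)\<^sup>2)"
  by (simp add: power_dom_def spectral_dom_def)

lemma R_clinear: "clinear_on (Dom r) (R r)"
  using power_integral unfolding is_spectral_integral_def by blast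

lemma Dom_subspace: "csubspace (Dom r)"
  using R_clinear by (simp add: clinear_on_def)

lemmas R_add = clinear_onD(2)[OF R_clinear]
  and R_scaleC = clinear_onD(3)[OF R_clinear]

lemma R_norm: "x \<in> Dom r \<Longrightarrow> ip (R r x) (R r x) = (\<integral>t. (t powr r)\<^sup>2 \<partial>nu x)"
proof -
  assume x: "x \<in> Dom r"
  have "ip (R r x) (R r x) = (\<integral>t. (max t \<alpha> powr r)\<^sup>2 \<partial>nu x)"
    by (rule spectral_integral_norm[OF tame_max_powr[OF \<alpha>_pos] _ x])
      (use power_integral in \<open>simp only: is_spectral_integral_powr_iff[symmetric]\<close>)
  also have "\<dots> = (\<integral>t. (t powr r)\<^sup>2 \<partial>nu x)"
    by (rule integral_cong_AE) (measurable, use powr_eq_AE[where x=x and r=r] in \<open>eventually_elim, simp\<close>)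
  finally show ?thesis .
qed

lemma R_norm_nn: "x \<in> Dom r \<Longrightarrow> ennreal (ip (R r x) (R r x)) = (\<integral>\<^sup>+t. ennreal ((t powr r)\<^sup>2) \<partial>nu x)"
  by (subst nn_integral_eq_integral) (auto simp: R_norm Dom_integrable[symmetric])

lemma R_sym: "x \<in> Dom r \<Longrightarrow> y \<in> Dom r \<Longrightarrow> g (R r x) y = g x (R r y)"
  by (rule spectral_integral_sym[OF power_integral])

lemma eigen_Dom:
  assumes q: "q \<in> eigenspace D S (complex_of_real m)"
  shows "q \<in> Dom r" "R r q = complex_of_real (m powr r) *\<^sub>C q"
proof -
  interpret finite_measure "nu q" by (rule finite_nu)
  have ae: "AE t in nu q. (t powr r)\<^sup>2 = (m powr r)\<^sup>2" "AE t in nu q. t powr r = m powr r"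
    using AE_nu_eigen[OF q] by (eventually_elim, simp)+
  have "integrable (nu q) (\<lambda>t. (t powr r)\<^sup>2)"
    by (subst integrable_cong_AE[OF _ _ ae(1)]) auto
  thus D: "q \<in> Dom r" by (simp add: Dom_integrable)
  have n: "ip (R r q) (R r q) = (m powr r)\<^sup>2 * ip q q"
    unfolding R_norm[OF D] by (subst integral_cong_AE[OF _ _ ae(1)]) (auto simp: measure_nu_UNIV)
  have "g (R r q) q = complex_of_real (\<integral>t. t powr r \<partial>nu q)"
    using power_integral D by (simp add: is_spectral_integral_def)
  also have "(\<integral>t. t powr r \<partial>nu q) = m powr r * ip q q"
    by (subst integral_cong_AE[OF _ _ ae(2)]) (auto simp: measure_nu_UNIV)
  finally have f: "ip (R r q) q = m powr r * ip q q" by (simp add: ip_def)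
  have "ip (R r q - (m powr r) *\<^sub>R q) (R r q - (m powr r) *\<^sub>R q) = 0"
    by (simp add: ip_simps n f ip_commute[of q "R r q"] power2_eq_square)
  thus "R r q = complex_of_real (m powr r) *\<^sub>C q" by (simp add: scaleR_scaleC)
qed

lemma g_R_eigen:
  assumes q: "q \<in> eigenspace D S (complex_of_real m)" and x: "x \<in> Dom r"
  shows "g (R r q) (R r x) = complex_of_real (m powr (2 * r)) * g q x"
proof -
  have "g (R r q) (R r x) = complex_of_real (m powr r) * g q (R r x)"
    by (simp add: eigen_Dom[OF q] g_scaleC_left)
  also have "g q (R r x) = g (R r q) x" by (rule R_sym[symmetric, OF eigen_Dom(1)[OF q] x])
  also have "\<dots> = complex_of_real (m powr r) * g q x"
    by (simp add: eigen_Dom[OF q] g_scaleC_left)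
  finally show ?thesis by (simp add: powr_power2[symmetric] power2_eq_square)
qed

lemma Dom_mono:
  assumes rr: "r \<le> r'" and x: "x \<in> Dom r'"
  shows "x \<in> Dom r" "ip (R r x) (R r x) \<le> (\<alpha> powr (r - r'))\<^sup>2 * ip (R r' x) (R r' x)"
proof -
  have ae: "AE t in nu x. (t powr r)\<^sup>2 \<le> (\<alpha> powr (r - r'))\<^sup>2 * (t powr r')\<^sup>2"
    using AE_nu_\<alpha>
  proof eventually_elim
    case (elim t)
    have "t powr r = t powr ((r - r') + r')" by simp
    also have "\<dots> = t powr (r - r') * t powr r'" by (rule powr_add)
    also have "\<dots> \<le> \<alpha> powr (r - r') * t powr r'"
      using elim \<alpha>_pos rr by (intro mult_right_mono powr_mono2') auto
    finally have "t powr r \<le> \<alpha> powr (r - r') * t powr r'" .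
    from power_mono[OF this, of 2] show ?case by (simp add: power_mult_distrib)
  qed
  have i': "integrable (nu x) (\<lambda>t. (\<alpha> powr (r - r'))\<^sup>2 * (t powr r')\<^sup>2)" using x by (simp add: Dom_integrable)
  have i: "integrable (nu x) (\<lambda>t. (t powr r)\<^sup>2)"
    by (rule Bochner_Integration.integrable_bound[OF i']) (use ae in auto)
  thus D: "x \<in> Dom r" by (simp add: Dom_integrable)
  show "ip (R r x) (R r x) \<le> (\<alpha> powr (r - r'))\<^sup>2 * ip (R r' x) (R r' x)"
    using integral_mono_AE[OF i i' ae] by (simp add: R_norm D x)
qed

lemma powr_1_AE: "AE t in nu x. (t powr 1)\<^sup>2 = t\<^sup>2"
  using AE_nu_\<alpha> by eventually_elim (use \<alpha>_pos in simp)

lemma Dom_1: "x \<in> Dom 1 \<longleftrightarrow> x \<in> D"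
proof -
  have "x \<in> Dom 1 \<longleftrightarrow> integrable (nu x) (\<lambda>t. t\<^sup>2)"
    unfolding Dom_integrable
  proof (rule integrable_cong_AE)
    show "AE t in nu x. (t powr 1)\<^sup>2 = t\<^sup>2" by (rule powr_1_AE)
  qed measurable
  thus ?thesis by (simp add: in_D_iff spectral_dom_def)
qed

lemma S_norm_nn: "x \<in> D \<Longrightarrow> (\<integral>\<^sup>+t. ennreal (t\<^sup>2) \<partial>nu x) = ennreal (ip (S x) (S x))"
  by (subst nn_integral_eq_integral) (auto simp: S_moments)

lemma D_subset_Dom: "r \<le> 1 \<Longrightarrow> x \<in> D \<Longrightarrow> x \<in> Dom r"
  using Dom_mono(1)[of r 1 x] by (simp add: Dom_1)

text \<open>On the support of the measure, \<open>t powr (2 * r) = t * t powr (2 * r - 1)\<close>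
  with \<open>t \<ge> b\<close>. For the forms of indices \<open>r\<close> and
  \<open>r - 1/2\<close> this bounds the Rayleigh quotient from below.\<close>

lemma R_lower_bound:
  assumes low: "\<And>s. s < b \<Longrightarrow> E s x = 0" and b: "b > 0" and x: "x \<in> Dom r"
  shows "b * ip (R (r - 1/2) x) (R (r - 1/2) x) \<le> ip (R r x) (R r x)"
proof -
  have x': "x \<in> Dom (r - 1/2)" by (rule Dom_mono(1)[OF _ x]) simp
  have bt: "AE t in nu x. b \<le> t" by (rule AE_nu_ge) (rule low)
  have "b * ip (R (r - 1/2) x) (R (r - 1/2) x) = (\<integral>t. b * (t powr (r - 1/2))\<^sup>2 \<partial>nu x)"
    by (simp add: R_norm[OF x'])
  also have "\<dots> \<le> (\<integral>t. (t powr r)\<^sup>2 \<partial>nu x)"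
  proof (rule integral_mono_AE)
    show "AE t in nu x. b * (t powr (r - 1/2))\<^sup>2 \<le> (t powr r)\<^sup>2"
      using bt
    proof eventually_elim
      case (elim t)
      have "b * (t powr (r - 1/2))\<^sup>2 \<le> t * (t powr (r - 1/2))\<^sup>2" using elim by (intro mult_right_mono) auto
      also have "\<dots> = t powr 1 * t powr (2 * (r - 1/2))" using elim b by (simp only: powr_power2 powr_one)
      also have "\<dots> = t powr (1 + 2 * (r - 1/2))" by (rule powr_add[symmetric])
      also have "\<dots> = (t powr r)\<^sup>2" by (simp add: powr_power2)
      finally show ?case .
    qed
  qed (use x x' in \<open>simp_all add: Dom_integrable\<close>)
  also have "\<dots> = ip (R r x) (R r x)" by (simp add: R_norm[OF x])
  finally show ?thesis .
qed

text \<open>The square norm of the part of \<open>R r x\<close> above the spectral level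
  \<open>s\<close>. Its decay turns a rate with O into one with little o.\<close>

definition tail :: "real \<Rightarrow> 'a \<Rightarrow> real \<Rightarrow> real" where
  "tail r x s = (\<integral>t. (t powr r)\<^sup>2 * indicator {s<..} t \<partial>nu x)"

lemma tail_nonneg: "0 \<le> tail r x s"
  by (simp add: tail_def integral_nonneg_AE)

lemma tail_tendsto:
  assumes x: "x \<in> Dom r" and s: "filterlim s at_top sequentially"
  shows "(\<lambda>n. tail r x (s n)) \<longlonglongrightarrow> 0"
proof -
  have "(\<lambda>n. tail r x (s n)) \<longlonglongrightarrow> (\<integral>t. 0 \<partial>nu x)" unfolding tail_def
  proof (rule integral_dominated_convergence[where w="\<lambda>t. (t powr r)\<^sup>2"])
    show "AE t in nu x. (\<lambda>n. (t powr r)\<^sup>2 * indicat_real {s n<..} t) \<longlonglongrightarrow> 0"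
    proof (intro AE_I2 tendsto_eventually)
      fix t
      have "\<forall>\<^sub>F n in sequentially. t \<le> s n" using s by (simp add: filterlim_at_top)
      thus "\<forall>\<^sub>F n in sequentially. (t powr r)\<^sup>2 * indicat_real {s n<..} t = 0"
        by eventually_elim simp
    qed
  qed (use x in \<open>auto simp: Dom_integrable indicator_def\<close>)
  thus ?thesis by simp
qed

text \<open>For \<open>t > s\<close> the factor \<open>t powr (r - r')\<close> is at most
  \<open>s powr (r - r')\<close>, the exponent being nonpositive. The error thus splits into an
  explicit rate and a tail.\<close>

lemma tail_bound:
  assumes x: "x \<in> Dom r'" and s: "s > 0" and rr: "r \<le> r'"
  shows "(\<integral>\<^sup>+t. ennreal ((t powr r)\<^sup>2) \<partial>nu (x - E s x)) \<le> ennreal ((s powr (r - r'))\<^sup>2 * tail r' x s)"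
proof -
  have "(\<integral>\<^sup>+t. ennreal ((t powr r)\<^sup>2) \<partial>nu (x - E s x)) = (\<integral>\<^sup>+t. ennreal ((t powr r)\<^sup>2) * indicator {s<..} t \<partial>nu x)"
    by (rule nn_integral_nu_E) measurable
  also have "\<dots> \<le> (\<integral>\<^sup>+t. ennreal ((s powr (r - r'))\<^sup>2 * ((t powr r')\<^sup>2 * indicator {s<..} t)) \<partial>nu x)"
  proof (rule nn_integral_mono)
    fix t
    show "ennreal ((t powr r)\<^sup>2) * indicator {s<..} t \<le> ennreal ((s powr (r - r'))\<^sup>2 * ((t powr r')\<^sup>2 * indicator {s<..} t))"
    proof (cases "s < t")
      case True
      have "t powr r = t powr ((r - r') + r')" by simp
      also have "\<dots> = t powr (r - r') * t powr r'" by (rule powr_add)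
      also have "\<dots> \<le> s powr (r - r') * t powr r'"
        using True s rr by (intro mult_right_mono powr_mono2') auto
      finally have "t powr r \<le> s powr (r - r') * t powr r'" .
      from power_mono[OF this, of 2] show ?thesis using True by (simp add: power_mult_distrib ennreal_leI)
    qed simp
  qed
  also have "\<dots> = ennreal (\<integral>t. (s powr (r - r'))\<^sup>2 * ((t powr r')\<^sup>2 * indicator {s<..} t) \<partial>nu x)"
    using x by (intro nn_integral_eq_integral integrable_mult_right integrable_real_mult_indicator) (auto simp: Dom_integrable)
  also have "\<dots> = ennreal ((s powr (r - r'))\<^sup>2 * tail r' x s)" by (simp add: tail_def)
  finally show ?thesis .
qed

end

text \<open>
  The Heinz inequality by real interpolation: up to a constant, \<open>t powr (2 * \<tau>)\<close> is the integral of
  \<open>s powr (2 * \<tau> - 1) * min (t\<^sup>2 / s\<^sup>2) 1\<close> over \<open>s > 0\<close>, and for each \<open>s\<close> the truncated forms are compared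
  by splitting \<open>x\<close> at the level \<open>s\<close> of the spectrum of \<open>M\<close>.
\<close>

lemma heinz_inequality:
  fixes A M :: "'a::complex_hilbert \<Rightarrow> 'a"
  assumes "posdef_selfadjoint g DA A" and "posdef_selfadjoint h DM M"
    and emb: "DM \<subseteq> DA" "\<And>x. x \<in> DM \<Longrightarrow> cnorm g (A x) \<le> C * cnorm h (M x)"
    and \<tau>: "0 \<le> \<tau>" "\<tau> \<le> 1"
  shows "\<exists>K\<ge>0. \<forall>x. (\<integral>\<^sup>+t. ennreal ((t powr \<tau>)\<^sup>2) \<partial>spectral_measure g (spectral_family_of g DA A) x)
    \<le> ennreal K * (\<integral>\<^sup>+t. ennreal ((t powr \<tau>)\<^sup>2) \<partial>spectral_measure h (spectral_family_of h DM M) x)"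
proof -
  interpret A: posdef_selfadjoint g DA A by fact
  interpret M: posdef_selfadjoint h DM M by fact
  obtain c1 C1 where 1: "c1 > 0" "C1 > 0" "\<And>x. c1 * norm x \<le> cnorm g x" "\<And>x. cnorm g x \<le> C1 * norm x"
    using A.bounds_ex by blast
  obtain c2 C2 where 2: "c2 > 0" "C2 > 0" "\<And>x. c2 * norm x \<le> cnorm h x" "\<And>x. cnorm h x \<le> C2 * norm x"
    using M.bounds_ex by blast
  \<comment> \<open>One constant for both end points: \<open>C\<^sup>2\<close> compares the
    operators, \<open>(C1 / c2)\<^sup>2\<close> the two equivalent norms.\<close>
  define k where "k = max (C\<^sup>2) ((C1 / c2)\<^sup>2)"
  have k: "k \<ge> 0" by (simp add: k_def le_max_iff_disj)
  have n0: "A.ip x x \<le> k * M.ip x x" for x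
  proof -
    have "cnorm g x \<le> C1 / c2 * cnorm h x"
      using 1(4)[of x] 2(3)[of x] 1(2) 2(1) by (simp add: field_simps) (smt (verit) mult.assoc mult.commute mult_left_mono)
    hence "(cnorm g x)\<^sup>2 \<le> (C1 / c2 * cnorm h x)\<^sup>2" by (rule power_mono) simp
    also have "\<dots> = (C1 / c2)\<^sup>2 * M.ip x x" by (simp only: power_mult_distrib M.cnorm_power2)
    also have "\<dots> \<le> k * M.ip x x" by (intro mult_right_mono) (simp_all add: k_def)
    finally show ?thesis by (simp only: A.cnorm_power2)
  qed
  have n1: "A.ip (A x) (A x) \<le> k * M.ip (M x) (M x)" if "x \<in> DM" for x
  proof -
    have "(cnorm g (A x))\<^sup>2 \<le> (C * cnorm h (M x))\<^sup>2" by (rule power_mono[OF emb(2)[OF that]]) simp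
    also have "\<dots> = C\<^sup>2 * M.ip (M x) (M x)" by (simp only: power_mult_distrib M.cnorm_power2)
    also have "\<dots> \<le> k * M.ip (M x) (M x)" by (intro mult_right_mono) (simp_all add: k_def)
    finally show ?thesis by (simp only: A.cnorm_power2)
  qed
  \<comment> \<open>At the end points one half of \<open>kernel_integral\<close> diverges; there the
    inequality is \<open>n0\<close> or \<open>n1\<close> itself.\<close>
  consider "\<tau> = 0" | "\<tau> = 1" | "0 < \<tau>" "\<tau> < 1" using \<tau> by linarith
  thus ?thesis
  proof cases
    case 1
    have "(\<integral>\<^sup>+t. ennreal ((t powr \<tau>)\<^sup>2) \<partial>A.nu x) \<le> ennreal k * (\<integral>\<^sup>+t. ennreal ((t powr \<tau>)\<^sup>2) \<partial>M.nu x)" for x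
    proof -
      have "(\<integral>\<^sup>+t. ennreal ((t powr \<tau>)\<^sup>2) \<partial>A.nu x) \<le> (\<integral>\<^sup>+t. 1 \<partial>A.nu x)"
        by (rule nn_integral_mono) (simp add: 1)
      also have "\<dots> = ennreal (A.ip x x)" by (simp add: A.emeasure_nu_UNIV)
      also have "\<dots> \<le> ennreal (k * M.ip x x)" by (intro ennreal_leI n0)
      also have "\<dots> = ennreal k * (\<integral>\<^sup>+t. 1 \<partial>M.nu x)" by (simp add: M.emeasure_nu_UNIV ennreal_mult k)
      also have "(\<integral>\<^sup>+t. 1 \<partial>M.nu x) = (\<integral>\<^sup>+t. ennreal ((t powr \<tau>)\<^sup>2) \<partial>M.nu x)"
      proof (rule nn_integral_cong_AE)
        show "AE t in M.nu x. 1 = ennreal ((t powr \<tau>)\<^sup>2)"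
          using M.AE_nu_\<alpha> by eventually_elim (use M.\<alpha>_pos in \<open>simp add: 1\<close>)
      qed
      finally show ?thesis .
    qed
    thus ?thesis using k by blast
  next
    case 2
    have e: "(\<integral>\<^sup>+t. ennreal ((t powr \<tau>)\<^sup>2) \<partial>A.nu x) = (\<integral>\<^sup>+t. ennreal (t\<^sup>2) \<partial>A.nu x)"
      "(\<integral>\<^sup>+t. ennreal ((t powr \<tau>)\<^sup>2) \<partial>M.nu x) = (\<integral>\<^sup>+t. ennreal (t\<^sup>2) \<partial>M.nu x)" for x
    proof -
      show "(\<integral>\<^sup>+t. ennreal ((t powr \<tau>)\<^sup>2) \<partial>A.nu x) = (\<integral>\<^sup>+t. ennreal (t\<^sup>2) \<partial>A.nu x)"
        by (rule nn_integral_cong_AE) (use A.powr_1_AE[of x] in \<open>eventually_elim, simp add: 2\<close>)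
      show "(\<integral>\<^sup>+t. ennreal ((t powr \<tau>)\<^sup>2) \<partial>M.nu x) = (\<integral>\<^sup>+t. ennreal (t\<^sup>2) \<partial>M.nu x)"
        by (rule nn_integral_cong_AE) (use M.powr_1_AE[of x] in \<open>eventually_elim, simp add: 2\<close>)
    qed
    \<comment> \<open>For \<open>x\<close> outside \<open>DM\<close> the right side has to be
      infinite. Only \<open>k \<ge> 0\<close> is recorded, and adding 1 rules out a product of zero
      and infinity.\<close>
    have "(\<integral>\<^sup>+t. ennreal ((t powr \<tau>)\<^sup>2) \<partial>A.nu x) \<le> ennreal (k + 1) * (\<integral>\<^sup>+t. ennreal ((t powr \<tau>)\<^sup>2) \<partial>M.nu x)" for x
    proof (cases "x \<in> DM")
      case True
      have "ennreal (A.ip (A x) (A x)) \<le> ennreal ((k + 1) * M.ip (M x) (M x))"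
        using n1[OF True] by (intro ennreal_leI) (simp add: distrib_right add_increasing2)
      thus ?thesis using True emb(1) k
        by (simp only: e A.S_norm_nn[OF subsetD[OF emb(1) True]] M.S_norm_nn[OF True] ennreal_mult M.ip_nonneg add_nonneg_nonneg zero_le_one)
    next
      case False
      hence "x \<notin> M.Dom 1" by (simp add: M.Dom_1)
      hence "(\<integral>\<^sup>+t. ennreal ((t powr \<tau>)\<^sup>2) \<partial>M.nu x) = \<infinity>" by (simp add: M.Dom_iff 2 less_top[symmetric])
      moreover have "ennreal (k + 1) \<noteq> 0" using k by simp
      ultimately show ?thesis by (simp add: ennreal_mult_top)
    qed
    thus ?thesis using k by (intro exI[of _ "k + 1"]) auto
  next
    case 3
    let ?m = "\<lambda>s t. min (t\<^sup>2 / s\<^sup>2) 1 :: real"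
    \<comment> \<open>A comparison of K-functionals. The part of \<open>x\<close> below the level
      \<open>s\<close> lies in \<open>DM\<close>, where the operator bound applies; the rest is
      measured by the norms alone. Each part contributes \<open>2 * k\<close>.\<close>
    have trunc: "(\<integral>\<^sup>+t. ennreal (?m s t) \<partial>A.nu x) \<le> ennreal (4 * k) * (\<integral>\<^sup>+t. ennreal (?m s t) \<partial>M.nu x)"
      if s: "s > 0" for s x
    proof -
      define z where "z = M.E s x"
      have z: "M.E s z = z" "M.E 0 z = 0" using M.E_below_\<alpha>[OF M.\<alpha>_pos] by (simp_all add: z_def)
      hence zM: "z \<in> DM" by (rule M.in_D)
      have "(\<integral>\<^sup>+t. ennreal (?m s t) \<partial>A.nu z) \<le> (\<integral>\<^sup>+t. ennreal (1 / s\<^sup>2) * ennreal (t\<^sup>2) \<partial>A.nu z)"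
        by (rule nn_integral_mono) (simp add: ennreal_mult[symmetric] ennreal_leI)
      also have "\<dots> = ennreal (1 / s\<^sup>2) * ennreal (A.ip (A z) (A z))"
        using zM emb(1) by (subst nn_integral_cmult) (auto simp: A.S_norm_nn)
      also have "\<dots> \<le> ennreal (1 / s\<^sup>2) * ennreal (k * M.ip (M z) (M z))"
        by (intro mult_left_mono ennreal_leI n1 zM) simp
      also have "\<dots> = ennreal k * (ennreal (1 / s\<^sup>2) * (\<integral>\<^sup>+t. ennreal (t\<^sup>2) \<partial>M.nu z))"
        by (simp add: M.S_norm_nn[OF zM] ennreal_mult k mult_ac)
      also have "ennreal (1 / s\<^sup>2) * (\<integral>\<^sup>+t. ennreal (t\<^sup>2) \<partial>M.nu z) = (\<integral>\<^sup>+t. ennreal (1 / s\<^sup>2) * ennreal (t\<^sup>2) * indicator {..s} t \<partial>M.nu x)"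
        unfolding z_def by (subst nn_integral_cmult[symmetric], simp, subst M.nn_integral_nu_E, auto)
      also have "\<dots> \<le> (\<integral>\<^sup>+t. ennreal (?m s t) \<partial>M.nu x)"
      proof (rule nn_integral_mono_AE)
        show "AE t in M.nu x. ennreal (1 / s\<^sup>2) * ennreal (t\<^sup>2) * indicator {..s} t \<le> ennreal (?m s t)"
          using M.AE_nu_\<alpha>
        proof eventually_elim
          case (elim t)
          show ?case
          proof (cases "t \<le> s")
            case True
            hence "t\<^sup>2 \<le> s\<^sup>2" using elim M.\<alpha>_pos by (intro power_mono) auto
            hence "?m s t = 1 / s\<^sup>2 * t\<^sup>2" using s by (simp add: min_def)
            thus ?thesis using True by (simp add: ennreal_mult[symmetric])
          qed simp
        qed
      qed
      finally have zle: "(\<integral>\<^sup>+t. ennreal (?m s t) \<partial>A.nu z) \<le> ennreal k * (\<integral>\<^sup>+t. ennreal (?m s t) \<partial>M.nu x)"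
        by (simp add: mult_left_mono)
      have "(\<integral>\<^sup>+t. ennreal (?m s t) \<partial>A.nu (x - z)) \<le> (\<integral>\<^sup>+t. 1 \<partial>A.nu (x - z))"
        by (rule nn_integral_mono) simp
      also have "\<dots> = ennreal (A.ip (x - z) (x - z))" by (simp add: A.emeasure_nu_UNIV)
      also have "\<dots> \<le> ennreal (k * M.ip (x - z) (x - z))" by (intro ennreal_leI n0)
      also have "\<dots> = ennreal k * (\<integral>\<^sup>+t. 1 \<partial>M.nu (x - z))" by (simp add: M.emeasure_nu_UNIV ennreal_mult k)
      also have "(\<integral>\<^sup>+t. 1 \<partial>M.nu (x - z)) = (\<integral>\<^sup>+t. 1 * indicator {s<..} t \<partial>M.nu x)"
        unfolding z_def by (rule M.nn_integral_nu_E) simp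
      also have "\<dots> \<le> (\<integral>\<^sup>+t. ennreal (?m s t) \<partial>M.nu x)"
      proof (rule nn_integral_mono)
        fix t
        show "1 * indicator {s<..} t \<le> ennreal (?m s t)"
        proof (cases "s < t")
          case True
          hence "s\<^sup>2 \<le> t\<^sup>2" using s by (intro power_mono) auto
          thus ?thesis using True s by (simp add: min_def)
        qed simp
      qed
      finally have xle: "(\<integral>\<^sup>+t. ennreal (?m s t) \<partial>A.nu (x - z)) \<le> ennreal k * (\<integral>\<^sup>+t. ennreal (?m s t) \<partial>M.nu x)"
        by (simp add: mult_left_mono)
      have "(\<integral>\<^sup>+t. ennreal (?m s t) \<partial>A.nu (z + (x - z))) \<le>
          2 * (\<integral>\<^sup>+t. ennreal (?m s t) \<partial>A.nu z) + 2 * (\<integral>\<^sup>+t. ennreal (?m s t) \<partial>A.nu (x - z))"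
        by (rule A.nn_integral_nu_add) measurable
      also have "\<dots> \<le> 2 * (ennreal k * (\<integral>\<^sup>+t. ennreal (?m s t) \<partial>M.nu x)) + 2 * (ennreal k * (\<integral>\<^sup>+t. ennreal (?m s t) \<partial>M.nu x))"
        by (intro add_mono mult_left_mono zle xle) auto
      also have "\<dots> = ennreal (4 * k) * (\<integral>\<^sup>+t. ennreal (?m s t) \<partial>M.nu x)"
        using k by (simp add: ennreal_mult mult.assoc flip: distrib_right)
      finally show ?thesis by simp
    qed
    \<comment> \<open>The constant of \<open>kernel_integral\<close>, common to both operators; it
      cancels at the end.\<close>
    define \<kappa> where "\<kappa> = 1 / (2 * \<tau>) + 1 / (2 - 2 * \<tau>)"
    have \<kappa>: "\<kappa> > 0" using 3 by (simp add: \<kappa>_def add_pos_pos)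
    let ?k = "\<lambda>s t. ennreal (s powr (2 * \<tau> - 1) * ?m s t) * indicator {0<..} s"
    have fubini: "ennreal \<kappa> * (\<integral>\<^sup>+t. ennreal ((t powr \<tau>)\<^sup>2) \<partial>\<nu>) = (\<integral>\<^sup>+s. (\<integral>\<^sup>+t. ?k s t \<partial>\<nu>) \<partial>lborel)"
      if fin: "finite_measure \<nu>" and sets [measurable_cong]: "sets \<nu> = sets borel" and pos: "AE t in \<nu>. t > 0" for \<nu> :: "real measure"
    proof -
      interpret finite_measure \<nu> by fact
      interpret pair_sigma_finite lborel \<nu> ..
      have "ennreal \<kappa> * (\<integral>\<^sup>+t. ennreal ((t powr \<tau>)\<^sup>2) \<partial>\<nu>) = (\<integral>\<^sup>+t. ennreal \<kappa> * ennreal ((t powr \<tau>)\<^sup>2) \<partial>\<nu>)"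
        by (rule nn_integral_cmult[symmetric]) measurable
      also have "\<dots> = (\<integral>\<^sup>+t. (\<integral>\<^sup>+s. ?k s t \<partial>lborel) \<partial>\<nu>)"
      proof (rule nn_integral_cong_AE)
        show "AE t in \<nu>. ennreal \<kappa> * ennreal ((t powr \<tau>)\<^sup>2) = (\<integral>\<^sup>+s. ?k s t \<partial>lborel)"
          using pos
        proof eventually_elim
          case (elim t)
          have "ennreal \<kappa> * ennreal ((t powr \<tau>)\<^sup>2) = ennreal (\<kappa> * (t powr \<tau>)\<^sup>2)"
            using \<kappa> by (simp add: ennreal_mult)
          also have "\<dots> = (\<integral>\<^sup>+s. ?k s t \<partial>lborel)"
            unfolding \<kappa>_def by (rule kernel_integral[OF elim 3, symmetric])
          finally show ?case .
        qed
      qed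
      also have "\<dots> = (\<integral>\<^sup>+s. (\<integral>\<^sup>+t. ?k s t \<partial>\<nu>) \<partial>lborel)"
        by (rule Fubini') measurable
      finally show ?thesis .
    qed
    have "(\<integral>\<^sup>+t. ennreal ((t powr \<tau>)\<^sup>2) \<partial>A.nu x) \<le> ennreal (4 * k) * (\<integral>\<^sup>+t. ennreal ((t powr \<tau>)\<^sup>2) \<partial>M.nu x)" for x
    proof -
      have pull: "(\<integral>\<^sup>+t. ?k s t \<partial>\<nu>) = ennreal (s powr (2 * \<tau> - 1)) * indicator {0<..} s * (\<integral>\<^sup>+t. ennreal (?m s t) \<partial>\<nu>)"
        if [measurable_cong]: "sets \<nu> = sets borel" for s and \<nu> :: "real measure"
        by (subst nn_integral_cmult[symmetric]) (auto simp: ennreal_mult mult_ac intro!: nn_integral_cong)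
      have "AE t in A.nu x. t > 0" using A.AE_nu_\<alpha> by eventually_elim (use A.\<alpha>_pos in simp)
      hence "ennreal \<kappa> * (\<integral>\<^sup>+t. ennreal ((t powr \<tau>)\<^sup>2) \<partial>A.nu x) = (\<integral>\<^sup>+s. (\<integral>\<^sup>+t. ?k s t \<partial>A.nu x) \<partial>lborel)"
        by (intro fubini A.finite_nu) auto
      also have "\<dots> \<le> (\<integral>\<^sup>+s. ennreal (4 * k) * (\<integral>\<^sup>+t. ?k s t \<partial>M.nu x) \<partial>lborel)"
      proof (rule nn_integral_mono)
        fix s :: real
        show "(\<integral>\<^sup>+t. ?k s t \<partial>A.nu x) \<le> ennreal (4 * k) * (\<integral>\<^sup>+t. ?k s t \<partial>M.nu x)"
        proof (cases "s > 0")
          case True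
          have "ennreal (s powr (2 * \<tau> - 1)) * (\<integral>\<^sup>+t. ennreal (?m s t) \<partial>A.nu x) \<le>
              ennreal (s powr (2 * \<tau> - 1)) * (ennreal (4 * k) * (\<integral>\<^sup>+t. ennreal (?m s t) \<partial>M.nu x))"
            by (intro mult_left_mono trunc True) simp
          thus ?thesis using True unfolding pull[OF A.sets_nu] pull[OF M.sets_nu] by (simp add: mult_ac)
        qed simp
      qed
      also have "\<dots> = ennreal (4 * k) * (\<integral>\<^sup>+s. (\<integral>\<^sup>+t. ?k s t \<partial>M.nu x) \<partial>lborel)"
      proof (rule nn_integral_cmult)
        interpret sigma_finite_measure "M.nu x" using M.finite_nu by (simp add: finite_measure_def)
        show "(\<lambda>s. \<integral>\<^sup>+t. ?k s t \<partial>M.nu x) \<in> borel_measurable lborel" by measurable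
      qed
      also have "(\<integral>\<^sup>+s. (\<integral>\<^sup>+t. ?k s t \<partial>M.nu x) \<partial>lborel) = ennreal \<kappa> * (\<integral>\<^sup>+t. ennreal ((t powr \<tau>)\<^sup>2) \<partial>M.nu x)"
      proof (rule fubini[symmetric, OF M.finite_nu])
        show "AE t in M.nu x. t > 0" using M.AE_nu_\<alpha> by eventually_elim (use M.\<alpha>_pos in simp)
      qed simp
      finally have "ennreal \<kappa> * (\<integral>\<^sup>+t. ennreal ((t powr \<tau>)\<^sup>2) \<partial>A.nu x) \<le> ennreal \<kappa> * (ennreal (4 * k) * (\<integral>\<^sup>+t. ennreal ((t powr \<tau>)\<^sup>2) \<partial>M.nu x))"
        by (simp add: mult_ac)
      thus ?thesis using \<kappa> by (subst (asm) ennreal_mult_le_mult_iff) auto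
    qed
    thus ?thesis using k by (intro exI[of _ "4 * k"]) auto
  qed
qed

section \<open>The Rayleigh--Ritz method for a pair of forms\<close>

text \<open>Gaussian elimination of one unknown at a nonzero pivot \<open>M i p\<close>. It carries
  the dimension count for the trial space and both halves of the minimax argument.\<close>

lemma homogeneous_system:
  fixes M :: "'i \<Rightarrow> 'k \<Rightarrow> complex"
  assumes "finite I" "finite K" "card I < card K"
  shows "\<exists>c. (\<exists>k\<in>K. c k \<noteq> 0) \<and> (\<forall>i\<in>I. (\<Sum>k\<in>K. M i k * c k) = 0)"
  using assms
proof (induction I arbitrary: K M rule: finite_induct)
  case empty
  then obtain k where "k \<in> K" by fastforce
  thus ?case by (intro exI[of _ "\<lambda>_. 1"]) auto
next
  case (insert i I)
  show ?case
  proof (cases "\<forall>k\<in>K. M i k = 0")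
    case True
    have "card I < card K" using insert by simp
    from insert.IH[OF insert.prems(1) this, of M] obtain c where
      "\<exists>k\<in>K. c k \<noteq> 0" "\<forall>i\<in>I. (\<Sum>k\<in>K. M i k * c k) = 0" by blast
    thus ?thesis using True by (intro exI[of _ c]) auto
  next
    case False
    then obtain p where p: "p \<in> K" "M i p \<noteq> 0" by blast
    let ?K = "K - {p}" and ?M = "\<lambda>j k. M j k - M j p * M i k / M i p"
    have "finite ?K" "card I < card ?K" using insert p by auto
    from insert.IH[OF this, of ?M] obtain c where
      c: "\<exists>k\<in>?K. c k \<noteq> 0" "\<forall>j\<in>I. (\<Sum>k\<in>?K. ?M j k * c k) = 0" by blast
    define s where "s = (\<Sum>k\<in>?K. M i k * c k)"
    define d where "d = c(p := - s / M i p)"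
    have sum: "(\<Sum>k\<in>K. M j k * d k) = M j p * d p + (\<Sum>k\<in>?K. M j k * c k)" for j
    proof -
      have "(\<Sum>k\<in>K. M j k * d k) = M j p * d p + (\<Sum>k\<in>?K. M j k * d k)"
        by (rule sum.remove[OF insert.prems(1) p(1)])
      also have "(\<Sum>k\<in>?K. M j k * d k) = (\<Sum>k\<in>?K. M j k * c k)" by (rule sum.cong) (auto simp: d_def)
      finally show ?thesis .
    qed
    have "(\<Sum>k\<in>K. M j k * d k) = 0" if "j \<in> insert i I" for j
    proof (cases "j = i")
      case True
      thus ?thesis unfolding sum using p by (simp add: d_def s_def)
    next
      case False
      hence "(\<Sum>k\<in>?K. ?M j k * c k) = 0" using c(2) that by blast
      moreover have "?M j k * c k = M j k * c k - M j p / M i p * (M i k * c k)" for k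
        by (simp add: left_diff_distrib)
      ultimately have "0 = (\<Sum>k\<in>?K. M j k * c k - M j p / M i p * (M i k * c k))" by simp
      also have "\<dots> = (\<Sum>k\<in>?K. M j k * c k) - M j p / M i p * s"
        by (simp add: sum_subtractf s_def sum_distrib_left)
      finally show ?thesis unfolding sum by (simp add: d_def)
    qed
    moreover have "\<exists>k\<in>K. d k \<noteq> 0" using c(1) by (auto simp: d_def)
    ultimately show ?thesis by blast
  qed
qed

text \<open>The forms come from \<open>power_op\<close>, whose values are determined only on the
  domain of the power. All rules are therefore relative to the subspace \<open>U\<close>.\<close>

locale hermitian_form =
  fixes U :: "'a::complex_hilbert set" and a :: "'a \<Rightarrow> 'a \<Rightarrow> complex"
  assumes subspace: "csubspace U"
    and add_right: "x \<in> U \<Longrightarrow> y \<in> U \<Longrightarrow> z \<in> U \<Longrightarrow> a x (y + z) = a x y + a x z"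
    and scale_right: "x \<in> U \<Longrightarrow> y \<in> U \<Longrightarrow> a x (c *\<^sub>C y) = c * a x y"
    and herm: "x \<in> U \<Longrightarrow> y \<in> U \<Longrightarrow> a x y = cnj (a y x)"
    and nonneg: "x \<in> U \<Longrightarrow> 0 \<le> Re (a x x)"
begin

abbreviation q where "q x \<equiv> Re (a x x)"

lemmas U_add = complex_vector.subspace_add[OF subspace]
  and U_scale = complex_vector.subspace_scale[OF subspace]
  and U_diff = complex_vector.subspace_diff[OF subspace]
  and U_sum = complex_vector.subspace_sum[OF subspace]
  and U_0 = complex_vector.subspace_0[OF subspace]

lemma add_left: "x \<in> U \<Longrightarrow> y \<in> U \<Longrightarrow> z \<in> U \<Longrightarrow> a (x + y) z = a x z + a y z"
  by (metis herm add_right U_add complex_cnj_add)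

lemma scale_left: "x \<in> U \<Longrightarrow> y \<in> U \<Longrightarrow> a (c *\<^sub>C x) y = cnj c * a x y"
  by (metis herm scale_right U_scale complex_cnj_mult)

lemma zero_right: "x \<in> U \<Longrightarrow> a x 0 = 0"
  using scale_right[of x 0 0] U_0 by simp

lemma zero_left: "x \<in> U \<Longrightarrow> a 0 x = 0"
  using scale_left[of 0 x 0] U_0 by simp

lemma diff_right: "x \<in> U \<Longrightarrow> y \<in> U \<Longrightarrow> z \<in> U \<Longrightarrow> a x (y - z) = a x y - a x z"
  using add_right[of x "y - z" z] U_diff[of y z] by simp

lemma diff_left: "x \<in> U \<Longrightarrow> y \<in> U \<Longrightarrow> z \<in> U \<Longrightarrow> a (x - y) z = a x z - a y z"
  using add_left[of "x - y" y z] U_diff[of x y] by simp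

lemma sum_right: "x \<in> U \<Longrightarrow> (\<And>k. k \<in> K \<Longrightarrow> F k \<in> U) \<Longrightarrow> a x (\<Sum>k\<in>K. c k *\<^sub>C F k) = (\<Sum>k\<in>K. c k * a x (F k))"
  by (induction K rule: infinite_finite_induct)
    (simp_all add: zero_right add_right scale_right U_scale U_sum)

lemma sum_left: "x \<in> U \<Longrightarrow> (\<And>k. k \<in> K \<Longrightarrow> F k \<in> U) \<Longrightarrow> a (\<Sum>k\<in>K. c k *\<^sub>C F k) x = (\<Sum>k\<in>K. cnj (c k) * a (F k) x)"
  by (induction K rule: infinite_finite_induct)
    (simp_all add: zero_left add_left scale_left U_scale U_sum)

lemma self: "x \<in> U \<Longrightarrow> a x x = complex_of_real (q x)"
  using herm[of x x] by (simp add: complex_eq_iff)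

lemma q_scale: "x \<in> U \<Longrightarrow> q (c *\<^sub>C x) = (cmod c)\<^sup>2 * q x"
proof -
  assume x: "x \<in> U"
  have "a (c *\<^sub>C x) (c *\<^sub>C x) = (c * cnj c) * a x x"
    using x by (simp add: scale_left scale_right U_scale)
  thus ?thesis by (simp only: complex_norm_square[symmetric] Re_complex_of_real) simp
qed

lemma q_add: "x \<in> U \<Longrightarrow> y \<in> U \<Longrightarrow> q (x + y) = q x + 2 * Re (a x y) + q y"
  using herm[of y x] by (simp add: add_left add_right U_add)

lemma q_diff: "x \<in> U \<Longrightarrow> y \<in> U \<Longrightarrow> q (x - y) = q x - 2 * Re (a x y) + q y"
  using herm[of y x] by (simp add: diff_left diff_right U_diff)

lemma q_add_le: "x \<in> U \<Longrightarrow> y \<in> U \<Longrightarrow> q (x + y) \<le> 2 * q x + 2 * q y"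
  using nonneg[OF U_diff[of x y]] by (simp add: q_add q_diff)

lemma CS: 
  assumes xy: "x \<in> U" "y \<in> U"
  shows "(cmod (a x y))\<^sup>2 \<le> q x * q y"
proof (cases "a x y = 0")
  case True
  thus ?thesis using nonneg xy by simp
next
  case False
  define B where "B = cmod (a x y)"
  have B: "B > 0" using False by (simp add: B_def)
  \<comment> \<open>A unimodular factor rotates \<open>y\<close> so that the form of
    \<open>x\<close> and the rotated vector is the positive number \<open>B\<close>; the real
    quadratic in \<open>s\<close> then sees the full modulus.\<close>
  define w where "w = cnj (a x y) / complex_of_real B"
  have w: "cmod w = 1" using B by (simp add: w_def B_def norm_divide)
  have aw: "a x (w *\<^sub>C y) = complex_of_real B"
  proof -
    have "a x (w *\<^sub>C y) = a x y * cnj (a x y) / complex_of_real B"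
      using xy by (simp add: scale_right w_def mult.commute)
    also have "a x y * cnj (a x y) = complex_of_real (B\<^sup>2)" by (simp only: complex_norm_square B_def)
    finally show ?thesis using B by (simp add: power2_eq_square)
  qed
  have quad: "0 \<le> q x - 2 * s * B + s\<^sup>2 * q y" for s
  proof -
    let ?z = "complex_of_real s *\<^sub>C (w *\<^sub>C y)"
    have z: "w *\<^sub>C y \<in> U" "?z \<in> U" by (intro U_scale xy)+
    have "0 \<le> q (x - ?z)" by (intro nonneg U_diff z xy)
    also have "q (x - ?z) = q x - 2 * Re (a x ?z) + q ?z" by (rule q_diff[OF xy(1) z(2)])
    also have "a x ?z = complex_of_real (s * B)" unfolding scale_right[OF xy(1) z(1)] aw by simp
    also have "q ?z = s\<^sup>2 * q y" by (simp only: q_scale[OF z(1)] q_scale[OF xy(2)] w) simp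
    finally show ?thesis by simp
  qed
  have "B\<^sup>2 \<le> q x * q y"
    by (rule quadratic_nonneg_discriminant[OF _ _ quad]) (intro nonneg xy)+
  thus ?thesis by (simp add: B_def)
qed

end

text \<open>Coefficient families are the shape in which the pencil provides the Ritz vectors, and
  they are the data for dimension counts, whether or not the \<open>p m\<close> are
  independent.\<close>

definition lin_combs :: "(nat \<Rightarrow> 'a::complex_hilbert) \<Rightarrow> nat \<Rightarrow> 'a set" where
  "lin_combs p n = {\<Sum>m=1..n. d m *\<^sub>C p m | d. True}"

lemma lin_combs_subspace: "csubspace (lin_combs p n)"
proof (rule complex_vector.subspaceI)
  show "0 \<in> lin_combs p n" unfolding lin_combs_def by (auto intro!: exI[of _ "\<lambda>_. 0"])
next
  fix x y assume "x \<in> lin_combs p n" "y \<in> lin_combs p n"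
  then obtain d e where "x = (\<Sum>m=1..n. d m *\<^sub>C p m)" "y = (\<Sum>m=1..n. e m *\<^sub>C p m)" by (auto simp: lin_combs_def)
  hence "x + y = (\<Sum>m=1..n. (d m + e m) *\<^sub>C p m)" by (simp add: sum.distrib complex_vector.scale_left_distrib)
  thus "x + y \<in> lin_combs p n" unfolding lin_combs_def by (auto intro!: exI[of _ "\<lambda>m. d m + e m"])
next
  fix c x assume "x \<in> lin_combs p n"
  then obtain d where "x = (\<Sum>m=1..n. d m *\<^sub>C p m)" by (auto simp: lin_combs_def)
  hence "c *\<^sub>C x = (\<Sum>m=1..n. (c * d m) *\<^sub>C p m)" by (simp add: complex_vector.scale_sum_right)
  thus "c *\<^sub>C x \<in> lin_combs p n" unfolding lin_combs_def by (auto intro!: exI[of _ "\<lambda>m. c * d m"])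
qed

section \<open>Ritz values, Ritz vectors and the Ritz projection\<close>

locale ritz = a: hermitian_form U a + b: hermitian_form U b
  for U :: "'a::complex_hilbert set" and a b +
  fixes Cb :: real and p :: "nat \<Rightarrow> 'a" and n :: nat and L :: "nat \<Rightarrow> real" and v :: "nat \<Rightarrow> 'a"
  assumes Cb: "Cb > 0" "\<And>x. x \<in> U \<Longrightarrow> b.q x \<le> Cb * a.q x"
    and p_in: "\<And>m. m \<in> {1..n} \<Longrightarrow> p m \<in> U"
    and v_in: "\<And>i. i \<in> {1..n} \<Longrightarrow> v i \<in> lin_combs p n"
    and v_b: "\<And>i j. i \<in> {1..n} \<Longrightarrow> j \<in> {1..n} \<Longrightarrow> b (v i) (v j) = (if i = j then 1 else 0)"
    and v_a: "\<And>i j. i \<in> {1..n} \<Longrightarrow> j \<in> {1..n} \<Longrightarrow> a (v i) (v j) = (if i = j then complex_of_real (L i) else 0)"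
    and L_mono: "mono_on {1..n} L"
begin

abbreviation V where "V \<equiv> lin_combs p n"

lemma V_U: "x \<in> V \<Longrightarrow> x \<in> U"
  unfolding lin_combs_def using p_in by (auto intro!: a.U_sum a.U_scale)

lemmas v_U = V_U[OF v_in]

text \<open>A \<open>b\<close>-orthonormal system of \<open>n\<close> vectors in the span of
  \<open>n\<close> vectors exhausts it. The count is a homogeneous system with \<open>n + 1\<close>
  unknowns, index 0 belonging to \<open>x\<close>, and one equation for each \<open>p m\<close>.
  Testing the relation with \<open>v j\<close> shows that the coefficient of \<open>x\<close> is
  nonzero and determines the others.\<close>

lemma expansion:
  assumes x: "x \<in> V"
  shows "x = (\<Sum>k=1..n. b (v k) x *\<^sub>C v k)"
proof -
  from x obtain d where d: "x = (\<Sum>m=1..n. d m *\<^sub>C p m)" by (auto simp: lin_combs_def)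
  from v_in have "\<forall>i\<in>{1..n}. \<exists>c. v i = (\<Sum>m=1..n. c m *\<^sub>C p m)" by (auto simp: lin_combs_def)
  then obtain c where c: "\<And>i. i \<in> {1..n} \<Longrightarrow> v i = (\<Sum>m=1..n. c i m *\<^sub>C p m)" by metis
  let ?M = "\<lambda>m k. if k = 0 then d m else c k m"
  have "\<exists>e. (\<exists>k\<in>{0..n}. e k \<noteq> 0) \<and> (\<forall>m\<in>{1..n}. (\<Sum>k\<in>{0..n}. ?M m k * e k) = 0)"
    by (rule homogeneous_system) auto
  then obtain e where e: "\<exists>k\<in>{0..n}. e k \<noteq> 0" "\<And>m. m \<in> {1..n} \<Longrightarrow> (\<Sum>k\<in>{0..n}. ?M m k * e k) = 0" by blast
  have split: "(\<Sum>k\<in>{0..n}. f k) = f 0 + (\<Sum>k=1..n. f k)" for f :: "nat \<Rightarrow> 'b::comm_monoid_add"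
    by (simp add: sum.atLeast_Suc_atMost)
  have "e 0 *\<^sub>C x + (\<Sum>k=1..n. e k *\<^sub>C v k) = (\<Sum>m=1..n. (e 0 * d m) *\<^sub>C p m) + (\<Sum>k=1..n. \<Sum>m=1..n. (e k * c k m) *\<^sub>C p m)"
    unfolding d by (simp add: c complex_vector.scale_sum_right)
  also have "\<dots> = (\<Sum>m=1..n. (e 0 * d m + (\<Sum>k=1..n. e k * c k m)) *\<^sub>C p m)"
    by (subst sum.swap) (simp add: complex_vector.scale_left_distrib sum.distrib complex_vector.scale_sum_left)
  also have "\<dots> = 0"
  proof (rule sum.neutral, intro ballI)
    fix m assume m: "m \<in> {1..n}"
    have "(\<Sum>k=1..n. ?M m k * e k) = (\<Sum>k=1..n. e k * c k m)" by (rule sum.cong) (auto simp: mult.commute)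
    hence "e 0 * d m + (\<Sum>k=1..n. e k * c k m) = 0"
      using e(2)[OF m] unfolding split by (simp add: mult.commute)
    thus "(e 0 * d m + (\<Sum>k=1..n. e k * c k m)) *\<^sub>C p m = 0" by simp
  qed
  finally have rel: "e 0 *\<^sub>C x + (\<Sum>k=1..n. e k *\<^sub>C v k) = 0" .
  have coef: "e 0 * b (v j) x + e j = 0" if j: "j \<in> {1..n}" for j
  proof -
    have "(\<Sum>k=1..n. e k *\<^sub>C v k) \<in> U" by (intro b.U_sum b.U_scale v_U)
    hence "b (v j) (e 0 *\<^sub>C x + (\<Sum>k=1..n. e k *\<^sub>C v k)) = b (v j) (e 0 *\<^sub>C x) + b (v j) (\<Sum>k=1..n. e k *\<^sub>C v k)"
      by (intro b.add_right v_U[OF j] b.U_scale V_U[OF x])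
    also have "b (v j) (e 0 *\<^sub>C x) = e 0 * b (v j) x" by (intro b.scale_right v_U[OF j] V_U[OF x])
    also have "b (v j) (\<Sum>k=1..n. e k *\<^sub>C v k) = (\<Sum>k=1..n. e k * b (v j) (v k))"
      by (intro b.sum_right v_U[OF j] v_U)
    also have "(\<Sum>k=1..n. e k * b (v j) (v k)) = (\<Sum>k=1..n. if k = j then e j else 0)"
      by (rule sum.cong) (use j v_b in auto)
    also have "\<dots> = e j" using j by simp
    finally show ?thesis unfolding rel using b.zero_right[OF v_U[OF j]] by simp
  qed
  have e0: "e 0 \<noteq> 0"
  proof
    assume z: "e 0 = 0"
    from e(1) obtain k where "k \<in> {0..n}" "e k \<noteq> 0" by blast
    thus False using coef[of k] z by (cases "k = 0") auto
  qed
  have "e 0 *\<^sub>C x = - (\<Sum>k=1..n. e k *\<^sub>C v k)" using rel by (simp add: eq_neg_iff_add_eq_0)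
  also have "\<dots> = (\<Sum>k=1..n. (e 0 * b (v k) x) *\<^sub>C v k)"
  proof -
    have "- (e k *\<^sub>C v k) = (e 0 * b (v k) x) *\<^sub>C v k" if "k \<in> {1..n}" for k
    proof -
      have "e 0 * b (v k) x = - e k" using coef[OF that] by (simp add: eq_neg_iff_add_eq_0)
      thus ?thesis by simp
    qed
    thus ?thesis by (simp add: sum_negf[symmetric])
  qed
  also have "\<dots> = e 0 *\<^sub>C (\<Sum>k=1..n. b (v k) x *\<^sub>C v k)" by (simp add: complex_vector.scale_sum_right)
  finally show ?thesis using e0 by (simp add: complex_vector.scale_cancel_left)
qed

text \<open>The Galerkin equation of a Ritz vector, tested against the whole trial space. It follows
  by expanding \<open>x\<close> in the \<open>v k\<close>, where both forms are diagonal.\<close>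

lemma a_v:
  assumes x: "x \<in> V" and j: "j \<in> {1..n}"
  shows "a x (v j) = complex_of_real (L j) * b x (v j)"
proof -
  have "a x (v j) = (\<Sum>k=1..n. cnj (b (v k) x) * a (v k) (v j))"
    by (subst expansion[OF x], subst a.sum_left) (use v_U j in auto)
  also have "\<dots> = (\<Sum>k=1..n. if k = j then cnj (b (v j) x) * complex_of_real (L j) else 0)"
    by (rule sum.cong) (use v_a j in auto)
  also have "\<dots> = complex_of_real (L j) * cnj (b (v j) x)" using j by simp
  also have "cnj (b (v j) x) = b x (v j)" using b.herm[OF V_U[OF x] v_U[OF j]] by simp
  finally show ?thesis .
qed

lemma q_expansion:
  assumes K: "K \<subseteq> {1..n}"
  shows "a.q (\<Sum>k\<in>K. c k *\<^sub>C v k) = (\<Sum>k\<in>K. L k * (cmod (c k))\<^sup>2)"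
    and "b.q (\<Sum>k\<in>K. c k *\<^sub>C v k) = (\<Sum>k\<in>K. (cmod (c k))\<^sup>2)"
proof -
  have fin: "finite K" using K finite_subset by blast
  have U: "\<And>k. k \<in> K \<Longrightarrow> v k \<in> U" using K v_U by blast
  have va: "a (v i) (v k) = (if i = k then complex_of_real (L i) else 0)"
    and vb: "b (v i) (v k) = (if i = k then 1 else 0)" if "i \<in> K" "k \<in> K" for i k
    using v_a[of i k] v_b[of i k] that K by blast+
  have sq: "Re (cnj z * (z * complex_of_real r)) = r * (cmod z)\<^sup>2" for z r
  proof -
    have "cnj z * (z * complex_of_real r) = z * cnj z * complex_of_real r" by simp
    also have "\<dots> = complex_of_real ((cmod z)\<^sup>2 * r)" by (simp only: complex_norm_square[symmetric] of_real_mult)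
    finally have eq: "cnj z * (z * complex_of_real r) = complex_of_real ((cmod z)\<^sup>2 * r)" .
    show ?thesis unfolding eq Re_complex_of_real by (rule mult.commute)
  qed
  have "a (\<Sum>k\<in>K. c k *\<^sub>C v k) (\<Sum>k\<in>K. c k *\<^sub>C v k) = (\<Sum>k\<in>K. cnj (c k) * (\<Sum>i\<in>K. c i * a (v k) (v i)))"
  proof (subst a.sum_left)
    show "(\<Sum>k\<in>K. cnj (c k) * a (v k) (\<Sum>k\<in>K. c k *\<^sub>C v k)) = (\<Sum>k\<in>K. cnj (c k) * (\<Sum>i\<in>K. c i * a (v k) (v i)))"
      by (rule sum.cong) (simp_all add: a.sum_right U)
  qed (simp_all add: U a.U_sum a.U_scale)
  also have "\<dots> = (\<Sum>k\<in>K. cnj (c k) * (c k * complex_of_real (L k)))"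
  proof (rule sum.cong[OF refl])
    fix k assume k: "k \<in> K"
    have "(\<Sum>i\<in>K. c i * a (v k) (v i)) = (\<Sum>i\<in>K. if i = k then c k * complex_of_real (L k) else 0)"
      by (rule sum.cong) (use va k in auto)
    thus "cnj (c k) * (\<Sum>i\<in>K. c i * a (v k) (v i)) = cnj (c k) * (c k * complex_of_real (L k))"
      using k fin by simp
  qed
  finally show "a.q (\<Sum>k\<in>K. c k *\<^sub>C v k) = (\<Sum>k\<in>K. L k * (cmod (c k))\<^sup>2)" by (simp only: Re_sum sq)
  have "b (\<Sum>k\<in>K. c k *\<^sub>C v k) (\<Sum>k\<in>K. c k *\<^sub>C v k) = (\<Sum>k\<in>K. cnj (c k) * (\<Sum>i\<in>K. c i * b (v k) (v i)))"
  proof (subst b.sum_left)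
    show "(\<Sum>k\<in>K. cnj (c k) * b (v k) (\<Sum>k\<in>K. c k *\<^sub>C v k)) = (\<Sum>k\<in>K. cnj (c k) * (\<Sum>i\<in>K. c i * b (v k) (v i)))"
      by (rule sum.cong) (simp_all add: b.sum_right U)
  qed (simp_all add: U b.U_sum b.U_scale)
  also have "\<dots> = (\<Sum>k\<in>K. cnj (c k) * (c k * complex_of_real 1))"
  proof (rule sum.cong[OF refl])
    fix k assume k: "k \<in> K"
    have "(\<Sum>i\<in>K. c i * b (v k) (v i)) = (\<Sum>i\<in>K. if i = k then c k else 0)"
      by (rule sum.cong) (use vb k in auto)
    thus "cnj (c k) * (\<Sum>i\<in>K. c i * b (v k) (v i)) = cnj (c k) * (c k * complex_of_real 1)"
      using k fin by simp
  qed
  finally show "b.q (\<Sum>k\<in>K. c k *\<^sub>C v k) = (\<Sum>k\<in>K. (cmod (c k))\<^sup>2)" by (simp only: Re_sum sq) simp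
qed

lemma L_pos: "k \<in> {1..n} \<Longrightarrow> L k > 0"
proof -
  assume k: "k \<in> {1..n}"
  have "b.q (v k) = 1" "a.q (v k) = L k" using v_b[OF k k] v_a[OF k k] by simp_all
  hence "1 \<le> Cb * L k" using Cb(2)[OF v_U[OF k]] by simp
  thus ?thesis using Cb(1) by (metis less_le_trans zero_less_mult_pos zero_less_one)
qed

text \<open>The vectors \<open>v k\<close> divided by \<open>sqrt (L k)\<close> are
  \<open>a\<close>-orthonormal and span \<open>V\<close>, so this is the \<open>a\<close>-orthogonal
  projection onto the trial space.\<close>

definition ritz_proj :: "'a \<Rightarrow> 'a" where
  "ritz_proj u = (\<Sum>k=1..n. (a (v k) u / complex_of_real (L k)) *\<^sub>C v k)"

lemma ritz_proj_V: "ritz_proj u \<in> V"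
  unfolding ritz_proj_def
  by (intro complex_vector.subspace_sum[OF lin_combs_subspace] complex_vector.subspace_scale[OF lin_combs_subspace] v_in)

lemma ritz_proj_orth:
  assumes u: "u \<in> U" and x: "x \<in> V"
  shows "a x (u - ritz_proj u) = 0"
proof -
  have vk: "a (v k) (u - ritz_proj u) = 0" if k: "k \<in> {1..n}" for k
  proof -
    have "a (v k) (ritz_proj u) = (\<Sum>i=1..n. (a (v i) u / complex_of_real (L i)) * a (v k) (v i))"
      unfolding ritz_proj_def by (rule a.sum_right) (use v_U k in auto)
    also have "\<dots> = (\<Sum>i=1..n. if i = k then a (v k) u else 0)"
      by (rule sum.cong) (use v_a k L_pos[OF k] in auto)
    also have "\<dots> = a (v k) u" using k by simp
    finally show ?thesis using u v_U[OF k] V_U[OF ritz_proj_V] by (simp add: a.diff_right)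
  qed
  have "a x (u - ritz_proj u) = (\<Sum>k=1..n. cnj (b (v k) x) * a (v k) (u - ritz_proj u))"
    by (subst expansion[OF x], rule a.sum_left) (use v_U u V_U[OF ritz_proj_V] a.U_diff in auto)
  thus ?thesis by (simp add: vk)
qed

lemma ritz_proj_best:
  assumes u: "u \<in> U" and y: "y \<in> V"
  shows "a.q (u - ritz_proj u) \<le> a.q (u - y)"
proof -
  note rU = V_U[OF ritz_proj_V[of u]]
  have d: "ritz_proj u - y \<in> V" by (intro complex_vector.subspace_diff[OF lin_combs_subspace] ritz_proj_V y)
  have "a (u - ritz_proj u) (ritz_proj u - y) = 0"
    using ritz_proj_orth[OF u d] a.herm[of "u - ritz_proj u" "ritz_proj u - y"] V_U[OF d] a.U_diff[OF u rU] by simp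
  hence "a.q ((u - ritz_proj u) + (ritz_proj u - y)) = a.q (u - ritz_proj u) + a.q (ritz_proj u - y)"
    using a.q_add[OF a.U_diff[OF u rU] V_U[OF d]] by simp
  thus ?thesis using a.nonneg[OF V_U[OF d]] by simp
qed

end

text \<open>The exact problem enters through weak eigenvalue equations, the variational bound
  \<open>lower\<close>, and \<open>\<delta>\<close>, which bounds the squared
  \<open>a\<close>-distances of the eigenvectors from the trial space. No compactness is involved,
  so eigenvalues below an essential spectrum are covered.\<close>

locale ritz_eigen = ritz +
  fixes l :: nat and lam :: "nat \<Rightarrow> real" and u :: "nat \<Rightarrow> 'a" and \<delta> :: real
  assumes u_U: "\<And>i. i \<in> {1..l} \<Longrightarrow> u i \<in> U"
    and u_eigen: "\<And>i x. i \<in> {1..l} \<Longrightarrow> x \<in> U \<Longrightarrow> a (u i) x = complex_of_real (lam i) * b (u i) x"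
    and u_b: "\<And>i k. i \<in> {1..l} \<Longrightarrow> k \<in> {1..l} \<Longrightarrow> b (u i) (u k) = (if i = k then 1 else 0)"
    and lam_pos: "\<And>i. i \<in> {1..l} \<Longrightarrow> lam i > 0"
    and lam_mono: "\<And>i k. i \<in> {1..l} \<Longrightarrow> k \<in> {1..l} \<Longrightarrow> i \<le> k \<Longrightarrow> lam i \<le> lam k"
    and lower: "\<And>j x. j \<in> {1..l} \<Longrightarrow> x \<in> U \<Longrightarrow> (\<And>i. i \<in> {1..<j} \<Longrightarrow> b (u i) x = 0) \<Longrightarrow> lam j * b.q x \<le> a.q x"
    and l_n: "l \<le> n"
    and \<delta>: "\<And>i. i \<in> {1..l} \<Longrightarrow> \<exists>y\<in>V. a.q (u i - y) \<le> \<delta>"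
begin

abbreviation e where "e i \<equiv> u i - ritz_proj (u i)"

lemma e_U: "i \<in> {1..l} \<Longrightarrow> e i \<in> U"
  by (intro a.U_diff u_U V_U[OF ritz_proj_V])

lemma e_le: "i \<in> {1..l} \<Longrightarrow> a.q (e i) \<le> \<delta>"
  using \<delta>[of i] ritz_proj_best[OF u_U[of i]] by force

text \<open>Some nonzero combination of \<open>v 1, ..., v j\<close> is \<open>b\<close>-orthogonal
  to \<open>u 1, ..., u (j-1)\<close>. Its Rayleigh quotient is at most \<open>L j\<close>, both
  forms being diagonal, and at least \<open>lam j\<close> by \<open>lower\<close>.\<close>

lemma eigenvalue_lower:
  assumes j: "j \<in> {1..l}"
  shows "lam j \<le> L j"
proof -
  have jn: "{1..j} \<subseteq> {1..n}" "j \<in> {1..n}" using j l_n by auto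
  have "\<exists>c. (\<exists>k\<in>{1..j}. c k \<noteq> 0) \<and> (\<forall>i\<in>{1..<j}. (\<Sum>k\<in>{1..j}. b (u i) (v k) * c k) = 0)"
    by (rule homogeneous_system) (use j in auto)
  then obtain c where c: "\<exists>k\<in>{1..j}. c k \<noteq> 0" "\<And>i. i \<in> {1..<j} \<Longrightarrow> (\<Sum>k\<in>{1..j}. b (u i) (v k) * c k) = 0" by blast
  define x where "x = (\<Sum>k\<in>{1..j}. c k *\<^sub>C v k)"
  have vU: "\<And>k. k \<in> {1..j} \<Longrightarrow> v k \<in> U" using jn v_U by blast
  have xU: "x \<in> U" unfolding x_def by (intro a.U_sum a.U_scale vU)
  have "b (u i) x = 0" if i: "i \<in> {1..<j}" for i
  proof -
    have "b (u i) x = (\<Sum>k\<in>{1..j}. c k * b (u i) (v k))"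
      unfolding x_def by (rule b.sum_right) (use u_U vU i j in auto)
    thus ?thesis using c(2)[OF i] by (simp add: mult.commute)
  qed
  from lower[OF j xU this] have le: "lam j * b.q x \<le> a.q x" .
  define s where "s = (\<Sum>k\<in>{1..j}. (cmod (c k))\<^sup>2)"
  have s: "s > 0"
  proof -
    from c(1) obtain k where "k \<in> {1..j}" "c k \<noteq> 0" by blast
    thus ?thesis unfolding s_def by (intro sum_pos2[of _ k]) auto
  qed
  have "lam j * s \<le> (\<Sum>k\<in>{1..j}. L k * (cmod (c k))\<^sup>2)"
    using le unfolding x_def q_expansion[OF jn(1)] s_def .
  also have "\<dots> \<le> (\<Sum>k\<in>{1..j}. L j * (cmod (c k))\<^sup>2)"
    using L_mono jn by (intro sum_mono mult_right_mono) (auto simp: mono_on_def)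
  also have "\<dots> = L j * s" by (simp add: s_def sum_distrib_left)
  finally show ?thesis using s by simp
qed

text \<open>Some combination \<open>x\<close> of the projections of \<open>u 1, ..., u j\<close>,
  with coefficients not all zero, is \<open>b\<close>-orthogonal to
  \<open>v 1, ..., v (j-1)\<close>, so \<open>L j * b.q x <= a.q x\<close>. For the same combination
  \<open>w\<close> of the \<open>u i\<close>, projecting lowers \<open>a.q\<close>, hence
  \<open>a.q x <= lam j * b.q w\<close>, and \<open>b.q x\<close> falls short of
  \<open>b.q w\<close> by at most \<open>2 * Re (b w r)\<close>, which is quadratic in the errors.
  The constant counts at most \<open>l ^ 2\<close> products, each at most
  \<open>s * \<delta> / lam 1\<close>. The factor stays on the left because its sign is unknown
  until \<open>\<delta>\<close> is small.\<close>

lemma eigenvalue_upper: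
  assumes j: "j \<in> {1..l}"
  shows "L j * (1 - 2 * real l ^ 2 / lam 1 * \<delta>) \<le> lam j"
proof -
  have jl: "{1..j} \<subseteq> {1..l}" and jn: "j \<in> {1..n}" using j l_n by auto
  have one: "1 \<in> {1..l}" using j by auto
  have \<delta>0: "\<delta> \<ge> 0" using a.nonneg[OF e_U[OF j]] e_le[OF j] by linarith
  have "\<exists>c. (\<exists>i\<in>{1..j}. c i \<noteq> 0) \<and> (\<forall>k\<in>{1..<j}. (\<Sum>i\<in>{1..j}. b (v k) (ritz_proj (u i)) * c i) = 0)"
    by (rule homogeneous_system) (use j in auto)
  then obtain c where c: "\<exists>k\<in>{1..j}. c k \<noteq> 0" "\<And>k. k \<in> {1..<j} \<Longrightarrow> (\<Sum>i\<in>{1..j}. b (v k) (ritz_proj (u i)) * c i) = 0" by blast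
  define s where "s = (\<Sum>i\<in>{1..j}. (cmod (c i))\<^sup>2)"
  have s: "s > 0"
  proof -
    from c(1) obtain k where "k \<in> {1..j}" "c k \<noteq> 0" by blast
    thus ?thesis unfolding s_def by (intro sum_pos2[of _ k]) auto
  qed
  define w x r where "w = (\<Sum>i\<in>{1..j}. c i *\<^sub>C u i)" and "x = (\<Sum>i\<in>{1..j}. c i *\<^sub>C ritz_proj (u i))"
    and "r = (\<Sum>i\<in>{1..j}. c i *\<^sub>C e i)"
  have uU: "\<And>i. i \<in> {1..j} \<Longrightarrow> u i \<in> U" "\<And>i. i \<in> {1..j} \<Longrightarrow> e i \<in> U" using u_U e_U jl by blast+
  have xV: "x \<in> V" unfolding x_def
    by (intro complex_vector.subspace_sum[OF lin_combs_subspace] complex_vector.subspace_scale[OF lin_combs_subspace] ritz_proj_V)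
  have U: "w \<in> U" "x \<in> U" "r \<in> U"
    unfolding w_def r_def using V_U[OF xV] by (auto intro!: a.U_sum a.U_scale uU)
  have wxr: "w = x + r"
    unfolding w_def x_def r_def sum.distrib[symmetric] complex_vector.scale_right_distrib[symmetric] by simp
  have axr: "a x r = 0"
    unfolding r_def by (subst a.sum_right) (use U(2) uU ritz_proj_orth[OF _ xV] in auto)
  have ax_le: "a.q x \<le> a.q w"
    using a.q_add[OF U(2,3)] a.nonneg[OF U(3)] by (simp add: wxr axr)
  have aw: "a (u i) w = complex_of_real (lam i) * b (u i) w" if "i \<in> {1..j}" for i
    using u_eigen that jl U by blast
  have buw: "b (u i) w = c i" if i: "i \<in> {1..j}" for i
  proof -
    have "b (u i) w = (\<Sum>k\<in>{1..j}. c k * b (u i) (u k))"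
      unfolding w_def by (rule b.sum_right) (use uU i in auto)
    also have "\<dots> = (\<Sum>k\<in>{1..j}. if k = i then c i else 0)"
      by (rule sum.cong) (use u_b i jl in auto)
    finally show ?thesis using i by simp
  qed
  have sq: "cnj z * z = complex_of_real ((cmod z)\<^sup>2)" for z
    by (simp only: complex_norm_square mult.commute)
  have bw: "b.q w = s"
  proof -
    have "b w w = (\<Sum>i\<in>{1..j}. cnj (c i) * b (u i) w)"
      by (subst (1) w_def) (rule b.sum_left, use uU U in auto)
    also have "\<dots> = complex_of_real s" unfolding s_def of_real_sum by (rule sum.cong) (simp_all only: buw sq)
    finally show ?thesis by simp
  qed
  have "a.q w \<le> lam j * s"
  proof -
    have "a w w = (\<Sum>i\<in>{1..j}. cnj (c i) * a (u i) w)"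
      by (subst (1) w_def) (rule a.sum_left, use uU U in auto)
    also have "\<dots> = (\<Sum>i\<in>{1..j}. complex_of_real (lam i * (cmod (c i))\<^sup>2))"
    proof (rule sum.cong[OF refl])
      fix i assume i: "i \<in> {1..j}"
      have "cnj (c i) * a (u i) w = complex_of_real (lam i) * (cnj (c i) * c i)" by (simp add: aw[OF i] buw[OF i])
      thus "cnj (c i) * a (u i) w = complex_of_real (lam i * (cmod (c i))\<^sup>2)" by (simp only: sq of_real_mult)
    qed
    finally have "a.q w = (\<Sum>i\<in>{1..j}. lam i * (cmod (c i))\<^sup>2)" by (simp add: Re_sum)
    also have "\<dots> \<le> (\<Sum>i\<in>{1..j}. lam j * (cmod (c i))\<^sup>2)"
      using lam_mono jl j by (intro sum_mono mult_right_mono) auto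
    finally show ?thesis by (simp add: s_def sum_distrib_left)
  qed
  with ax_le have ax: "a.q x \<le> lam j * s" by linarith
  have ee: "cmod (a (e i) (e k)) \<le> \<delta>" if "i \<in> {1..j}" "k \<in> {1..j}" for i k
  proof (rule power2_le_imp_le[OF _ \<delta>0])
    have ik: "i \<in> {1..l}" "k \<in> {1..l}" using that jl by auto
    have "(cmod (a (e i) (e k)))\<^sup>2 \<le> a.q (e i) * a.q (e k)" by (intro a.CS uU that)
    also have "\<dots> \<le> \<delta> * \<delta>" by (intro mult_mono e_le ik \<delta>0 a.nonneg uU that)
    finally show "(cmod (a (e i) (e k)))\<^sup>2 \<le> \<delta>\<^sup>2" by (simp add: power2_eq_square)
  qed
  have cc: "cmod (c i) * cmod (c k) \<le> s" if "i \<in> {1..j}" "k \<in> {1..j}" for i k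
  proof -
    have le: "(cmod (c i))\<^sup>2 \<le> s" if "i \<in> {1..j}" for i
      unfolding s_def by (rule member_le_sum) (use that in auto)
    have "0 \<le> (cmod (c i) - cmod (c k))\<^sup>2" by simp
    thus ?thesis using le[OF that(1)] le[OF that(2)] by (simp add: power2_diff)
  qed
  \<comment> \<open>The eigenvalue equation turns \<open>b (u i) r\<close> into
    \<open>a (u i) r / lam i\<close>, and \<open>a\<close>-orthogonality of \<open>r\<close> to the
    trial space leaves only the error \<open>e i\<close> of the first argument.\<close>
  have "b w r = (\<Sum>i\<in>{1..j}. \<Sum>k\<in>{1..j}. cnj (c i) * c k * a (e i) (e k) / complex_of_real (lam i))"
  proof -
    have "b w r = (\<Sum>i\<in>{1..j}. cnj (c i) * b (u i) r)"
      unfolding w_def by (rule b.sum_left) (use uU U in auto)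
    also have "\<dots> = (\<Sum>i\<in>{1..j}. \<Sum>k\<in>{1..j}. cnj (c i) * c k * a (e i) (e k) / complex_of_real (lam i))"
    proof (rule sum.cong[OF refl])
      fix i assume i: "i \<in> {1..j}"
      hence il: "i \<in> {1..l}" using jl by auto
      have "a (ritz_proj (u i)) r = 0"
        unfolding r_def by (subst a.sum_right) (use uU V_U[OF ritz_proj_V] ritz_proj_orth[OF _ ritz_proj_V] in auto)
      hence "a (u i) r = a (e i) r" using uU(1)[OF i] U(3) V_U[OF ritz_proj_V] by (simp add: a.diff_left)
      also have "\<dots> = (\<Sum>k\<in>{1..j}. c k * a (e i) (e k))"
        unfolding r_def by (rule a.sum_right) (use uU i in auto)
      finally have "complex_of_real (lam i) * b (u i) r = (\<Sum>k\<in>{1..j}. c k * a (e i) (e k))"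
        using u_eigen[OF il U(3)] by simp
      hence "b (u i) r = (\<Sum>k\<in>{1..j}. c k * a (e i) (e k)) / complex_of_real (lam i)"
        using lam_pos[OF il] by (simp add: field_simps)
      thus "cnj (c i) * b (u i) r = (\<Sum>k\<in>{1..j}. cnj (c i) * c k * a (e i) (e k) / complex_of_real (lam i))"
        by (simp add: sum_distrib_left sum_divide_distrib mult.assoc)
    qed
    finally show ?thesis .
  qed
  hence "cmod (b w r) \<le> (\<Sum>i\<in>{1..j}. \<Sum>k\<in>{1..j}. cmod (cnj (c i) * c k * a (e i) (e k) / complex_of_real (lam i)))"
    by (auto intro!: order_trans[OF norm_sum] sum_mono)
  also have "\<dots> \<le> (\<Sum>i\<in>{1..j}. \<Sum>k\<in>{1..j}. s * \<delta> / lam 1)"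
  proof (intro sum_mono)
    fix i k assume ik: "i \<in> {1..j}" "k \<in> {1..j}"
    hence il: "i \<in> {1..l}" using jl by auto
    have "cmod (cnj (c i) * c k * a (e i) (e k) / complex_of_real (lam i)) = (cmod (c i) * cmod (c k)) * cmod (a (e i) (e k)) / lam i"
      using lam_pos[OF il] by (simp add: norm_mult norm_divide)
    also have "\<dots> \<le> s * \<delta> / lam 1"
      using lam_pos[OF one] lam_mono[OF one il] ik s \<delta>0
      by (intro frac_le mult_mono cc ee mult_nonneg_nonneg) auto
    finally show "cmod (cnj (c i) * c k * a (e i) (e k) / complex_of_real (lam i)) \<le> s * \<delta> / lam 1" .
  qed
  also have "\<dots> = real j ^ 2 * (s * \<delta> / lam 1)" by (simp add: power2_eq_square)
  also have "\<dots> \<le> real l ^ 2 * (s * \<delta> / lam 1)"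
    using j s \<delta>0 lam_pos[OF one] by (intro mult_right_mono power_mono) auto
  finally have bwr: "cmod (b w r) \<le> real l ^ 2 * (s * \<delta> / lam 1)" .
  have "b.q x = b.q w - 2 * Re (b w r) + b.q r"
    using b.q_diff[OF U(1,3)] by (simp add: wxr)
  hence bx: "b.q x \<ge> s - 2 * (real l ^ 2 * (s * \<delta> / lam 1))"
    using bw b.nonneg[OF U(3)] bwr complex_Re_le_cmod[of "b w r"] by linarith
  have Lbx: "L j * b.q x \<le> a.q x"
  proof -
    have z: "b (v k) x = 0" if k: "k \<in> {1..<j}" for k
    proof -
      have "b (v k) x = (\<Sum>i\<in>{1..j}. c i * b (v k) (ritz_proj (u i)))"
        unfolding x_def by (rule b.sum_right) (use v_U V_U[OF ritz_proj_V] k jn in auto)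
      thus ?thesis using c(2)[OF k] by (simp add: mult.commute)
    qed
    have "(\<Sum>k\<in>{1..n}. L j * (cmod (b (v k) x))\<^sup>2) \<le> (\<Sum>k\<in>{1..n}. L k * (cmod (b (v k) x))\<^sup>2)"
    proof (rule sum_mono)
      fix k assume k: "k \<in> {1..n}"
      show "L j * (cmod (b (v k) x))\<^sup>2 \<le> L k * (cmod (b (v k) x))\<^sup>2"
      proof (cases "k < j")
        case True
        thus ?thesis using z[of k] k by simp
      next
        case False
        thus ?thesis using L_mono k jn by (intro mult_right_mono) (auto simp: mono_on_def)
      qed
    qed
    moreover have "a.q x = (\<Sum>k\<in>{1..n}. L k * (cmod (b (v k) x))\<^sup>2)" "b.q x = (\<Sum>k\<in>{1..n}. (cmod (b (v k) x))\<^sup>2)"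
      using q_expansion[of "{1..n}" "\<lambda>k. b (v k) x"] by (simp_all only: expansion[OF xV, symmetric] order_refl)
    ultimately show ?thesis by (simp only: sum_distrib_left)
  qed
  have "(L j * (1 - 2 * real l ^ 2 / lam 1 * \<delta>)) * s = L j * (s - 2 * (real l ^ 2 * (s * \<delta> / lam 1)))"
    by (simp add: algebra_simps)
  also have "\<dots> \<le> L j * b.q x" using bx L_pos[OF jn] by (intro mult_left_mono) auto
  also have "\<dots> \<le> lam j * s" using Lbx ax by linarith
  finally show ?thesis using s by simp
qed

lemma low_coefficient:
  assumes k: "k \<in> {1..l}" and j: "j \<in> {1..n}" and gap: "lam k < L j"
  shows "(cmod (b (u k) (v j)))\<^sup>2 \<le> (L j / (L j - lam k))\<^sup>2 * (Cb * \<delta>)"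
proof -
  note vj = v_U[OF j] and uk = u_U[OF k] and ek = e_U[OF k] and rk = V_U[OF ritz_proj_V[of "u k"]]
  have "a (e k) (v j) = cnj (a (v j) (e k))" by (rule a.herm[OF ek vj])
  also have "\<dots> = 0" using ritz_proj_orth[OF uk v_in[OF j]] by simp
  \<comment> \<open>Since \<open>e k\<close> is \<open>a\<close>-orthogonal to the trial space,
    \<open>u k\<close> may be replaced by its projection, to which the Galerkin equation of
    \<open>v j\<close> applies.\<close>
  finally have "a (u k) (v j) = a (ritz_proj (u k)) (v j)" using uk rk vj by (simp add: a.diff_left)
  also have "\<dots> = complex_of_real (L j) * b (ritz_proj (u k)) (v j)" by (rule a_v[OF ritz_proj_V j])
  also have "b (ritz_proj (u k)) (v j) = b (u k) (v j) - b (e k) (v j)" using uk rk vj by (simp add: b.diff_left)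
  finally have "complex_of_real (lam k) * b (u k) (v j) = complex_of_real (L j) * (b (u k) (v j) - b (e k) (v j))"
    using u_eigen[OF k vj] by simp
  hence "complex_of_real (L j - lam k) * b (u k) (v j) = complex_of_real (L j) * b (e k) (v j)"
    by (simp add: algebra_simps)
  hence eq: "b (u k) (v j) = complex_of_real (L j / (L j - lam k)) * b (e k) (v j)"
    using gap by (simp add: field_simps)
  have "(cmod (b (e k) (v j)))\<^sup>2 \<le> b.q (e k) * b.q (v j)" by (rule b.CS[OF ek vj])
  also have "\<dots> = b.q (e k)" using v_b[OF j j] by simp
  also have "\<dots> \<le> Cb * a.q (e k)" by (rule Cb(2)[OF ek])
  also have "\<dots> \<le> Cb * \<delta>" using e_le[OF k] Cb(1) by simp
  finally have "(cmod (b (e k) (v j)))\<^sup>2 \<le> Cb * \<delta>" .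
  thus ?thesis unfolding eq norm_mult power_mult_distrib norm_of_real power2_abs
    by (rule mult_left_mono) simp
qed

text \<open>The lower part, \<open>m\<close> and \<open>x\<close> are mutually orthogonal for both
  forms, so \<open>a.q (v j) = L j\<close> and \<open>b.q (v j) = 1\<close> split into sums.
  Subtracting \<open>lam j\<close> times the second identity from the first bounds
  \<open>a.q x - lam j * b.q x\<close> by \<open>L j - lam j + lam j * B\<close>, where
  \<open>B\<close> is the \<open>b\<close>-mass of the lower part. The gap up to
  \<open>\<Lambda>\<close> makes the left side at least
  \<open>(1 - lam j / \<Lambda>) * a.q x\<close>.\<close>

lemma eigenvector_distance:
  assumes j: "j \<in> {1..l}" and m: "m \<in> U" and x: "x \<in> U"
    and dec: "v j = (\<Sum>k\<in>{k\<in>{1..l}. lam k < lam j}. b (u k) (v j) *\<^sub>C u k) + m + x"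
    and um: "\<And>k. k \<in> {1..l} \<Longrightarrow> lam k < lam j \<Longrightarrow> b (u k) m = 0"
    and ux: "\<And>k. k \<in> {1..l} \<Longrightarrow> lam k < lam j \<Longrightarrow> b (u k) x = 0"
    and m_eigen: "\<And>y. y \<in> U \<Longrightarrow> a m y = complex_of_real (lam j) * b m y"
    and mx: "b m x = 0" and up: "\<Lambda> * b.q x \<le> a.q x" and \<Lambda>: "lam j < \<Lambda>"
  defines "B \<equiv> (\<Sum>k\<in>{k\<in>{1..l}. lam k < lam j}. (cmod (b (u k) (v j)))\<^sup>2)"
  shows "a.q (v j - m) \<le> \<Lambda> / (\<Lambda> - lam j) * (L j - lam j + lam j * B) + lam j * B"
    and "b.q m = 1 - b.q (v j - m)" and "a.q m = lam j * b.q m"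
proof -
  let ?K = "{k\<in>{1..l}. lam k < lam j}" and ?c = "\<lambda>k. b (u k) (v j)"
  have jn: "j \<in> {1..n}" using j l_n by auto
  define w where "w = (\<Sum>k\<in>?K. ?c k *\<^sub>C u k)"
  have K: "\<And>k. k \<in> ?K \<Longrightarrow> u k \<in> U" using u_U by blast
  have w: "w \<in> U" unfolding w_def by (intro a.U_sum a.U_scale K)
  have vj: "v j = w + m + x" using dec by (simp add: w_def)
  have bu: "b (u k) w = ?c k" if k: "k \<in> ?K" for k
  proof -
    have "b (u k) w = (\<Sum>i\<in>?K. ?c i * b (u k) (u i))"
      unfolding w_def by (rule b.sum_right) (use K k in auto)
    also have "\<dots> = (\<Sum>i\<in>?K. if i = k then ?c k else 0)" by (rule sum.cong) (use u_b k in auto)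
    finally show ?thesis using k by simp
  qed
  have sq: "cnj z * z = complex_of_real ((cmod z)\<^sup>2)" for z
    by (simp only: complex_norm_square mult.commute)
  have bw: "b.q w = B"
  proof -
    have "b w w = (\<Sum>k\<in>?K. cnj (?c k) * b (u k) w)"
      by (subst (1) w_def) (rule b.sum_left, use K w in auto)
    also have "\<dots> = complex_of_real B" unfolding B_def of_real_sum by (rule sum.cong) (simp_all only: bu sq)
    finally show ?thesis by simp
  qed
  have aw_le: "a.q w \<le> lam j * B" and aw_nonneg: "0 \<le> a.q w"
  proof -
    have "a w w = (\<Sum>k\<in>?K. cnj (?c k) * a (u k) w)"
      by (subst (1) w_def) (rule a.sum_left, use K w in auto)
    also have "\<dots> = (\<Sum>k\<in>?K. complex_of_real (lam k * (cmod (?c k))\<^sup>2))"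
    proof (rule sum.cong[OF refl])
      fix k assume k: "k \<in> ?K"
      hence "a (u k) w = complex_of_real (lam k) * b (u k) w" using u_eigen w by blast
      hence "cnj (?c k) * a (u k) w = complex_of_real (lam k) * (cnj (?c k) * ?c k)" by (simp add: bu[OF k])
      thus "cnj (?c k) * a (u k) w = complex_of_real (lam k * (cmod (?c k))\<^sup>2)" by (simp only: sq of_real_mult)
    qed
    finally have "a.q w = (\<Sum>k\<in>?K. lam k * (cmod (?c k))\<^sup>2)" by (simp add: Re_sum)
    also have "\<dots> \<le> (\<Sum>k\<in>?K. lam j * (cmod (?c k))\<^sup>2)" by (intro sum_mono mult_right_mono) auto
    finally show "a.q w \<le> lam j * B" by (simp add: B_def sum_distrib_left)
    show "0 \<le> a.q w" by (rule a.nonneg[OF w])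
  qed
  have w0: "b w y = 0 \<and> a w y = 0" if y: "y \<in> U" "\<And>k. k \<in> ?K \<Longrightarrow> b (u k) y = 0" for y
  proof
    show "b w y = 0" unfolding w_def by (subst b.sum_left) (use K y in auto)
    have "a (u k) y = 0" if "k \<in> ?K" for k using u_eigen[of k y] y that by auto
    thus "a w y = 0" unfolding w_def by (subst a.sum_left) (use K y in auto)
  qed
  have wm: "b w m = 0" "a w m = 0" using w0[OF m] um by auto
  have wx: "b w x = 0" "a w x = 0" using w0[OF x] ux by auto
  have amx: "a m x = 0" using m_eigen[OF x] mx by simp
  have am: "a.q m = lam j * b.q m" using m_eigen[OF m] b.self[OF m] by simp
  thus "a.q m = lam j * b.q m" .
  have vm: "v j - m = w + x" using vj by simp
  have vwx: "v j = (w + x) + m" using vj by (simp add: ac_simps)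
  have q1: "a.q (w + x) = a.q w + a.q x" "b.q (w + x) = b.q w + b.q x"
    using a.q_add[OF w x] b.q_add[OF w x] wx by auto
  have cross: "a (w + x) m = 0" "b (w + x) m = 0"
    using a.add_left[OF w x m] b.add_left[OF w x m] wm a.herm[OF x m] b.herm[OF x m] amx mx by auto
  have q2: "a.q (v j) = a.q (w + x) + a.q m" "b.q (v j) = b.q (w + x) + b.q m"
    unfolding vwx using a.q_add[OF a.U_add[OF w x] m] b.q_add[OF a.U_add[OF w x] m] cross by auto
  have one: "b.q (v j) = 1" and Lj: "a.q (v j) = L j" using v_b[OF jn jn] v_a[OF jn jn] by auto
  show "b.q m = 1 - b.q (v j - m)" using q2 one vm by simp
  have "a.q x - lam j * b.q x \<le> L j - lam j + lam j * B"
  proof -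
    have "lam j * (B + b.q x + b.q m) = lam j" using q1 q2 one bw by simp
    thus ?thesis using q1 q2 Lj am aw_nonneg by (simp add: algebra_simps)
  qed
  moreover have "(1 - lam j / \<Lambda>) * a.q x \<le> a.q x - lam j * b.q x"
  proof -
    have lj: "0 < lam j" by (rule lam_pos[OF j])
    have "lam j * b.q x \<le> lam j * (a.q x / \<Lambda>)"
      using up lj \<Lambda> by (intro mult_left_mono) (auto simp: field_simps)
    thus ?thesis by (simp add: left_diff_distrib)
  qed
  ultimately have "(1 - lam j / \<Lambda>) * a.q x \<le> L j - lam j + lam j * B" by linarith
  moreover have "1 - lam j / \<Lambda> = (\<Lambda> - lam j) / \<Lambda>" "\<Lambda> > 0"
    using lam_pos[OF j] \<Lambda> by (auto simp: field_simps)
  ultimately have "a.q x \<le> \<Lambda> / (\<Lambda> - lam j) * (L j - lam j + lam j * B)"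
    using \<Lambda> by (simp add: field_simps)
  thus "a.q (v j - m) \<le> \<Lambda> / (\<Lambda> - lam j) * (L j - lam j + lam j * B) + lam j * B"
    unfolding vm q1 using aw_le by linarith
qed

end

section \<open>Convergence rates\<close>

text \<open>The vector is split into listed eigenvectors below \<open>lam j\<close>, a component
  \<open>m\<close> in \<open>W\<close> and a remainder \<open>x\<close> above
  \<open>\<Lambda>\<close>. In the application \<open>W\<close> is the full eigenspace, possibly
  larger than the span of the vectors with index up to \<open>l\<close>, which is why
  \<open>m\<close> is not expanded.\<close>

definition spectral_splitting where
  "spectral_splitting U W a b l lam u j \<Lambda> z \<longleftrightarrow> (\<exists>m x. m \<in> W \<and> m \<in> U \<and> x \<in> U \<and>
      z = (\<Sum>k\<in>{k\<in>{1..l::nat}. lam k < (lam j :: real)}. b (u k) z *\<^sub>C (u k :: 'a::complex_hilbert)) + m + x \<and>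
      (\<forall>k\<in>{1..l}. lam k < lam j \<longrightarrow> b (u k) m = 0 \<and> b (u k) x = 0) \<and>
      (\<forall>y\<in>U. a m y = complex_of_real (lam j) * b m y) \<and> b m x = 0 \<and> \<Lambda> * Re (b x x) \<le> Re (a x x))"

text \<open>The constants depend on the forms, on \<open>l\<close>, on the eigenvalues and on
  \<open>\<Lambda>\<close>, but not on \<open>n\<close>; this lets a rate for
  \<open>\<delta>\<close> pass to Ritz values and Ritz vectors.\<close>

lemma ritz_uniform_estimate:
  fixes U :: "'a::complex_hilbert set" and L :: "nat \<Rightarrow> nat \<Rightarrow> real" and v :: "nat \<Rightarrow> nat \<Rightarrow> 'a"
  assumes ritz: "\<And>n. n \<ge> l \<Longrightarrow> ritz_eigen U a b Cb p n (L n) (v n) l lam u (\<delta> n)"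
    and j: "j \<in> {1..l}" and \<Lambda>: "lam j < \<Lambda>"
    and W: "\<And>m c. m \<in> W \<Longrightarrow> c *\<^sub>C m \<in> W"
    and decomp: "\<And>z. z \<in> U \<Longrightarrow> spectral_splitting U W a b l lam u j \<Lambda> z"
  shows "\<exists>C\<ge>0. \<exists>d>0. \<forall>n\<ge>l. \<delta> n \<le> d \<longrightarrow> 0 \<le> L n j - lam j \<and> L n j - lam j \<le> C * \<delta> n \<and>
    (\<exists>w\<in>W. w \<in> U \<and> Re (b w w) = 1 \<and> Re (a (w - v n j) (w - v n j)) \<le> C * \<delta> n)"
proof -
  let ?K = "{k\<in>{1..l}. lam k < lam j}"
  interpret R0: ritz_eigen U a b Cb p l "L l" "v l" l lam u "\<delta> l" by (rule ritz[OF order_refl])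
  have one: "1 \<in> {1..l}" using j by auto
  have lj: "lam j > 0" and l1: "lam 1 > 0" using R0.lam_pos[OF j] R0.lam_pos[OF one] by auto
  have Cb: "Cb > 0" by (rule R0.Cb)
  \<comment> \<open>\<open>K0\<close> is the constant of \<open>eigenvalue_upper\<close>. Once
    \<open>K0 * \<delta> n\<close> is at most 1/2 it gives \<open>L n j \<le> 2 * lam j\<close>,
    whence the factors 2 in \<open>C1\<close> and \<open>C2\<close>. \<open>C3\<close> collects
    \<open>eigenvector_distance\<close>, and \<open>C4\<close> adds the cost of normalizing. The
    threshold \<open>d\<close> also keeps \<open>Cb * C3 * \<delta> n\<close> at most 1/2, so that
    the eigenspace component stays away from zero.\<close>
  define K0 where "K0 = 2 * real l ^ 2 / lam 1"
  define C1 where "C1 = 2 * K0 * lam j"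
  define C2 where "C2 = (\<Sum>k\<in>?K. (2 * lam j / (lam j - lam k))\<^sup>2 * Cb)"
  define C3 where "C3 = \<Lambda> / (\<Lambda> - lam j) * (C1 + lam j * C2) + lam j * C2"
  define C4 where "C4 = 2 * (lam j * Cb * C3) + 2 * C3"
  define d where "d = min (1 / (2 * K0 + 1)) (1 / (2 * Cb * C3 + 1)) / 2"
  have K0: "K0 \<ge> 0" using l1 by (simp add: K0_def)
  have C1: "C1 \<ge> 0" using K0 lj by (simp add: C1_def)
  have C2: "C2 \<ge> 0" unfolding C2_def using Cb by (intro sum_nonneg) simp
  have r: "\<Lambda> / (\<Lambda> - lam j) \<ge> 0" using \<Lambda> lj by simp
  have C3: "C3 \<ge> 0" unfolding C3_def using r C1 C2 lj by (intro add_nonneg_nonneg mult_nonneg_nonneg) auto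
  have C4: "C4 \<ge> 0" using C3 lj Cb by (simp add: C4_def)
  have half: "min x y / 2 > 0 \<and> min x y / 2 \<le> x \<and> min x y / 2 \<le> y" if "x > 0" "y > 0" for x y :: real
    using that by (auto simp: min_def)
  have "1 / (2 * K0 + 1) > 0" "1 / (2 * Cb * C3 + 1) > 0" using K0 C3 Cb by (simp_all add: add_nonneg_pos)
  from half[OF this] have d: "d > 0" "d \<le> 1 / (2 * K0 + 1)" "d \<le> 1 / (2 * Cb * C3 + 1)"
    unfolding d_def by blast+
  have "0 \<le> L n j - lam j \<and> L n j - lam j \<le> (C1 + C4) * \<delta> n \<and>
      (\<exists>w\<in>W. w \<in> U \<and> Re (b w w) = 1 \<and> Re (a (w - v n j) (w - v n j)) \<le> (C1 + C4) * \<delta> n)"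
    if n: "n \<ge> l" and small: "\<delta> n \<le> d" for n
  proof -
    interpret ritz_eigen U a b Cb p n "L n" "v n" l lam u "\<delta> n" by (rule ritz[OF n])
    have jn: "j \<in> {1..n}" using j n by auto
    have \<delta>0: "\<delta> n \<ge> 0" using R0.a.nonneg[OF e_U[OF j]] e_le[OF j] by linarith
    have "\<delta> n \<le> 1 / (2 * K0 + 1)" using small d by linarith
    hence "K0 * \<delta> n \<le> K0 * (1 / (2 * K0 + 1))" using K0 by (intro mult_left_mono) auto
    also have "\<dots> \<le> 1 / 2" using K0 by (simp add: field_simps)
    finally have s1: "K0 * \<delta> n \<le> 1 / 2" .
    have "\<delta> n \<le> 1 / (2 * Cb * C3 + 1)" using small d by linarith
    hence "(Cb * C3) * \<delta> n \<le> (Cb * C3) * (1 / (2 * Cb * C3 + 1))" using C3 Cb by (intro mult_left_mono) auto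
    also have "\<dots> \<le> 1 / 2"
    proof -
      have "0 < 2 * Cb * C3 + 1" using C3 Cb by (simp add: add_nonneg_pos)
      thus ?thesis by (simp add: field_simps)
    qed
    finally have s2: "Cb * C3 * \<delta> n \<le> 1 / 2" .
    have low: "lam j \<le> L n j" by (rule eigenvalue_lower[OF j])
    have up: "L n j * (1 - K0 * \<delta> n) \<le> lam j" using eigenvalue_upper[OF j] by (simp add: K0_def)
    have "L n j * (1 / 2) \<le> L n j * (1 - K0 * \<delta> n)" using s1 low lj by (intro mult_left_mono) auto
    hence L2: "L n j \<le> 2 * lam j" using up by linarith
    have "L n j - lam j \<le> L n j * (K0 * \<delta> n)" using up by (simp add: algebra_simps)
    also have "\<dots> \<le> 2 * lam j * (K0 * \<delta> n)" using K0 \<delta>0 by (intro mult_right_mono L2) simp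
    finally have L1: "L n j - lam j \<le> C1 * \<delta> n" by (simp add: C1_def mult_ac)
    define B where "B = (\<Sum>k\<in>?K. (cmod (b (u k) (v n j)))\<^sup>2)"
    have B: "B \<le> C2 * \<delta> n" unfolding B_def C2_def sum_distrib_right
    proof (rule sum_mono)
      fix k assume k: "k \<in> ?K"
      have "(cmod (b (u k) (v n j)))\<^sup>2 \<le> (L n j / (L n j - lam k))\<^sup>2 * (Cb * \<delta> n)"
        by (rule low_coefficient) (use k jn low in auto)
      also have "\<dots> \<le> (2 * lam j / (lam j - lam k))\<^sup>2 * (Cb * \<delta> n)"
        using k low lj L2 Cb \<delta>0 by (intro mult_right_mono power_mono frac_le) auto
      finally show "(cmod (b (u k) (v n j)))\<^sup>2 \<le> (2 * lam j / (lam j - lam k))\<^sup>2 * Cb * \<delta> n" by (simp add: mult.assoc)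
    qed
    from decomp[OF v_U[OF jn]] obtain m x where mx: "m \<in> W" "m \<in> U" "x \<in> U"
      "v n j = (\<Sum>k\<in>?K. b (u k) (v n j) *\<^sub>C u k) + m + x"
      "\<And>k. k \<in> {1..l} \<Longrightarrow> lam k < lam j \<Longrightarrow> b (u k) m = 0" "\<And>k. k \<in> {1..l} \<Longrightarrow> lam k < lam j \<Longrightarrow> b (u k) x = 0"
      "\<And>y. y \<in> U \<Longrightarrow> a m y = complex_of_real (lam j) * b m y" "b m x = 0" "\<Lambda> * R0.b.q x \<le> R0.a.q x"
      unfolding spectral_splitting_def by blast
    note dist = eigenvector_distance[OF j mx(2-9) \<Lambda>, folded B_def]
    have "R0.a.q (v n j - m) \<le> \<Lambda> / (\<Lambda> - lam j) * (L n j - lam j + lam j * B) + lam j * B" by (rule dist)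
    also have "\<dots> \<le> \<Lambda> / (\<Lambda> - lam j) * (C1 * \<delta> n + lam j * (C2 * \<delta> n)) + lam j * (C2 * \<delta> n)"
      using r lj by (intro add_mono mult_left_mono L1 B) auto
    also have "\<dots> = C3 * \<delta> n" by (simp only: C3_def distrib_right distrib_left mult.assoc)
    finally have A3: "R0.a.q (v n j - m) \<le> C3 * \<delta> n" .
    have vm: "v n j - m \<in> U" by (intro R0.a.U_diff v_U jn mx)
    have "R0.b.q (v n j - m) \<le> Cb * (C3 * \<delta> n)"
      using Cb(1) A3 by (intro order_trans[OF R0.Cb(2)[OF vm]] mult_left_mono) auto
    hence b3: "R0.b.q (v n j - m) \<le> Cb * C3 * \<delta> n" by (simp add: mult.assoc)
    define \<beta> where "\<beta> = sqrt (R0.b.q m)"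
    have qm: "R0.b.q m \<ge> 1 / 2" "R0.b.q m \<le> 1" using dist(2) b3 s2 R0.b.nonneg[OF vm] by auto
    have \<beta>: "\<beta> > 0" "\<beta> \<le> 1" "\<beta>\<^sup>2 = R0.b.q m" using qm by (auto simp: \<beta>_def)
    define w where "w = complex_of_real (1 / \<beta>) *\<^sub>C m"
    have wU: "w \<in> U" unfolding w_def by (intro R0.a.U_scale mx)
    have bw: "R0.b.q w = 1" unfolding w_def R0.b.q_scale[OF mx(2)] norm_of_real \<beta>(3)[symmetric]
      using \<beta>(1) by (simp add: power_divide)
    have "w - m = complex_of_real (1 / \<beta> - 1) *\<^sub>C m"
      by (simp add: w_def complex_vector.scale_left_diff_distrib)
    hence "R0.a.q (w - m) = (1 / \<beta> - 1)\<^sup>2 * (lam j * \<beta>\<^sup>2)"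
      using \<beta>(3) dist(3) by (simp only: R0.a.q_scale[OF mx(2)] norm_of_real power2_abs)
    also have "\<dots> = lam j * (1 - \<beta>)\<^sup>2" using \<beta>(1) by (simp add: field_simps power2_eq_square)
    \<comment> \<open>As \<open>0 < \<beta> \<le> 1\<close>, the square of
      \<open>1 - \<beta>\<close> is at most \<open>1 - \<beta>\<^sup>2\<close>, which equals the
      \<open>b\<close>-mass of \<open>v n j - m\<close>. Normalizing therefore costs no
      order.\<close>
    also have "\<dots> \<le> lam j * ((1 - \<beta>) * (1 + \<beta>))"
      using \<beta> lj by (intro mult_left_mono) (auto simp: power2_eq_square intro!: mult_left_mono)
    also have "(1 - \<beta>) * (1 + \<beta>) = R0.b.q (v n j - m)" using dist(2) \<beta>(3) by (simp add: power2_eq_square algebra_simps)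
    also have "lam j * R0.b.q (v n j - m) \<le> lam j * (Cb * C3 * \<delta> n)" using lj by (intro mult_left_mono b3) simp
    finally have wm: "R0.a.q (w - m) \<le> lam j * Cb * C3 * \<delta> n" by (simp add: mult_ac)
    have "w - v n j = (w - m) + (-1) *\<^sub>C (v n j - m)"
      using complex_vector.scale_minus_left[of 1 "v n j - m"] by (simp add: scaleC_one)
    hence "R0.a.q (w - v n j) \<le> 2 * R0.a.q (w - m) + 2 * R0.a.q ((-1) *\<^sub>C (v n j - m))"
      using R0.a.q_add_le[OF R0.a.U_diff[OF wU mx(2)] R0.a.U_scale[OF vm, of "-1"]] by simp
    also have "R0.a.q ((-1) *\<^sub>C (v n j - m)) = R0.a.q (v n j - m)" unfolding R0.a.q_scale[OF vm] by simp
    also have "2 * R0.a.q (w - m) + 2 * R0.a.q (v n j - m) \<le> 2 * (lam j * Cb * C3 * \<delta> n) + 2 * (C3 * \<delta> n)"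
      using wm A3 by linarith
    also have "\<dots> = C4 * \<delta> n" by (simp add: C4_def algebra_simps)
    finally have "R0.a.q (w - v n j) \<le> C4 * \<delta> n" .
    moreover have "C4 * \<delta> n \<le> (C1 + C4) * \<delta> n" "C1 * \<delta> n \<le> (C1 + C4) * \<delta> n"
      using C1 C4 \<delta>0 by (auto intro: mult_right_mono)
    moreover have "w \<in> W" unfolding w_def by (intro W mx)
    ultimately show ?thesis using wU bw low L1 by (intro conjI bexI[of _ w]) auto
  qed
  thus ?thesis using C1 C4 d by (intro exI[of _ "C1 + C4"] conjI exI[of _ d]) auto
qed

section \<open>The forms of the scale and the spectrum near \<open>lam j\<close>\<close>

context posdef_selfadjoint begin

lemma hermitian_form_R:
  assumes "r \<le> r'"
  shows "hermitian_form (Dom r') (\<lambda>x y. g (R r x) (R r y))"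
proof
  note D = Dom_mono(1)[OF assms]
  show "csubspace (Dom r')" by (rule Dom_subspace)
  fix x y z c assume "x \<in> Dom r'" "y \<in> Dom r'" "z \<in> Dom r'"
  thus "g (R r x) (R r (y + z)) = g (R r x) (R r y) + g (R r x) (R r z)" by (simp add: R_add D g_add_right)
next
  note D = Dom_mono(1)[OF assms]
  fix x y c assume "x \<in> Dom r'" "y \<in> Dom r'"
  thus "g (R r x) (R r (c *\<^sub>C y)) = c * g (R r x) (R r y)" by (simp add: R_scaleC D g_scaleC_right)
next
  fix x y
  show "g (R r x) (R r y) = cnj (g (R r y) (R r x))" by (rule g_commute)
  show "0 \<le> Re (g (R r x) (R r x))" by (simp flip: ip_def)
qed

text \<open>Everything below \<open>lam j\<close> is below the essential spectrum, so gaps are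
  available there and the listed vectors span the eigenspaces. \<open>no_lower_part\<close> with
  bound \<open>lam j\<close> then asks for orthogonality to these vectors only.\<close>

lemma E_zero_below:
  assumes list: "eigenpair_listing g D S (essential_bottom D S) I lam u" and j: "j \<in> I"
    and x: "\<And>i. i \<in> I \<Longrightarrow> lam i < lam j \<Longrightarrow> g (u i) x = 0" and s: "s < lam j"
  shows "E s x = 0"
proof (rule no_lower_part[where bnd="ereal (lam j)"])
  have lj: "ereal (lam j) < essential_bottom D S" using list j by (auto simp: eigenpair_listing_def)
  fix t assume t: "ereal t < ereal (lam j)"
  hence tb: "ereal t < essential_bottom D S" using lj by (meson less_trans)
  show "\<exists>s>t. E s x = 0" if "E t x = 0"
    using gap_below_essential[OF tb] that by auto
  show "g e x = 0" if "e \<in> eigenspace D S (complex_of_real t)" for e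
    by (rule eigen_orth[OF list tb that]) (use x t in auto)
qed (use s in simp)

text \<open>Once \<open>E t\<close> has split off the eigenspace of \<open>t\<close>, the remainder lives above the next gap.\<close>

lemma upper_part:
  assumes low: "\<And>s. s < t \<Longrightarrow> E s x = 0" and gap: "\<And>y. E b y = E t y" and s: "s < b" and tb: "t \<le> b"
  shows "E s (x - E t x) = 0"
proof (cases "s < t")
  case True
  thus ?thesis by (simp add: E_diff E_mono low)
next
  case False
  have "E s x = E s (E b x)" using s by (simp add: E_mono)
  also have "\<dots> = E t x" using False by (simp add: gap E_mono2)
  finally show ?thesis using False by (simp add: E_diff E_mono2)
qed

end

lemma scale_norm_eq: "scale_norm DA A r x = sqrt (Re (scale_inner DA A r x x))"
  by (simp add: scale_norm_def scale_inner_def norm_eq_sqrt_inner inner_eq_Re_cinner)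

text \<open>\<open>N\<close> is the number of eigenvalues below the essential spectrum, counted with
  multiplicity and possibly infinite. The Ritz pairs \<open>L n\<close> and \<open>v n\<close> are
  arbitrary admissible choices, which covers the ambiguity at multiple Ritz values.\<close>

theorem proposition4p2:
  fixes DA DM :: "'a::complex_hilbert set" and A M :: "'a \<Rightarrow> 'a"
    and ipG :: "'a \<Rightarrow> 'a \<Rightarrow> complex"
    and N :: enat and lam mu :: "nat \<Rightarrow> real" and u q :: "nat \<Rightarrow> 'a"
    and l :: nat and \<tau> \<sigma> :: real
    and L :: "nat \<Rightarrow> nat \<Rightarrow> real" and v :: "nat \<Rightarrow> nat \<Rightarrow> 'a"
  assumes separable: "\<exists>X::'a set. countable X \<and> closure X = UNIV"
    and A_selfadjoint: "selfadjoint_op cinner DA A"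
    and A_posdef: "posdef_op cinner DA A"
    and A_eigen: "eigenpair_listing cinner DA A (essential_bottom DA A) {i. 1 \<le> i \<and> enat i \<le> N} lam u"
    and l_le: "1 \<le> l" "enat l \<le> N"
    and G0: "equivalent_cinner ipG"
    and M_selfadjoint: "selfadjoint_op ipG DM M"
    and M_posdef: "posdef_op ipG DM M"
    and M_compact: "compact_map (inv_into DM M)"
    and M_eigen: "eigenpair_listing ipG DM M \<infinity> {1..} mu q"
    and mu_lim: "filterlim mu at_top sequentially"
    and embed: "continuously_embedded DM (\<lambda>x. cnorm ipG (M x)) DA (\<lambda>x. norm (A x))"
    and tau: "0 \<le> \<tau>" "\<tau> \<le> 1"
    and sigma: "\<sigma> \<ge> \<tau>"
    and u_regular: "\<And>j. j \<in> {1..l} \<Longrightarrow> u j \<in> power_dom ipG DM M \<sigma>"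
    and RR: "\<And>n. rayleigh_ritz DA A \<tau> q n (L n) (v n)"
  shows "(\<forall>j\<in>{1..l}. (\<lambda>n. L n j - lam j) \<in> o(\<lambda>n. mu (n + 1) powr (2 * \<tau> - 2 * \<sigma>))) \<and>
    (\<exists>w :: nat \<Rightarrow> nat \<Rightarrow> 'a.
       (\<forall>\<^sub>F n in sequentially. \<forall>j\<in>{1..l}.
          w n j \<in> eigenspace DA A (complex_of_real (lam j)) \<and> scale_norm DA A (\<tau> - 1/2) (w n j) = 1) \<and>
       (\<forall>j\<in>{1..l}. (\<lambda>n. scale_norm DA A \<tau> (w n j - v n j)) \<in> o(\<lambda>n. mu (n + 1) powr (\<tau> - \<sigma>))))"
proof -
  interpret A: posdef_selfadjoint cinner DA A
    by (intro posdef_selfadjoint.intro posdef_selfadjoint_axioms.intro equiv_inner_cinner A_selfadjoint A_posdef)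
  interpret M: posdef_selfadjoint ipG DM M
    by (intro posdef_selfadjoint.intro posdef_selfadjoint_axioms.intro equiv_inner.intro G0 M_selfadjoint M_posdef)

  \<comment> \<open>The two forms and the normalized eigenvectors\<close>
  let ?I = "{i. 1 \<le> i \<and> enat i \<le> N}"
  let ?U = "A.Dom \<tau>" and ?a = "scale_inner DA A \<tau>" and ?b = "scale_inner DA A (\<tau> - 1/2)"
  have lI: "{1..l} \<subseteq> ?I" using l_le(2) by (auto intro: order_trans[OF _ l_le(2)])
  have u_eig: "\<And>i. i \<in> ?I \<Longrightarrow> u i \<in> eigenspace DA A (complex_of_real (lam i))"
    and lam0: "\<And>i. i \<in> ?I \<Longrightarrow> 0 < lam i"
    and lam_b: "\<And>i. i \<in> ?I \<Longrightarrow> ereal (lam i) < essential_bottom DA A"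
    and u_on: "\<And>i j. i \<in> ?I \<Longrightarrow> j \<in> ?I \<Longrightarrow> cinner (u i) (u j) = (if i = j then 1 else 0)"
    and lam_mono: "mono_on ?I lam"
    using A_eigen unfolding eigenpair_listing_def by blast+
  have lam_le: "lam i \<le> lam k" if "i \<in> ?I" "k \<in> ?I" "i \<le> k" for i k
    using lam_mono that by (auto simp: mono_on_def)
  have a_eq: "?a = (\<lambda>x y. cinner (A.R \<tau> x) (A.R \<tau> y))" and b_eq: "?b = (\<lambda>x y. cinner (A.R (\<tau> - 1/2) x) (A.R (\<tau> - 1/2) y))"
    by (simp_all add: fun_eq_iff scale_inner_def)
  interpret a: hermitian_form ?U ?a unfolding a_eq by (rule A.hermitian_form_R) simp
  interpret b: hermitian_form ?U ?b unfolding b_eq by (rule A.hermitian_form_R) simp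
  have qa: "a.q x = A.ip (A.R \<tau> x) (A.R \<tau> x)" and qb: "b.q x = A.ip (A.R (\<tau> - 1/2) x) (A.R (\<tau> - 1/2) x)" for x
    by (simp_all add: a_eq b_eq A.ip_def)
  \<comment> \<open>This is \<open>1 / \<alpha>\<close> for the lower bound \<open>\<alpha>\<close>
    of the spectrum of \<open>A\<close>: passing from index \<open>\<tau>\<close> to
    \<open>\<tau> - 1/2\<close> removes one factor \<open>t\<close> under the integral.\<close>
  define Cb where "Cb = (A.\<alpha> powr (\<tau> - 1/2 - \<tau>))\<^sup>2"
  have Cb: "Cb > 0" "\<And>x. x \<in> ?U \<Longrightarrow> b.q x \<le> Cb * a.q x"
    unfolding qa qb Cb_def using A.\<alpha>_pos A.Dom_mono(2)[of "\<tau> - 1/2" \<tau>] by auto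
  have D_U: "x \<in> ?U" if "x \<in> DA" for x by (rule A.D_subset_Dom[OF tau(2) that])
  have form_eig: "?a y x = complex_of_real (t powr (2 * \<tau>)) * cinner y x"
      "?b y x = complex_of_real (t powr (2 * \<tau> - 1)) * cinner y x"
    if y: "y \<in> eigenspace DA A (complex_of_real t)" and x: "x \<in> ?U" for y x t
  proof -
    show "?a y x = complex_of_real (t powr (2 * \<tau>)) * cinner y x"
      unfolding a_eq by (rule A.g_R_eigen[OF y x])
    have "x \<in> A.Dom (\<tau> - 1/2)" by (rule A.Dom_mono(1)[OF _ x]) simp
    from A.g_R_eigen[OF y this] show "?b y x = complex_of_real (t powr (2 * \<tau> - 1)) * cinner y x"
      by (simp add: b_eq algebra_simps)
  qed
  \<comment> \<open>The norm of \<open>u i\<close> with index \<open>\<tau> - 1/2\<close> is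
    \<open>lam i powr (\<tau> - 1/2)\<close>; the factor makes these vectors orthonormal for
    \<open>?b\<close>, as the Ritz vectors are.\<close>
  define u' where "u' i = complex_of_real (lam i powr (1/2 - \<tau>)) *\<^sub>C u i" for i
  have u'_eig: "u' i \<in> eigenspace DA A (complex_of_real (lam i))" if "i \<in> ?I" for i
    using u_eig[OF that] unfolding u'_def eigenspace_def
    by (simp add: complex_vector.subspace_scale[OF A.D_subspace] A.S_scaleC scaleC_scaleC mult.commute)
  have eig_U: "y \<in> ?U" if "y \<in> eigenspace DA A z" for y z
    using that by (intro D_U) (simp add: eigenspace_def)
  have ci: "cinner (u' i) x = complex_of_real (lam i powr (1/2 - \<tau>)) * cinner (u i) x" for i x
    unfolding u'_def by (simp add: A.g_scaleC_left)
  have bu: "?b (u' i) x = complex_of_real (lam i powr (\<tau> - 1/2)) * cinner (u i) x" if i: "i \<in> ?I" and x: "x \<in> ?U" for i x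
  proof -
    have "lam i powr (2 * \<tau> - 1) * lam i powr (1/2 - \<tau>) = lam i powr (\<tau> - 1/2)"
      by (simp add: powr_add[symmetric])
    thus ?thesis unfolding form_eig(2)[OF u'_eig[OF i] x] ci
      by (simp only: mult.assoc[symmetric] of_real_mult[symmetric])
  qed
  have bu0: "?b (u' i) x = 0 \<longleftrightarrow> cinner (u i) x = 0" if "i \<in> ?I" "x \<in> ?U" for i x
    using bu[OF that] lam0[OF that(1)] by simp
  have u'_b: "?b (u' i) (u' k) = (if i = k then 1 else 0)" if ik: "i \<in> ?I" "k \<in> ?I" for i k
  proof -
    have "?b (u' i) (u' k) = complex_of_real (lam i powr (\<tau> - 1/2) * lam k powr (1/2 - \<tau>)) * cinner (u i) (u k)"
      unfolding bu[OF ik(1) eig_U[OF u'_eig[OF ik(2)]]] by (simp add: u'_def A.g_scaleC_right)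
    thus ?thesis using u_on[OF ik] lam0[OF ik(1)] by (auto simp: powr_add[symmetric] simp flip: of_real_mult)
  qed
  have u'_a: "?a (u' i) x = complex_of_real (lam i) * ?b (u' i) x" if i: "i \<in> ?I" and x: "x \<in> ?U" for i x
  proof -
    have "lam i powr (2 * \<tau>) = lam i * lam i powr (2 * \<tau> - 1)"
      using lam0[OF i] by (simp add: powr_diff)
    thus ?thesis unfolding form_eig[OF u'_eig[OF i] x] by simp
  qed
  \<comment> \<open>A strictly smaller eigenvalue has a smaller index, so finitely many
    orthogonality relations control the whole spectrum below \<open>lam j\<close>.\<close>
  have below_I: "i \<in> {1..<j}" if "j \<in> {1..l}" "i \<in> ?I" "lam i < lam j" for i j
    using that lam_le[of j i] lI by (cases "i < j") auto
  have lower: "lam j * b.q x \<le> a.q x" if j: "j \<in> {1..l}" and x: "x \<in> ?U" and orth: "\<And>i. i \<in> {1..<j} \<Longrightarrow> ?b (u' i) x = 0" for j x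
  proof -
    have jI: "j \<in> ?I" using j lI by blast
    have "A.E s x = 0" if "s < lam j" for s
    proof (rule A.E_zero_below[OF A_eigen jI _ that])
      fix i assume i: "i \<in> ?I" "lam i < lam j"
      show "cinner (u i) x = 0" using orth[OF below_I[OF j i]] bu0[OF i(1) x] by simp
    qed
    thus ?thesis unfolding qa qb by (intro A.R_lower_bound lam0 jI x)
  qed

  \<comment> \<open>Splitting a vector at an eigenvalue\<close>
  have decomp: "\<exists>\<Lambda>>lam j. \<forall>z\<in>?U. spectral_splitting ?U (eigenspace DA A (complex_of_real (lam j))) ?a ?b l lam u' j \<Lambda> z"
    if j: "j \<in> {1..l}" for j
  proof -
    have jI: "j \<in> ?I" using j lI by blast
    from A.gap_below_essential[OF lam_b[OF jI]] obtain \<Lambda> where \<Lambda>: "\<Lambda> > lam j" "\<And>x. A.E \<Lambda> x = A.E (lam j) x" by blast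
    have "spectral_splitting ?U (eigenspace DA A (complex_of_real (lam j))) ?a ?b l lam u' j \<Lambda> z"
      if z: "z \<in> ?U" for z
    proof -
      let ?K = "{k\<in>{1..l}. lam k < lam j}"
      define low where "low = (\<Sum>k\<in>?K. ?b (u' k) z *\<^sub>C u' k)"
      have KI: "k \<in> ?I" "u' k \<in> ?U" if "k \<in> ?K" for k
        using that lI eig_U[OF u'_eig] by blast+
      have lowU: "low \<in> ?U" unfolding low_def by (intro a.U_sum a.U_scale KI)
      define y where "y = z - low"
      have yU: "y \<in> ?U" unfolding y_def by (intro a.U_diff z lowU)
      have by0: "?b (u' k) y = 0" if k: "k \<in> ?K" for k
      proof -
        have "?b (u' k) low = (\<Sum>i\<in>?K. ?b (u' i) z * ?b (u' k) (u' i))"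
          unfolding low_def by (rule b.sum_right) (use KI k in blast)+
        also have "\<dots> = (\<Sum>i\<in>?K. if i = k then ?b (u' k) z else 0)"
          by (rule sum.cong) (use u'_b KI(1) k in auto)
        also have "\<dots> = ?b (u' k) z" using k by simp
        finally show ?thesis unfolding y_def using b.diff_right[OF KI(2)[OF k] z lowU] by simp
      qed
      have cy: "cinner (u i) y = 0" if i: "i \<in> ?I" "lam i < lam j" for i
      proof -
        have "i \<in> ?K" using below_I[OF j i] i j by auto
        from by0[OF this] show ?thesis using bu0[OF i(1) yU] by simp
      qed
      have below: "A.E s y = 0" if "s < lam j" for s
        by (rule A.E_zero_below[OF A_eigen jI cy that])
      \<comment> \<open>\<open>y\<close> has no part below \<open>lam j\<close>, so its image is
        concentrated at \<open>lam j\<close>. The projection captures the whole eigenspace,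
        including listed vectors with index beyond \<open>l\<close>.\<close>
      define m where "m = A.E (lam j) y"
      have m: "m \<in> eigenspace DA A (complex_of_real (lam j))"
        unfolding m_def by (rule A.eigen_of_concentrated) (simp_all add: A.E_mono below)
      note mU = eig_U[OF m]
      define x where "x = y - m"
      have xU: "x \<in> ?U" unfolding x_def by (intro a.U_diff yU mU)
      have mx: "cinner m x = 0"
      proof -
        have "cinner m m = cinner m y" unfolding m_def by (metis A.E_g A.E_idem)
        thus ?thesis unfolding x_def by (simp add: A.g_diff_right)
      qed
      have um: "cinner (u k) m = 0" if k: "k \<in> ?K" for k
      proof -
        have "cinner (u k) m = cinner (A.E (lam j) (u k)) y" unfolding m_def by (rule A.E_g[symmetric])
        also have "A.E (lam j) (u k) = u k" using k by (simp add: A.E_eigen[OF u_eig[OF KI(1)[OF k]]])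
        also have "cinner (u k) y = 0" using cy[OF KI(1)[OF k]] k by simp
        finally show ?thesis .
      qed
      have x0: "cinner (u k) x = 0" if k: "k \<in> ?K" for k
        using um[OF k] cy[OF KI(1)[OF k]] k by (simp add: x_def A.g_diff_right)
      have "A.E s x = 0" if "s < \<Lambda>" for s
        unfolding x_def m_def by (rule A.upper_part[OF below \<Lambda>(2) that]) (use \<Lambda>(1) in auto)
      hence xup: "\<Lambda> * b.q x \<le> a.q x"
        unfolding qa qb using \<Lambda>(1) lam0[OF jI] by (intro A.R_lower_bound xU) auto
      have m_a: "?a m w = complex_of_real (lam j) * ?b m w" if w: "w \<in> ?U" for w
      proof -
        have "lam j powr (2 * \<tau>) = lam j * lam j powr (2 * \<tau> - 1)"
          using lam0[OF jI] by (simp add: powr_diff)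
        thus ?thesis unfolding form_eig[OF m w] by simp
      qed
      have "?b (u' k) m = 0 \<and> ?b (u' k) x = 0" if "k \<in> {1..l}" "lam k < lam j" for k
      proof -
        have k: "k \<in> ?K" using that by simp
        show ?thesis using bu0[OF KI(1)[OF k] mU] bu0[OF KI(1)[OF k] xU] um[OF k] x0[OF k] by simp
      qed
      moreover have "?b m x = 0" using form_eig(2)[OF m xU] mx by simp
      moreover have "z = low + m + x" by (simp add: x_def y_def)
      ultimately show ?thesis using m mU xU m_a xup unfolding low_def spectral_splitting_def by blast
    qed
    thus ?thesis using \<Lambda>(1) by blast
  qed

  \<comment> \<open>Approximation of the eigenvectors from the trial space\<close>
  obtain C where C: "DM \<subseteq> DA" "\<And>x. x \<in> DM \<Longrightarrow> norm (A x) \<le> C * cnorm ipG (M x)"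
    using embed by (auto simp: continuously_embedded_def)
  have "\<exists>K\<ge>0. \<forall>x. (\<integral>\<^sup>+t. ennreal ((t powr \<tau>)\<^sup>2) \<partial>A.nu x) \<le> ennreal K * (\<integral>\<^sup>+t. ennreal ((t powr \<tau>)\<^sup>2) \<partial>M.nu x)"
  proof (rule heinz_inequality[OF A.posdef_selfadjoint_axioms M.posdef_selfadjoint_axioms C(1) _ tau])
    show "cnorm cinner (A x) \<le> C * cnorm ipG (M x)" if "x \<in> DM" for x
      using C(2)[OF that] by (simp add: cnorm_def norm_eq_sqrt_inner inner_eq_Re_cinner)
  qed
  then obtain K where K: "K \<ge> 0" "\<And>x. (\<integral>\<^sup>+t. ennreal ((t powr \<tau>)\<^sup>2) \<partial>A.nu x) \<le> ennreal K * (\<integral>\<^sup>+t. ennreal ((t powr \<tau>)\<^sup>2) \<partial>M.nu x)" by blast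
  have q_eig: "\<And>k. k \<ge> 1 \<Longrightarrow> q k \<in> eigenspace DM M (complex_of_real (mu k))"
    and mu0: "\<And>k. k \<ge> 1 \<Longrightarrow> 0 < mu k" and mu_mono: "mono_on {1..} mu"
    using M_eigen unfolding eigenpair_listing_def by auto
  have qU: "q k \<in> ?U" if "k \<ge> 1" for k
    using q_eig[OF that] C(1) by (intro D_U) (auto simp: eigenspace_def)
  \<comment> \<open>Half of \<open>mu (n + 1)\<close> lies strictly below it, so
    \<open>mu k \<le> s n\<close> forces \<open>k \<le> n\<close> even for repeated eigenvalues,
    whereas the right-continuous \<open>M.E\<close> at \<open>mu (n + 1)\<close> would include that
    eigenvalue. The factor costs only a constant.\<close>
  define s where "s n = mu (n + 1) / 2" for n
  have s0: "s n > 0" for n using mu0[of "n + 1"] by (simp add: s_def)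
  have mu1_lim: "filterlim (\<lambda>n. mu (n + 1)) at_top sequentially"
    using mu_lim by (rule filterlim_compose) (rule filterlim_add_const_nat_at_top)
  have s_lim: "filterlim s at_top sequentially"
    unfolding s_def using filterlim_tendsto_pos_mult_at_top[OF tendsto_const _ mu1_lim, of "1/2"] by simp
  have approx: "M.E (s n) x \<in> lin_combs q n" for n x
  proof -
    have sub: "{k\<in>{1..}. mu k \<le> s n} \<subseteq> {1..n}"
    proof
      fix k assume k: "k \<in> {k\<in>{1..}. mu k \<le> s n}"
      show "k \<in> {1..n}"
      proof (rule ccontr)
        assume "k \<notin> {1..n}"
        hence "mu (n + 1) \<le> mu k" using mu_mono k by (auto simp: mono_on_def)
        thus False using k mu0[of "n + 1"] by (simp add: s_def)
      qed
    qed
    have "M.E (s n) x \<in> cspan (q ` {k\<in>{1..}. mu k \<le> s n})"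
      by (rule M.E_in_span[OF M_compact M_eigen finite_subset[OF sub]]) simp
    moreover have "q ` {k\<in>{1..}. mu k \<le> s n} \<subseteq> lin_combs q n"
    proof
      fix y assume "y \<in> q ` {k\<in>{1..}. mu k \<le> s n}"
      then obtain k where k: "k \<in> {1..n}" "y = q k" using sub by blast
      have "(\<Sum>m=1..n. (if m = k then 1 else 0) *\<^sub>C q m) = (\<Sum>m=1..n. if m = k then q k else 0)"
        by (rule sum.cong) (auto simp: scaleC_one)
      also have "\<dots> = q k" using k by simp
      finally show "y \<in> lin_combs q n" unfolding lin_combs_def k(2)
        by (auto intro!: exI[of _ "\<lambda>m. if m = k then 1 else 0"])
    qed
    ultimately show ?thesis using complex_vector.span_minimal[OF _ lin_combs_subspace] by blast
  qed
  define T where "T n = (\<Sum>i\<in>{1..l}. M.tail \<sigma> (u' i) (s n))" for n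
  define \<delta> where "\<delta> n = K * ((s n powr (\<tau> - \<sigma>))\<^sup>2 * T n)" for n
  have u'_reg: "u' i \<in> M.Dom \<sigma>" if "i \<in> {1..l}" for i
    unfolding u'_def by (rule complex_vector.subspace_scale[OF M.Dom_subspace u_regular[OF that]])
  have T_lim: "T \<longlonglongrightarrow> 0"
    unfolding T_def by (rule tendsto_null_sum) (rule M.tail_tendsto[OF u'_reg s_lim])
  have T0: "T n \<ge> 0" for n unfolding T_def by (intro sum_nonneg M.tail_nonneg)
  have \<delta>_bound: "a.q (u' i - M.E (s n) (u' i)) \<le> \<delta> n" if i: "i \<in> {1..l}" for i n
  proof -
    let ?x = "u' i - M.E (s n) (u' i)"
    \<comment> \<open>The cut-off vector lies in \<open>DM\<close>, and \<open>u' i\<close> lies in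
      \<open>DA\<close> as an eigenvector of \<open>A\<close>; so their difference is in
      \<open>?U\<close>.\<close>
    have "M.E (s n) (u' i) \<in> DM"
      by (rule M.in_D[where b="s n" and a=0]) (simp_all add: M.E_mono2 M.E_below_\<alpha>[OF M.\<alpha>_pos] M.E_mono s0 less_imp_le)
    hence EU: "M.E (s n) (u' i) \<in> ?U" using C(1) by (intro D_U) auto
    have xU: "?x \<in> ?U" using i lI by (intro a.U_diff EU eig_U[OF u'_eig]) auto
    have "ennreal (a.q ?x) = (\<integral>\<^sup>+t. ennreal ((t powr \<tau>)\<^sup>2) \<partial>A.nu ?x)"
      unfolding qa by (rule A.R_norm_nn[OF xU])
    also have "\<dots> \<le> ennreal K * (\<integral>\<^sup>+t. ennreal ((t powr \<tau>)\<^sup>2) \<partial>M.nu ?x)" by (rule K)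
    also have "\<dots> \<le> ennreal K * ennreal ((s n powr (\<tau> - \<sigma>))\<^sup>2 * M.tail \<sigma> (u' i) (s n))"
      by (intro mult_left_mono M.tail_bound u'_reg i s0 sigma) simp
    also have "\<dots> = ennreal (K * ((s n powr (\<tau> - \<sigma>))\<^sup>2 * M.tail \<sigma> (u' i) (s n)))"
      using K(1) M.tail_nonneg by (simp add: ennreal_mult)
    finally have "a.q ?x \<le> K * ((s n powr (\<tau> - \<sigma>))\<^sup>2 * M.tail \<sigma> (u' i) (s n))"
      using K(1) M.tail_nonneg by (subst (asm) ennreal_le_iff) auto
    also have "\<dots> \<le> \<delta> n" unfolding \<delta>_def T_def
      using K(1) i M.tail_nonneg by (intro mult_left_mono member_le_sum) auto
    finally show ?thesis .
  qed
  have ritz: "ritz_eigen ?U ?a ?b Cb q n (L n) (v n) l lam u' (\<delta> n)" if n: "n \<ge> l" for n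
  proof -
    have rr: "mono_on {1..n} (L n)"
      "\<And>i. i \<in> {1..n} \<Longrightarrow> \<exists>c. v n i = (\<Sum>m=1..n. c m *\<^sub>C q m)"
      "\<And>i j. i \<in> {1..n} \<Longrightarrow> j \<in> {1..n} \<Longrightarrow> ?b (v n i) (v n j) = (if i = j then 1 else 0)"
      "\<And>i j. i \<in> {1..n} \<Longrightarrow> j \<in> {1..n} \<Longrightarrow> ?a (v n i) (v n j) = (if i = j then complex_of_real (L n i) else 0)"
      using RR[of n] unfolding rayleigh_ritz_def by blast+
    show ?thesis
    proof (unfold_locales)
      show "0 < Cb" by (rule Cb)
      show "b.q x \<le> Cb * a.q x" if "x \<in> ?U" for x by (rule Cb(2)[OF that])
      show "q m \<in> ?U" if "m \<in> {1..n}" for m using qU that by simp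
      show "v n i \<in> lin_combs q n" if "i \<in> {1..n}" for i using rr(2)[OF that] by (auto simp: lin_combs_def)
      show "u' i \<in> ?U" if "i \<in> {1..l}" for i using that lI by (intro eig_U[OF u'_eig]) auto
      show "?a (u' i) x = complex_of_real (lam i) * ?b (u' i) x" if "i \<in> {1..l}" "x \<in> ?U" for i x
        using that lI by (intro u'_a) auto
      show "?b (u' i) (u' k) = (if i = k then 1 else 0)" if "i \<in> {1..l}" "k \<in> {1..l}" for i k
        using that lI by (intro u'_b) auto
      show "0 < lam i" if "i \<in> {1..l}" for i using that lI by (intro lam0) auto
      show "lam i \<le> lam k" if "i \<in> {1..l}" "k \<in> {1..l}" "i \<le> k" for i k using that lI by (intro lam_le) blast+
      show "lam j * b.q x \<le> a.q x" if "j \<in> {1..l}" "x \<in> ?U" "\<And>i. i \<in> {1..<j} \<Longrightarrow> ?b (u' i) x = 0" for j x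
        by (rule lower[OF that])
      show "l \<le> n" by (rule n)
      show "\<exists>y\<in>lin_combs q n. a.q (u' i - y) \<le> \<delta> n" if "i \<in> {1..l}" for i
        using approx \<delta>_bound[OF that] by blast
    qed (use rr in auto)
  qed
  have est: "\<exists>C\<ge>0. \<exists>d>0. \<forall>n\<ge>l. \<delta> n \<le> d \<longrightarrow> 0 \<le> L n j - lam j \<and> L n j - lam j \<le> C * \<delta> n \<and>
    (\<exists>w\<in>eigenspace DA A (complex_of_real (lam j)). w \<in> ?U \<and> b.q w = 1 \<and> a.q (w - v n j) \<le> C * \<delta> n)"
    if j: "j \<in> {1..l}" for j
  proof -
    from decomp[OF j] obtain \<Lambda> where \<Lambda>: "\<Lambda> > lam j" and dec: "\<forall>z\<in>?U. spectral_splitting ?U (eigenspace DA A (complex_of_real (lam j))) ?a ?b l lam u' j \<Lambda> z" by blast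
    show ?thesis
    proof (rule ritz_uniform_estimate[OF ritz j \<Lambda> _ bspec[OF dec]])
      show "c *\<^sub>C m \<in> eigenspace DA A (complex_of_real (lam j))" if "m \<in> eigenspace DA A (complex_of_real (lam j))" for m c
        using that unfolding eigenspace_def
        by (simp add: complex_vector.subspace_scale[OF A.D_subspace] A.S_scaleC scaleC_scaleC mult.commute)
    qed
  qed
  then obtain Cj dj where Cj: "\<And>j. j \<in> {1..l} \<Longrightarrow> Cj j \<ge> 0" "\<And>j. j \<in> {1..l} \<Longrightarrow> dj j > 0"
    and ej: "\<And>j n. j \<in> {1..l} \<Longrightarrow> n \<ge> l \<Longrightarrow> \<delta> n \<le> dj j \<Longrightarrow> 0 \<le> L n j - lam j \<and> L n j - lam j \<le> Cj j * \<delta> n \<and>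
    (\<exists>w\<in>eigenspace DA A (complex_of_real (lam j)). w \<in> ?U \<and> b.q w = 1 \<and> a.q (w - v n j) \<le> Cj j * \<delta> n)"
    by metis

  \<comment> \<open>From squared distances to the Landau symbols\<close>
  define \<epsilon> where "\<epsilon> n = mu (n + 1) powr (\<tau> - \<sigma>)" for n
  \<comment> \<open>The contribution of the factor 1/2 in \<open>s\<close> to the squared
    rate.\<close>
  define h where "h = ((1/2) powr (\<tau> - \<sigma>))\<^sup>2"
  have \<delta>_eq: "\<delta> n = K * h * T n * (\<epsilon> n)\<^sup>2" for n
  proof -
    have "s n powr (\<tau> - \<sigma>) = (1/2) powr (\<tau> - \<sigma>) * \<epsilon> n"
      using mu0[of "n + 1"] unfolding s_def \<epsilon>_def by (subst powr_mult[symmetric]) auto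
    thus ?thesis by (simp add: \<delta>_def h_def power_mult_distrib mult_ac)
  qed
  have \<epsilon>2: "mu (n + 1) powr (2 * \<tau> - 2 * \<sigma>) = (\<epsilon> n)\<^sup>2" for n
    unfolding \<epsilon>_def powr_power2 by (simp add: algebra_simps)
  have \<epsilon>0: "\<epsilon> n > 0" for n using mu0[of "n + 1"] by (simp add: \<epsilon>_def)
  \<comment> \<open>The exponent is nonpositive and \<open>mu\<close> tends to infinity. Together
    with the decay of \<open>T\<close> this brings \<open>\<delta> n\<close> below every
    threshold.\<close>
  have \<epsilon>1: "\<forall>\<^sub>F n in sequentially. \<epsilon> n \<le> 1"
  proof -
    have "\<forall>\<^sub>F n in sequentially. 1 \<le> mu (n + 1)" using mu1_lim by (simp add: filterlim_at_top)
    thus ?thesis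
    proof eventually_elim
      case (elim n)
      have "mu (n + 1) powr (\<tau> - \<sigma>) \<le> mu (n + 1) powr 0" using elim sigma by (intro powr_mono) auto
      thus ?case using elim by (simp add: \<epsilon>_def)
    qed
  qed
  have KhT: "\<forall>\<^sub>F n in sequentially. C * (K * h * T n) < c" if "c > 0" for C c
  proof -
    have "(\<lambda>n. C * (K * h * T n)) \<longlonglongrightarrow> C * (K * h * 0)" by (intro tendsto_intros T_lim)
    hence "(\<lambda>n. C * (K * h * T n)) \<longlonglongrightarrow> 0" by simp
    from order_tendstoD(2)[OF this that] show ?thesis .
  qed
  have small: "\<forall>\<^sub>F n in sequentially. n \<ge> l \<and> \<delta> n \<le> dj j" if j: "j \<in> {1..l}" for j
    using KhT[OF Cj(2)[OF j], of 1] \<epsilon>1 eventually_ge_at_top[of l]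
  proof eventually_elim
    case (elim n)
    have "(\<epsilon> n)\<^sup>2 \<le> 1" using elim \<epsilon>0[of n] by (simp add: power_le_one less_imp_le)
    hence "\<delta> n \<le> K * h * T n * 1"
      unfolding \<delta>_eq using K(1) T0[of n] by (intro mult_left_mono) (auto simp: h_def)
    thus ?case using elim by simp
  qed
  \<comment> \<open>For the finitely many \<open>n\<close> before the threshold is reached the value
    is unspecified, which is why the eigenvector properties are claimed eventually.\<close>
  define w where "w n j = (SOME w. w \<in> eigenspace DA A (complex_of_real (lam j)) \<and> w \<in> ?U \<and> b.q w = 1 \<and> a.q (w - v n j) \<le> Cj j * \<delta> n)" for n j
  have w: "w n j \<in> eigenspace DA A (complex_of_real (lam j)) \<and> w n j \<in> ?U \<and> b.q (w n j) = 1 \<and> a.q (w n j - v n j) \<le> Cj j * \<delta> n"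
    if "j \<in> {1..l}" "n \<ge> l" "\<delta> n \<le> dj j" for n j
  proof -
    from ej[OF that] have "\<exists>w. w \<in> eigenspace DA A (complex_of_real (lam j)) \<and> w \<in> ?U \<and> b.q w = 1 \<and> a.q (w - v n j) \<le> Cj j * \<delta> n" by blast
    thus ?thesis unfolding w_def by (rule someI_ex)
  qed
  have part1: "(\<lambda>n. L n j - lam j) \<in> o(\<lambda>n. mu (n + 1) powr (2 * \<tau> - 2 * \<sigma>))" if j: "j \<in> {1..l}" for j
  proof (rule landau_o.smallI)
    fix c :: real assume c: "c > 0"
    show "\<forall>\<^sub>F n in sequentially. norm (L n j - lam j) \<le> c * norm (mu (n + 1) powr (2 * \<tau> - 2 * \<sigma>))"
      using small[OF j] KhT[OF c, of "Cj j"]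
    proof eventually_elim
      case (elim n)
      hence "0 \<le> L n j - lam j" "L n j - lam j \<le> Cj j * \<delta> n" using ej[OF j, of n] by auto
      moreover have "Cj j * \<delta> n = Cj j * (K * h * T n) * (\<epsilon> n)\<^sup>2" by (simp add: \<delta>_eq)
      moreover have "\<dots> \<le> c * (\<epsilon> n)\<^sup>2" using elim by (intro mult_right_mono) auto
      ultimately show ?case unfolding \<epsilon>2 by simp
    qed
  qed
  have part2: "(\<lambda>n. scale_norm DA A \<tau> (w n j - v n j)) \<in> o(\<lambda>n. mu (n + 1) powr (\<tau> - \<sigma>))" if j: "j \<in> {1..l}" for j
  proof (rule landau_o.smallI)
    fix c :: real assume c: "c > 0"
    hence "c\<^sup>2 > 0" by simp
    show "\<forall>\<^sub>F n in sequentially. norm (scale_norm DA A \<tau> (w n j - v n j)) \<le> c * norm (mu (n + 1) powr (\<tau> - \<sigma>))"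
      using small[OF j] KhT[OF \<open>c\<^sup>2 > 0\<close>, of "Cj j"]
    proof eventually_elim
      case (elim n)
      hence "a.q (w n j - v n j) \<le> Cj j * \<delta> n" using w[OF j] by blast
      also have "\<dots> = Cj j * (K * h * T n) * (\<epsilon> n)\<^sup>2" by (simp add: \<delta>_eq)
      also have "\<dots> \<le> c\<^sup>2 * (\<epsilon> n)\<^sup>2" using elim by (intro mult_right_mono) auto
      also have "\<dots> = (c * \<epsilon> n)\<^sup>2" by (simp add: power_mult_distrib)
      finally have "sqrt (a.q (w n j - v n j)) \<le> c * \<epsilon> n"
        using c \<epsilon>0[of n] by (intro real_le_lsqrt) (auto simp: qa)
      moreover have "0 \<le> sqrt (a.q (w n j - v n j))" by (simp add: qa)
      ultimately show ?case unfolding scale_norm_eq \<epsilon>_def[symmetric] using \<epsilon>0[of n] by simp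
    qed
  qed
  have part3: "\<forall>\<^sub>F n in sequentially. \<forall>j\<in>{1..l}. w n j \<in> eigenspace DA A (complex_of_real (lam j)) \<and> scale_norm DA A (\<tau> - 1/2) (w n j) = 1"
  proof (rule eventually_ball_finite)
    show "\<forall>j\<in>{1..l}. \<forall>\<^sub>F n in sequentially. w n j \<in> eigenspace DA A (complex_of_real (lam j)) \<and> scale_norm DA A (\<tau> - 1/2) (w n j) = 1"
    proof
      fix j assume j: "j \<in> {1..l}"
      show "\<forall>\<^sub>F n in sequentially. w n j \<in> eigenspace DA A (complex_of_real (lam j)) \<and> scale_norm DA A (\<tau> - 1/2) (w n j) = 1"
        using small[OF j] by eventually_elim (use w[OF j] in \<open>simp add: scale_norm_eq\<close>)
    qed
  qed simp
  show ?thesis using part1 part2 part3 by (intro conjI ballI exI[of _ w])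
qed

end
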